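(* Let $S_\rho$ be a $k$-mins, $k$-partition or bottom-$k$ MinHash sketch, and run the adaptive attack described in the context against an arbitrary query-response algorithm that follows the interaction protocol. For $\alpha>0$, set $n=\Omega\!\left(\frac{1}{\alpha}k\log(kr)\right)$ and $r=\tilde{\Omega}\!\left(\frac{k^2}{\alpha^2}\right)$. Then with probability at least $0.99$, the final mask $M$ satisfies $|M|<\alpha n$, and there is no correct map (for threshold $A=n/16$ and error $\delta=O(1/\sqrt{k})$) for the query distribution of sets $M\cup U$ with $U\sim\mathcal{D}_0$.
   Context: Sketches. Keys come from a universe $\mathcal{U}$ and $\rho$ is the sketch randomness. $k$-mins: $k$ independent random hash functions $h_1,\dots,h_k$ with i.i.d. continuous values, $S_\rho(U)=(\min_{x\in U}h_i(x))_{i\in[k]}$. Bottom-$k$: one random hash $h$ with i.i.d. continuous values, $S_\rho(U)$ = the $k$ smallest values of $h$ on $U$. $k$-partition: a random hash $P:\mathcal{U}\to[k]$ and a random hash $h$ with i.i.d. $\mathrm{Exp}[1]$ values, $S_\rho(U)=(\min_{x\in U,P(x)=i}h(x))_{i\in[k]}$. Rate sampling (given $A,n$): $\omega=n/(2A)$, $\omega_a=\omega/2$, $D\sim U[0,\omega/4]$, $\omega^*_a=\omega_a+D$, $\omega^*_b=\omega^*_a+\frac74\omega$, and $q=1/X$ with $X\sim U[\omega^*_a,\omega^*_b]$. The distribution $\mathcal{D}_0$ on subsets of the ground set $N$: sample $q$ this way, then $U$ contains each key of $N$ independently with probability $q$. A map $\pi$ from sketches to $[0,1]$ is correct for threshold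 $A$, error $\delta$ and query distribution $\mathcal{D}$ if for every $c<A$, $\mathsf{E}_{U\sim\mathcal{D}\mid |U|=c}[\pi(S_\rho(U))]\le\delta$, and for every $c>2A$, $\mathsf{E}_{U\sim\mathcal{D}\mid |U|=c}[\pi(S_\rho(U))]\ge 1-\delta$. Interaction step: the attacker specifies a distribution $\mathcal{D}$ over query sets and gives it to the query-response (QR) algorithm, then draws a query from $\mathcal{D}$; QR selects a map $\pi$ correct for $A$ and $\delta=O(1/\sqrt{k})$ w.r.t. $\mathcal{D}$ (its choice may depend on the previous transcript and on $\mathcal{D}$), and if no correct map exists it reports failure and halts; QR receives the sketch of the query and returns $Z\sim\mathrm{Bern}[\pi(\text{sketch})]$; the attacker then reveals the query and its internal state to QR. Adaptive attack: choose $N$ as $n$ random keys of $\mathcal{U}$; $A=n/16$; $M=\emptyset$; $C[x]=0$ for $x\in N$. For $i=1,\dots,r$: draw $U\sim\mathcal{D}_0$, query $M\cup U$, receive $Z$ (exit if QR reports failure); for each $x\in U$ set $C[x]\leftarrow C[x]+Z$, and if $C[x]\ge \mathrm{median}\{C[y]:y\in N\setminus M\}+\sqrt{i\log(200nr)/2}$ then add $x$ to $M$; send $M,C,U$ to QR. Output $M$. The notations $\tilde O,\tilde\Omega$ hide polylogarithmic factors. *)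

theory Defs
  imports "HOL-Probability.Probability"
begin

section \<open>MinHash sketches\<close>

definition iid_on :: "'r measure \<Rightarrow> 'b measure \<Rightarrow> ('i \<Rightarrow> 'r \<Rightarrow> 'b) \<Rightarrow> 'i set \<Rightarrow> bool" where
  "iid_on R law X I \<longleftrightarrow>
     prob_space.indep_vars R (\<lambda>_. law) X I \<and> (\<forall>i\<in>I. distr R law (X i) = law)"

definition continuous_law :: "real measure \<Rightarrow> bool" where
  "continuous_law \<nu> \<longleftrightarrow> prob_space \<nu> \<and> sets \<nu> = sets borel \<and> (\<forall>x. measure \<nu> {x} = 0)"

text \<open>
  All three sketches are lists of extended reals; a minimum over no keys is \<open>\<infinity>\<close>.
  Hash functions are families of random variables on a space \<open>R\<close>, one for each key.
\<close>

type_synonym sketch = "ereal list"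

definition kmins_sketch :: "nat \<Rightarrow> (nat \<Rightarrow> 'a \<Rightarrow> real) \<Rightarrow> 'a set \<Rightarrow> sketch" where
  "kmins_sketch k h V = map (\<lambda>i. INF x\<in>V. ereal (h i x)) [0..<k]"

definition bottomk_sketch :: "nat \<Rightarrow> ('a \<Rightarrow> real) \<Rightarrow> 'a set \<Rightarrow> sketch" where
  "bottomk_sketch k h V = map ereal (take k (sorted_list_of_set (h ` V)))"

definition kpartition_sketch :: "nat \<Rightarrow> ('a \<Rightarrow> nat) \<Rightarrow> ('a \<Rightarrow> real) \<Rightarrow> 'a set \<Rightarrow> sketch" where
  "kpartition_sketch k P h V = map (\<lambda>i. INF x\<in>{x\<in>V. P x = i}. ereal (h x)) [0..<k]"

definition is_kmins :: "'r measure \<Rightarrow> 'a set \<Rightarrow> nat \<Rightarrow> ('r \<Rightarrow> 'a set \<Rightarrow> sketch) \<Rightarrow> bool" where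
  "is_kmins R \<U> k S \<longleftrightarrow> (\<exists>\<nu> h. continuous_law \<nu> \<and>
     iid_on R \<nu> (\<lambda>(i, x). h i x) ({..<k} \<times> \<U>) \<and>
     S = (\<lambda>\<rho>. kmins_sketch k (\<lambda>i x. h i x \<rho>)))"

definition is_bottomk :: "'r measure \<Rightarrow> 'a set \<Rightarrow> nat \<Rightarrow> ('r \<Rightarrow> 'a set \<Rightarrow> sketch) \<Rightarrow> bool" where
  "is_bottomk R \<U> k S \<longleftrightarrow> (\<exists>\<nu> h. continuous_law \<nu> \<and>
     iid_on R \<nu> h \<U> \<and>
     S = (\<lambda>\<rho>. bottomk_sketch k (\<lambda>x. h x \<rho>)))"

definition is_kpartition :: "'r measure \<Rightarrow> 'a set \<Rightarrow> nat \<Rightarrow> ('r \<Rightarrow> 'a set \<Rightarrow> sketch) \<Rightarrow> bool" where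
  "is_kpartition R \<U> k S \<longleftrightarrow> (\<exists>P h.
     iid_on R
       (measure_pmf (pmf_of_set {..<k}) \<Otimes>\<^sub>M density lborel (\<lambda>t. ennreal (exponential_density 1 t)))
       (\<lambda>x \<rho>. (P x \<rho>, h x \<rho>)) \<U> \<and>
     S = (\<lambda>\<rho>. kpartition_sketch k (\<lambda>x. P x \<rho>) (\<lambda>x. h x \<rho>)))"

definition is_minhash :: "'r measure \<Rightarrow> 'a set \<Rightarrow> nat \<Rightarrow> ('r \<Rightarrow> 'a set \<Rightarrow> sketch) \<Rightarrow> bool" where
  "is_minhash R \<U> k S \<longleftrightarrow> is_kmins R \<U> k S \<or> is_bottomk R \<U> k S \<or> is_kpartition R \<U> k S"


section \<open>Rate sampling and the base query distribution\<close>

definition rate_dist :: "real \<Rightarrow> real \<Rightarrow> real measure" where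
  "rate_dist A n = (let \<omega> = n / (2 * A); \<omega>\<^sub>a = \<omega> / 2 in
     uniform_measure lborel {0..\<omega> / 4} \<bind> (\<lambda>D.
     uniform_measure lborel {\<omega>\<^sub>a + D..\<omega>\<^sub>a + D + 7 / 4 * \<omega>} \<bind> (\<lambda>X.
     return borel (1 / X))))"

definition random_subset :: "real \<Rightarrow> 'a set \<Rightarrow> 'a set pmf" where
  "random_subset q N = map_pmf (\<lambda>f. {x\<in>N. f x}) (Pi_pmf N False (\<lambda>_. bernoulli_pmf q))"

text \<open>
  The rate is continuous but the sampled set is discrete, so the mixture is a probability mass
  function; lemma \<open>measure_pmf_D0\<close> below shows that \<open>Abs_pmf\<close> is applied within its domain.
\<close>

definition D0 :: "real \<Rightarrow> 'a set \<Rightarrow> 'a set pmf" where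
  "D0 A N = Abs_pmf (rate_dist A (real (card N)) \<bind> (\<lambda>q. measure_pmf (random_subset q N)))"

lemma set_random_subset: "finite N \<Longrightarrow> set_pmf (random_subset q N) \<subseteq> Pow N"
  by (auto simp: random_subset_def)

lemma pmf_random_subset:
  assumes "finite N" "V \<subseteq> N"
  shows "pmf (random_subset q N) V = (\<Prod>x\<in>N. pmf (bernoulli_pmf q) (x \<in> V))"
proof -
  have "pmf (random_subset q N) V
      = measure (measure_pmf (Pi_pmf N False (\<lambda>_. bernoulli_pmf q))) {f. {x\<in>N. f x} = V}"
    by (simp add: random_subset_def pmf_map vimage_def)
  also have "\<dots> = measure (measure_pmf (Pi_pmf N False (\<lambda>_. bernoulli_pmf q))) {\<lambda>x. x \<in> V}"
  proof (rule measure_pmf.finite_measure_eq_AE)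
    show "AE f in measure_pmf (Pi_pmf N False (\<lambda>_. bernoulli_pmf q)).
        (f \<in> {f. {x\<in>N. f x} = V}) = (f \<in> {\<lambda>x. x \<in> V})"
      using set_Pi_pmf_subset[OF assms(1), of False "\<lambda>_. bernoulli_pmf q"] assms(2)
      by (auto simp: AE_measure_pmf_iff fun_eq_iff)
  qed auto
  also have "\<dots> = (\<Prod>x\<in>N. pmf (bernoulli_pmf q) (x \<in> V))"
    using assms by (auto simp: measure_pmf_single pmf_Pi)
  finally show ?thesis .
qed

lemma measurable_bernoulli_pmf: "(\<lambda>q. pmf (bernoulli_pmf q) b) \<in> borel_measurable borel"
proof -
  have *: "(\<lambda>q. pmf (bernoulli_pmf q) b)
      = (\<lambda>q. let p = min 1 (max 0 q) in if b then p else 1 - p)"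
    by (auto simp: fun_eq_iff bernoulli_pmf.rep_eq Let_def)
  show ?thesis unfolding * Let_def by (cases b) simp_all
qed

lemma random_subset_measurable:
  assumes "finite N"
  shows "(\<lambda>q. measure_pmf (random_subset q N)) \<in> borel \<rightarrow>\<^sub>M prob_algebra (count_space UNIV)"
proof (intro measurable_prob_algebraI measurable_subprob_algebra)
  fix W :: "'a set set"
  have "emeasure (measure_pmf (random_subset q N)) W
      = (\<Sum>V\<in>W \<inter> Pow N. ennreal (\<Prod>x\<in>N. pmf (bernoulli_pmf q) (x \<in> V)))" for q
  proof -
    have "emeasure (measure_pmf (random_subset q N)) W
        = emeasure (measure_pmf (random_subset q N)) (W \<inter> Pow N)"
      by (rule emeasure_eq_AE) (use set_random_subset[OF assms, of q] in \<open>auto simp: AE_measure_pmf_iff\<close>)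
    also have "\<dots> = (\<Sum>V\<in>W \<inter> Pow N. ennreal (pmf (random_subset q N) V))"
      using assms by (simp add: emeasure_measure_pmf_finite)
    also have "\<dots> = (\<Sum>V\<in>W \<inter> Pow N. ennreal (\<Prod>x\<in>N. pmf (bernoulli_pmf q) (x \<in> V)))"
      by (intro sum.cong refl) (use assms in \<open>auto simp: pmf_random_subset\<close>)
    finally show ?thesis .
  qed
  moreover have "(\<lambda>q. \<Sum>V\<in>W \<inter> Pow N. ennreal (\<Prod>x\<in>N. pmf (bernoulli_pmf q) (x \<in> V)))
      \<in> borel_measurable borel"
    by (intro borel_measurable_sum measurable_compose[OF _ measurable_ennreal]
        borel_measurable_prod measurable_bernoulli_pmf)
  ultimately show "(\<lambda>q. emeasure (measure_pmf (random_subset q N)) W) \<in> borel_measurable borel"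
    by simp
qed (auto intro: prob_space_measure_pmf measure_pmf.subprob_space_axioms)

lemma uniform_interval_measurable:
  assumes "0 < (l::real)"
  shows "(\<lambda>D. uniform_measure lborel {a + D..a + D + l}) \<in> borel \<rightarrow>\<^sub>M prob_algebra borel"
proof (intro measurable_prob_algebraI measurable_subprob_algebra)
  fix D :: real
  show "prob_space (uniform_measure lborel {a + D..a + D + l})"
    using assms by (intro prob_space_uniform_measure) auto
  then show "subprob_space (uniform_measure lborel {a + D..a + D + l})"
    by (rule prob_space_imp_subprob_space)
next
  fix B :: "real set" assume B: "B \<in> sets borel"
  have "emeasure (uniform_measure lborel {a + D..a + D + l}) B
      = (\<integral>\<^sup>+t. indicator B t * indicator {(D, t). a + D \<le> t \<and> t \<le> a + D + l} (D, t) \<partial>lborel) / ennreal l" for D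
  proof -
    have "emeasure lborel ({a + D..a + D + l} \<inter> B)
        = (\<integral>\<^sup>+t. indicator ({a + D..a + D + l} \<inter> B) t \<partial>lborel)"
      using B by simp
    also have "\<dots> = (\<integral>\<^sup>+t. indicator B t * indicator {(D, t). a + D \<le> t \<and> t \<le> a + D + l} (D, t) \<partial>lborel)"
      by (intro nn_integral_cong) (auto simp: indicator_def)
    finally show ?thesis
      using B assms by simp
  qed
  moreover have "(\<lambda>D. (\<integral>\<^sup>+t. indicator B t * indicator {(D, t). a + D \<le> t \<and> t \<le> a + D + l} (D, t) \<partial>lborel) / ennreal l)
      \<in> borel_measurable borel"
    using B by measurable
  ultimately show "(\<lambda>D. emeasure (uniform_measure lborel {a + D..a + D + l}) B) \<in> borel_measurable borel"
    by simp
qed auto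

lemma rate_dist_prob_algebra:
  assumes "0 < A" "0 < n"
  shows "rate_dist A n \<in> space (prob_algebra borel)"
proof -
  define w where "w = n / (2 * A)"
  have w: "w > 0" using assms by (simp add: w_def)
  have 1: "uniform_measure lborel {0..w / 4} \<in> space (prob_algebra borel)"
    using w by (auto simp: space_prob_algebra intro!: prob_space_uniform_measure)
  have 2: "(\<lambda>X::real. return borel (1 / X)) \<in> borel \<rightarrow>\<^sub>M prob_algebra borel"
    by (rule measurable_compose[OF _ measurable_return_prob_space]) measurable
  have 3: "(\<lambda>D. uniform_measure lborel {w / 2 + D..w / 2 + D + 7 / 4 * w} \<bind> (\<lambda>X. return borel (1 / X)))
      \<in> borel \<rightarrow>\<^sub>M prob_algebra borel"
    by (rule measurable_bind_prob_space[OF uniform_interval_measurable 2]) (use w in simp)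
  show ?thesis
    unfolding rate_dist_def Let_def w_def[symmetric] space_prob_algebra
    using prob_space_bind'[OF 1 3] sets_bind'[OF 1 3] by simp
qed

lemma measure_pmf_D0:
  assumes "0 < A" "finite N" "N \<noteq> {}"
  shows "measure_pmf (D0 A N)
    = rate_dist A (real (card N)) \<bind> (\<lambda>q. measure_pmf (random_subset q N))" (is "_ = ?M")
proof -
  have R: "rate_dist A (real (card N)) \<in> space (prob_algebra borel)"
    using assms by (intro rate_dist_prob_algebra) (auto simp: card_gt_0_iff)
  note K = random_subset_measurable[OF assms(2)]
  interpret M: prob_space ?M by (rule prob_space_bind'[OF R K])
  have sets: "sets ?M = UNIV" using sets_bind'[OF R K] by simp
  have "emeasure ?M (- Pow N) = (\<integral>\<^sup>+q. emeasure (measure_pmf (random_subset q N)) (- Pow N) \<partial>rate_dist A (real (card N)))"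
    by (rule emeasure_bind_prob_algebra[OF R K]) simp
  also have "\<dots> = (\<integral>\<^sup>+q. 0 \<partial>rate_dist A (real (card N)))"
    by (intro nn_integral_cong)
      (use set_random_subset[OF assms(2)] in \<open>auto simp: measure_pmf.emeasure_eq_measure measure_pmf_zero_iff\<close>)
  finally have out: "emeasure ?M (- Pow N) = 0" by simp
  have "AE V in ?M. measure ?M {V} \<noteq> 0"
  proof (rule AE_I)
    show "emeasure ?M (- Pow N \<union> {V \<in> Pow N. measure ?M {V} = 0}) = 0"
    proof -
      have "emeasure ?M {V \<in> Pow N. measure ?M {V} = 0} = (\<Sum>V\<in>{V \<in> Pow N. measure ?M {V} = 0}. emeasure ?M {V})"
        using assms(2) by (intro emeasure_eq_sum_singleton) (auto simp: sets)
      also have "\<dots> = 0"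
        by (intro sum.neutral) (auto simp: M.emeasure_eq_measure)
      finally have "emeasure ?M {V \<in> Pow N. measure ?M {V} = 0} = 0" .
      with out show ?thesis
        by (metis (no_types, lifting) UNIV_I emeasure_Un_null_set null_setsI sets)
    qed
  qed (auto simp: sets)
  then show ?thesis
    unfolding D0_def by (intro Abs_pmf_inverse) (use M.prob_space_axioms sets in auto)
qed


section \<open>Correct maps and the interaction\<close>

text \<open>
  \<open>S\<close> is the sketching map for one fixed value of the sketch randomness: the expectations range
  over the query only. A cardinality that \<open>D\<close> does not produce imposes no condition.
\<close>

definition correct_map ::
  "('a set \<Rightarrow> sketch) \<Rightarrow> real \<Rightarrow> real \<Rightarrow> 'a set pmf \<Rightarrow> (sketch \<Rightarrow> real) \<Rightarrow> bool" where
  "correct_map S A \<delta> D \<pi> \<longleftrightarrow>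
     (\<forall>s. 0 \<le> \<pi> s \<and> \<pi> s \<le> 1) \<and>
     (\<forall>c::nat. set_pmf D \<inter> {V. card V = c} \<noteq> {} \<longrightarrow>
        (real c < A \<longrightarrow>
           measure_pmf.expectation (cond_pmf D {V. card V = c}) (\<lambda>V. \<pi> (S V)) \<le> \<delta>) \<and>
        (real c > 2 * A \<longrightarrow>
           measure_pmf.expectation (cond_pmf D {V. card V = c}) (\<lambda>V. \<pi> (S V)) \<ge> 1 - \<delta>))"

text \<open>
  One round of the transcript: the query distribution, the query, the response, and the
  state \<open>(M, C, U)\<close> revealed by the attacker.
\<close>

type_synonym 'a round = "'a set pmf \<times> 'a set \<times> bool \<times> 'a set \<times> ('a \<Rightarrow> nat) \<times> 'a set"

text \<open>
  A query-response algorithm selects a map from the point \<open>\<rho>\<close> of the underlying probability space,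
  the transcript and the current query distribution. Besides the hash functions the space may carry
  private coins of the algorithm, so randomised selection is covered.
\<close>

type_synonym ('r, 'a) qr = "'r \<Rightarrow> 'a round list \<Rightarrow> 'a set pmf \<Rightarrow> (sketch \<Rightarrow> real)"

definition follows_protocol ::
  "'r measure \<Rightarrow> ('r \<Rightarrow> 'a set \<Rightarrow> sketch) \<Rightarrow> real \<Rightarrow> real \<Rightarrow> ('r, 'a) qr \<Rightarrow> bool" where
  "follows_protocol R S A \<delta> QR \<longleftrightarrow>
     (\<forall>\<rho>\<in>space R. \<forall>tr D. (\<exists>\<pi>. correct_map (S \<rho>) A \<delta> D \<pi>) \<longrightarrow>
        correct_map (S \<rho>) A \<delta> D (QR \<rho> tr D))"


section \<open>The adaptive attack\<close>

definition median :: "('a \<Rightarrow> nat) \<Rightarrow> 'a set \<Rightarrow> real" where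
  "median C Y = (let s = sorted_list_of_multiset (image_mset C (mset_set Y)); m = length s in
     (real (s ! ((m - 1) div 2)) + real (s ! (m div 2))) / 2)"

definition query_dist :: "real \<Rightarrow> 'a set \<Rightarrow> 'a set \<Rightarrow> 'a set pmf" where
  "query_dist A N M = map_pmf (\<lambda>U. M \<union> U) (D0 A N)"

definition process_key ::
  "nat \<Rightarrow> nat \<Rightarrow> 'a set \<Rightarrow> nat \<Rightarrow> bool \<Rightarrow> 'a \<Rightarrow> 'a set \<times> ('a \<Rightarrow> nat) \<Rightarrow> 'a set \<times> ('a \<Rightarrow> nat)" where
  "process_key n r N i Z x = (\<lambda>(M, C).
     let C' = C(x := C x + of_bool Z) in
     (if real (C' x) \<ge> median C' (N - M) + sqrt (real i * ln (200 * real n * real r) / 2)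
      then insert x M else M, C'))"

text \<open>
  The order in which the keys of a query are processed is left open: it is given by \<open>enum\<close>.
\<close>

definition set_enumeration :: "('a set \<Rightarrow> 'a list) \<Rightarrow> bool" where
  "set_enumeration enum \<longleftrightarrow> (\<forall>V. finite V \<longrightarrow> set (enum V) = V \<and> distinct (enum V))"

text \<open>
  The final mask, for fixed \<open>N\<close>, sketching map \<open>S\<close> and strategy \<open>Q\<close> (that is, for a fixed value of
  \<open>\<rho>\<close>). The first argument counts the remaining iterations, so the current one is \<open>i = r - m\<close>.
  The loop exits when no correct map exists, since then the algorithm reports failure.
\<close>

primrec attack_loop ::
  "nat \<Rightarrow> ('a set \<Rightarrow> 'a list) \<Rightarrow> ('a set \<Rightarrow> sketch) \<Rightarrow>
   ('a round list \<Rightarrow> 'a set pmf \<Rightarrow> (sketch \<Rightarrow> real)) \<Rightarrow> real \<Rightarrow> real \<Rightarrow> nat \<Rightarrow> nat \<Rightarrow> 'a set \<Rightarrow>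
   'a set \<Rightarrow> ('a \<Rightarrow> nat) \<Rightarrow> 'a round list \<Rightarrow> 'a set pmf" where
  "attack_loop 0 enum S Q A \<delta> n r N M C tr = return_pmf M"
| "attack_loop (Suc m) enum S Q A \<delta> n r N M C tr =
     (let i = r - m; D = query_dist A N M in
      if \<not> (\<exists>\<pi>. correct_map S A \<delta> D \<pi>) then return_pmf M
      else do {
        U \<leftarrow> D0 A N;
        Z \<leftarrow> bernoulli_pmf (Q tr D (S (M \<union> U)));
        let (M', C') = fold (process_key n r N i Z) (enum U) (M, C);
        attack_loop m enum S Q A \<delta> n r N M' C' (tr @ [(D, M \<union> U, Z, M', C', U)])
      })"

definition attack ::
  "('a set \<Rightarrow> 'a list) \<Rightarrow> ('a set \<Rightarrow> sketch) \<Rightarrow> ('a round list \<Rightarrow> 'a set pmf \<Rightarrow> (sketch \<Rightarrow> real)) \<Rightarrow>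
   real \<Rightarrow> real \<Rightarrow> nat \<Rightarrow> nat \<Rightarrow> 'a set \<Rightarrow> ('a set \<times> 'a set) pmf" where
  "attack enum S Q A \<delta> n r \<U> = do {
     N \<leftarrow> pmf_of_set {N. N \<subseteq> \<U> \<and> card N = n};
     M \<leftarrow> attack_loop r enum S Q A \<delta> n r N {} (\<lambda>_. 0) [];
     return_pmf (N, M)
   }"

end

theory Submission
  imports Defs "HOL-Real_Asymp.Real_Asymp"
begin

text \<open>
  Only the \<open>O(k log (k r))\<close> keys of \<open>N\<close> with the lowest hashes influence the sketches of the queries
  (up to a negligible probability per query); call them important. The remaining keys are
  exchangeable from the point of view of the responder, so their scores stay near a common baseline,
  and the median follows this baseline: almost none of them ever enters the mask.

  A correct map must move its mean response from almost 1 to almost 0 as the rate \<open>q\<close> decreases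
  across the sampled interval. Since \<open>q (1 - q) d/dq E\<^sub>q[f U] = E\<^sub>q[f U (|U| - q |J|)]\<close> for
  random subsets \<open>U\<close> of \<open>J\<close>, integrating against the distribution of \<open>1 / q\<close> shows that in every
  round the unmasked important keys jointly gain a constant expected advantage over the baseline. An
  important key is masked once its own advantage exceeds about \<open>sqrt (r log (n r))\<close>. As there are so few
  of them, a correct map cannot exist in all \<open>r\<close> rounds. This holds for almost every value of the
  hash functions and against every strategy, so no averaging over the sketch randomness is needed.
\<close>

section \<open>Means over random subsets with independent keys\<close>

text \<open>The set of important keys is fixed by the hash values alone, before any response, so it
  moves neither with the mask nor with the transcript; the baseline increment of a round is read off
  only after the responder has committed to a map. This is what makes the estimate hold against
  every adaptive strategy. Correctness constrains only averages over queries of one size under a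
  mixture of rates. Given its size, a query is uniform whatever the rate was, so the constraint
  passes to each single rate, where one can differentiate in q. The obstacle is the drifting median:
  to keep unimportant keys out, it must not fall below the baseline by more than a small fraction of
  the threshold, in any round. The available bound for one key is only about exp (- L / 500) with L
  = ln (200 n r), far too weak for a union bound over keys or rounds. Hence only the fraction of
  deviating keys is controlled, by averaging over keys, and all rounds are treated at once by
  supermartingales summed over the O(log r) epochs.\<close>

definition subset_mean :: "real \<Rightarrow> 'a set \<Rightarrow> ('a set \<Rightarrow> real) \<Rightarrow> real" where
  "subset_mean q J F = (\<Sum>W\<in>Pow J. q ^ card W * (1 - q) ^ (card J - card W) * F W)"

lemma subset_mean_empty: "subset_mean q {} F = F {}"
  by (simp add: subset_mean_def)

lemma subset_mean_insert:
  assumes "finite J" "x \<notin> J"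
  shows "subset_mean q (insert x J) F = q * subset_mean q J (\<lambda>W. F (insert x W)) + (1 - q) * subset_mean q J F"
proof -
  have inj: "inj_on (insert x) (Pow J)" using assms(2) by (auto simp: inj_on_def)
  have dis: "Pow J \<inter> insert x ` Pow J = {}" using assms(2) by auto
  have "subset_mean q (insert x J) F = (\<Sum>W\<in>Pow J. q ^ card W * (1 - q) ^ (Suc (card J) - card W) * F W)
     + (\<Sum>W\<in>insert x ` Pow J. q ^ card W * (1 - q) ^ (Suc (card J) - card W) * F W)"
    unfolding subset_mean_def Pow_insert using assms dis by (subst sum.union_disjoint) auto
  also have "(\<Sum>W\<in>insert x ` Pow J. q ^ card W * (1 - q) ^ (Suc (card J) - card W) * F W)
      = (\<Sum>W\<in>Pow J. q ^ card (insert x W) * (1 - q) ^ (Suc (card J) - card (insert x W)) * F (insert x W))"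
    by (subst sum.reindex[OF inj]) simp
  also have "\<dots> = q * subset_mean q J (\<lambda>W. F (insert x W))"
    unfolding subset_mean_def sum_distrib_left
  proof (intro sum.cong refl)
    fix W assume "W \<in> Pow J"
    then have "card (insert x W) = Suc (card W)" using assms by (auto simp: finite_subset card_insert_if)
    then show "q ^ card (insert x W) * (1 - q) ^ (Suc (card J) - card (insert x W)) * F (insert x W)
       = q * (q ^ card W * (1 - q) ^ (card J - card W) * F (insert x W))" by simp
  qed
  also have "(\<Sum>W\<in>Pow J. q ^ card W * (1 - q) ^ (Suc (card J) - card W) * F W) = (1 - q) * subset_mean q J F"
    unfolding subset_mean_def sum_distrib_left
  proof (intro sum.cong refl)
    fix W assume "W \<in> Pow J"
    then have "card W \<le> card J" using assms by (auto intro: card_mono)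
    then show "q ^ card W * (1 - q) ^ (Suc (card J) - card W) * F W
       = (1 - q) * (q ^ card W * (1 - q) ^ (card J - card W) * F W)" by (simp add: Suc_diff_le)
  qed
  finally show ?thesis by simp
qed

lemma subset_mean_cong: "(\<And>W. W \<subseteq> J \<Longrightarrow> F W = G W) \<Longrightarrow> subset_mean q J F = subset_mean q J G"
  unfolding subset_mean_def by (intro sum.cong) auto

lemma subset_mean_add: "subset_mean q J (\<lambda>W. F W + G W) = subset_mean q J F + subset_mean q J G"
  and subset_mean_diff: "subset_mean q J (\<lambda>W. F W - G W) = subset_mean q J F - subset_mean q J G"
  and subset_mean_cmult: "subset_mean q J (\<lambda>W. c * F W) = c * subset_mean q J F"
  unfolding subset_mean_def by (simp_all add: sum.distrib sum_subtractf sum_distrib_left algebra_simps)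

lemma subset_mean_sum: "subset_mean q J (\<lambda>W. \<Sum>i\<in>A. H i W) = (\<Sum>i\<in>A. subset_mean q J (H i))"
  unfolding subset_mean_def sum_distrib_left by (rule sum.swap)

lemma subset_mean_mono:
  assumes "0 \<le> q" "q \<le> 1" "\<And>W. W \<subseteq> J \<Longrightarrow> F W \<le> G W"
  shows "subset_mean q J F \<le> subset_mean q J G"
  unfolding subset_mean_def using assms by (intro sum_mono mult_left_mono) auto

section \<open>Marginals and independence\<close>

text \<open>Keys outside \<open>J\<close> are integrated out one at a time: each contributes the
  factor q + (1 - q) = 1, an identity of polynomials in q that needs no sign condition.\<close>

lemma subset_mean_marginal:
  assumes "finite N" "J \<subseteq> N"
  shows "subset_mean q N (\<lambda>U. F (U \<inter> J)) = subset_mean q J F"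
proof -
  have "subset_mean q (J \<union> K) (\<lambda>U. F (U \<inter> J)) = subset_mean q J F" if "finite K" "K \<inter> J = {}" for K
    using that
  proof (induction K rule: finite_induct)
    case empty
    show ?case by (auto intro: subset_mean_cong simp: Int_absorb2)
  next
    case (insert x K)
    have "subset_mean q (J \<union> insert x K) (\<lambda>U. F (U \<inter> J)) = subset_mean q (insert x (J \<union> K)) (\<lambda>U. F (U \<inter> J))"
      by simp
    also have "\<dots> = q * subset_mean q (J \<union> K) (\<lambda>U. F (insert x U \<inter> J)) + (1 - q) * subset_mean q (J \<union> K) (\<lambda>U. F (U \<inter> J))"
      using insert assms by (intro subset_mean_insert) (auto intro: finite_subset)
    also have "(\<lambda>U. F (insert x U \<inter> J)) = (\<lambda>U. F (U \<inter> J))"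
      using insert by auto
    finally show ?case using insert by (simp add: algebra_simps)
  qed
  from this[of "N - J"] show ?thesis using assms by (simp add: Un_absorb1 Int_commute)
qed

lemma subset_mean_const: "finite J \<Longrightarrow> subset_mean q J (\<lambda>_. c) = c"
  using subset_mean_marginal[of J "{}" q "\<lambda>_. c"] by (simp add: subset_mean_empty)

lemma subset_mean_independent:
  assumes "finite N" "J \<subseteq> N" "x \<in> N" "x \<notin> J"
  shows "subset_mean q N (\<lambda>U. of_bool (x \<in> U) * F (U \<inter> J)) = q * subset_mean q J F"
proof -
  have "subset_mean q N (\<lambda>U. of_bool (x \<in> U) * F (U \<inter> J))
      = subset_mean q N (\<lambda>U. (\<lambda>V. of_bool (x \<in> V) * F (V \<inter> J)) (U \<inter> insert x J))"
    using assms by (intro subset_mean_cong arg_cong2[of _ _ _ _ "(*)"] arg_cong[of _ _ F]) auto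
  also have "\<dots> = subset_mean q (insert x J) (\<lambda>V. of_bool (x \<in> V) * F (V \<inter> J))"
    using assms by (intro subset_mean_marginal) auto
  also have "\<dots> = q * subset_mean q J (\<lambda>W. F (insert x W \<inter> J)) + (1 - q) * subset_mean q J (\<lambda>V. of_bool (x \<in> V) * F (V \<inter> J))"
    using assms by (subst subset_mean_insert) (auto intro: finite_subset)
  also have "subset_mean q J (\<lambda>W. F (insert x W \<inter> J)) = subset_mean q J F"
    using assms by (intro subset_mean_cong arg_cong[of _ _ F]) auto
  also have "subset_mean q J (\<lambda>V. of_bool (x \<in> V) * F (V \<inter> J)) = subset_mean q J (\<lambda>V. 0)"
    using assms by (intro subset_mean_cong) auto
  also have "subset_mean q J (\<lambda>V. 0) = 0" by (simp add: subset_mean_def)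
  finally show ?thesis by simp
qed

lemma subset_mean_miss:
  assumes "finite N" "B \<subseteq> N"
  shows "subset_mean q N (\<lambda>U. of_bool (U \<inter> B = {})) = (1 - q) ^ card B"
proof -
  have "subset_mean q N (\<lambda>U. of_bool (U \<inter> B = {})) = subset_mean q B (\<lambda>W. of_bool (W = {}))"
    using subset_mean_marginal[OF assms, of q "\<lambda>W. of_bool (W = {})"] .
  also have "\<dots> = (\<Sum>W\<in>Pow B. if W = {} then (1 - q) ^ card B else 0)"
    unfolding subset_mean_def by (intro sum.cong) auto
  also have "\<dots> = (1 - q) ^ card B"
    using assms by (subst sum.delta) (auto intro: finite_subset)
  finally show ?thesis .
qed

lemma finite_set_random_subset: "finite N \<Longrightarrow> finite (set_pmf (random_subset q N))"
  using set_random_subset finite_subset by blast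

text \<open>The bridge between the probability mass function and the polynomial in q. Working with
  the polynomial gives continuity, the derivative in q and all linear identities by finite
  algebra.\<close>

lemma expectation_random_subset:
  assumes "finite N" "0 \<le> q" "q \<le> 1"
  shows "measure_pmf.expectation (random_subset q N) F = subset_mean q N F"
proof -
  have "measure_pmf.expectation (random_subset q N) F = (\<Sum>V\<in>Pow N. F V * pmf (random_subset q N) V)"
    by (rule integral_measure_pmf_real) (use assms set_random_subset in auto)
  also have "\<dots> = subset_mean q N F" unfolding subset_mean_def
  proof (intro sum.cong refl)
    fix V assume V: "V \<in> Pow N"
    have "pmf (random_subset q N) V = (\<Prod>x\<in>N. if x \<in> V then q else 1 - q)"
      using V assms by (subst pmf_random_subset) (auto intro!: prod.cong)
    also have "\<dots> = q ^ card V * (1 - q) ^ card (N - V)"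
      using V assms by (subst prod.If_cases) (auto simp: Int_absorb1 Diff_eq)
    also have "card (N - V) = card N - card V" using V assms by (intro card_Diff_subset) (auto intro: finite_subset)
    finally show "F V * pmf (random_subset q N) V = q ^ card V * (1 - q) ^ (card N - card V) * F V" by simp
  qed
  finally show ?thesis .
qed

section \<open>Derivative in the rate\<close>

text \<open>The logarithmic derivative of the weight q^w (1 - q)^(j - w) is (w - q j) / (q (1 - q)):
  the derivative of the mean is the correlation of \<open>f\<close> with the centred size of the
  set.\<close>

lemma subset_mean_has_derivative:
  assumes "0 < q" "q < 1" "finite J"
  shows "((\<lambda>q. subset_mean q J f) has_real_derivative
     subset_mean q J (\<lambda>W. f W * (real (card W) - q * real (card J))) / (q * (1 - q))) (at q)"
proof -
  have "((\<lambda>q. q ^ a * (1 - q) ^ b * c) has_real_derivative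
     q ^ a * (1 - q) ^ b * (c * (real a - q * real (a + b))) / (q * (1 - q))) (at q)" for a b :: nat and c :: real
  proof -
    have d: "((\<lambda>q. q ^ a * (1 - q) ^ b * c) has_real_derivative
       (real a * q ^ (a - 1) * (1 - q) ^ b - q ^ a * (real b * (1 - q) ^ (b - 1))) * c) (at q)"
      by (auto intro!: derivative_eq_intros simp: algebra_simps)
    \<comment> \<open>For a = 0 the truncated exponent a - 1 does no harm, because the factor
      \<open>real a\<close> vanishes.\<close>
    have 1: "real a * q ^ (a - 1) = real a * q ^ a / q" using assms by (cases a) auto
    have 2: "real b * (1 - q) ^ (b - 1) = real b * (1 - q) ^ b / (1 - q)" using assms by (cases b) auto
    have "(real a * q ^ (a - 1) * (1 - q) ^ b - q ^ a * (real b * (1 - q) ^ (b - 1))) * c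
       = q ^ a * (1 - q) ^ b * (c * (real a - q * real (a + b))) / (q * (1 - q))"
      unfolding 1 2 using assms by (simp add: field_simps)
    with d show ?thesis by simp
  qed
  then have "((\<lambda>q. \<Sum>W\<in>Pow J. q ^ card W * (1 - q) ^ (card J - card W) * f W) has_real_derivative
     (\<Sum>W\<in>Pow J. q ^ card W * (1 - q) ^ (card J - card W) * (f W * (real (card W) - q * real (card W + (card J - card W)))) / (q * (1 - q)))) (at q)"
    by (intro DERIV_sum)
  also have "(\<Sum>W\<in>Pow J. q ^ card W * (1 - q) ^ (card J - card W) * (f W * (real (card W) - q * real (card W + (card J - card W)))) / (q * (1 - q)))
    = subset_mean q J (\<lambda>W. f W * (real (card W) - q * real (card J))) / (q * (1 - q))"
    unfolding subset_mean_def sum_divide_distrib using assms by (intro sum.cong refl) (auto simp: card_mono)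
  finally show ?thesis unfolding subset_mean_def .
qed

lemma continuous_on_subset_mean: "continuous_on S (\<lambda>q. subset_mean q N F)"
  unfolding subset_mean_def by (intro continuous_intros)


section \<open>Mixing over the rate\<close>

lemma set_pmf_D0:
  assumes "0 < A" "finite N" "N \<noteq> {}"
  shows "set_pmf (D0 A N) \<subseteq> Pow N"
proof -
  have R: "rate_dist A (real (card N)) \<in> space (prob_algebra borel)"
    using assms by (intro rate_dist_prob_algebra) (auto simp: card_gt_0_iff)
  have "emeasure (measure_pmf (D0 A N)) (- Pow N)
      = (\<integral>\<^sup>+q. emeasure (measure_pmf (random_subset q N)) (- Pow N) \<partial>rate_dist A (real (card N)))"
    unfolding measure_pmf_D0[OF assms]
    by (rule emeasure_bind_prob_algebra[OF R random_subset_measurable[OF assms(2)]]) simp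
  also have "\<dots> = (\<integral>\<^sup>+q. 0 \<partial>rate_dist A (real (card N)))"
    by (intro nn_integral_cong)
      (use set_random_subset[OF assms(2)] in \<open>auto simp: measure_pmf.emeasure_eq_measure measure_pmf_zero_iff\<close>)
  finally have "measure (measure_pmf (D0 A N)) (- Pow N) = 0"
    by (simp add: measure_pmf.emeasure_eq_measure)
  then show ?thesis by (auto simp: measure_pmf_zero_iff)
qed

text \<open>With \<open>A = |N| / 16\<close> the rate is \<open>q = 1 / X\<close> with \<open>X\<close> uniform on \<open>{a..a + 14}\<close>, where \<open>a\<close> is uniform on \<open>{4..6}\<close>.\<close>

lemma nn_integral_D0:
  fixes G :: "'a set \<Rightarrow> real"
  assumes N: "finite N" "N \<noteq> {}"
  shows "(\<integral>\<^sup>+V. G V \<partial>measure_pmf (D0 (real (card N) / 16) N)) =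
    (\<integral>\<^sup>+D. (\<integral>\<^sup>+X. (\<integral>\<^sup>+V. G V \<partial>measure_pmf (random_subset (1 / X) N)) * indicator {4 + D..4 + D + 14} X \<partial>lborel) / 14
       * indicator {0..2} D \<partial>lborel) / 2"
proof -
  have n: "0 < real (card N)" using N by (simp add: card_gt_0_iff)
  have w: "real (card N) / (2 * (real (card N) / 16)) = 8" using n by simp
  have R: "rate_dist (real (card N) / 16) (real (card N)) \<in> space (prob_algebra borel)"
    using n by (intro rate_dist_prob_algebra) auto
  let ?E = "\<lambda>q. \<integral>\<^sup>+V. ennreal (G V) \<partial>measure_pmf (random_subset q N)"
  have K: "(\<lambda>q. measure_pmf (random_subset q N)) \<in> borel \<rightarrow>\<^sub>M subprob_algebra (count_space UNIV)"
    using random_subset_measurable[OF N(1)] by (rule measurable_prob_algebraD)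
  have E: "?E \<in> borel_measurable borel"
    by (rule measurable_compose[OF K nn_integral_measurable_subprob_algebra]) simp
  have sr: "sets (rate_dist (real (card N) / 16) (real (card N))) = sets borel"
    using R by (simp add: space_prob_algebra)
  have ret: "(\<lambda>X::real. return borel (1 / X)) \<in> borel \<rightarrow>\<^sub>M prob_algebra borel"
    by (rule measurable_compose[OF _ measurable_return_prob_space]) measurable
  have uni: "(\<lambda>D. uniform_measure lborel {4 + D..4 + D + 14::real}) \<in> borel \<rightarrow>\<^sub>M prob_algebra borel"
    by (rule uniform_interval_measurable) simp
  have inner: "(\<lambda>D::real. uniform_measure lborel {4 + D..4 + D + 14} \<bind> (\<lambda>X. return borel (1 / X)))
      \<in> borel \<rightarrow>\<^sub>M prob_algebra borel"
    by (rule measurable_bind_prob_space[OF uni ret])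
  have "(\<integral>\<^sup>+V. G V \<partial>measure_pmf (D0 (real (card N) / 16) N))
      = (\<integral>\<^sup>+q. ?E q \<partial>rate_dist (real (card N) / 16) (real (card N)))"
    using n N by (subst measure_pmf_D0) (auto intro!: nn_integral_bind[of _ "count_space UNIV"] simp: K sr cong: measurable_cong_sets)
  also have "\<dots> = (\<integral>\<^sup>+q. ?E q \<partial>(uniform_measure lborel {0..2} \<bind> (\<lambda>D.
     uniform_measure lborel {4 + D..4 + D + 14} \<bind> (\<lambda>X. return borel (1 / X)))))"
    unfolding rate_dist_def Let_def w by simp
  also have "\<dots> = (\<integral>\<^sup>+D. (\<integral>\<^sup>+q. ?E q \<partial>(uniform_measure lborel {4 + D..4 + D + 14} \<bind> (\<lambda>X. return borel (1 / X))))
       \<partial>uniform_measure lborel {0..2})"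
    by (rule nn_integral_bind[OF E]) (use measurable_prob_algebraD[OF inner] in \<open>simp cong: measurable_cong_sets\<close>)
  also have "\<dots> = (\<integral>\<^sup>+D. (\<integral>\<^sup>+X. ?E (1 / X) \<partial>uniform_measure lborel {4 + D..4 + D + 14}) \<partial>uniform_measure lborel {0..2})"
  proof (intro nn_integral_cong)
    fix D :: real
    have "(\<integral>\<^sup>+q. ?E q \<partial>(uniform_measure lborel {4 + D..4 + D + 14} \<bind> (\<lambda>X. return borel (1 / X))))
      = (\<integral>\<^sup>+X. (\<integral>\<^sup>+q. ?E q \<partial>return borel (1 / X)) \<partial>uniform_measure lborel {4 + D..4 + D + 14})"
      by (rule nn_integral_bind[OF E]) (use measurable_prob_algebraD[OF ret] in \<open>simp cong: measurable_cong_sets\<close>)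
    also have "\<dots> = (\<integral>\<^sup>+X. ?E (1 / X) \<partial>uniform_measure lborel {4 + D..4 + D + 14})"
      by (intro nn_integral_cong nn_integral_return) (use E in auto)
    finally show "(\<integral>\<^sup>+q. ?E q \<partial>(uniform_measure lborel {4 + D..4 + D + 14} \<bind> (\<lambda>X. return borel (1 / X))))
      = (\<integral>\<^sup>+X. ?E (1 / X) \<partial>uniform_measure lborel {4 + D..4 + D + 14})" .
  qed
  also have "\<dots> = (\<integral>\<^sup>+D. (\<integral>\<^sup>+X. ?E (1 / X) * indicator {4 + D..4 + D + 14} X \<partial>lborel) / 14 \<partial>uniform_measure lborel {0..2})"
    using E by (intro nn_integral_cong) (subst nn_integral_uniform_measure; simp add: measurable_compose[of "\<lambda>x. 1 / x" borel borel])
  also have "\<dots> = (\<integral>\<^sup>+D. (\<integral>\<^sup>+X. ?E (1 / X) * indicator {4 + D..4 + D + 14} X \<partial>lborel) / 14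
       * indicator {0..2} D \<partial>lborel) / 2"
  proof (subst nn_integral_uniform_measure)
    have eq: "indicator {4 + D..4 + D + 14} X = (indicator {(D, X). 4 + D \<le> X \<and> X \<le> 4 + D + 14} (D, X) :: ennreal)" for D X :: real
      by (auto simp: indicator_def)
    show "(\<lambda>D. (\<integral>\<^sup>+X. ?E (1 / X) * indicator {4 + D..4 + D + 14} X \<partial>lborel) / 14) \<in> borel_measurable lborel"
      unfolding eq using E by measurable
  qed (use E in auto)
  finally show ?thesis .
qed

text \<open>Turns a statement about the double mixture into one about ordinary integrals over X,
  uniformly in the left end a, so that the fundamental theorem of calculus becomes
  applicable.\<close>

lemma D0_expectation_ge:
  fixes F :: "'a set \<Rightarrow> real"
  assumes N: "finite N" "N \<noteq> {}"
    and \<Gamma>: "\<And>a. 4 \<le> a \<Longrightarrow> a \<le> 6 \<Longrightarrow> 14 * \<Gamma> \<le> integral {a..a + 14} (\<lambda>X. subset_mean (1 / X) N F)"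
  shows "\<Gamma> \<le> measure_pmf.expectation (D0 (real (card N) / 16) N) F"
proof -
  define D where "D = D0 (real (card N) / 16) N"
  have n: "0 < real (card N)" using N by (simp add: card_gt_0_iff)
  have D: "set_pmf D \<subseteq> Pow N" unfolding D_def using n N by (intro set_pmf_D0) auto
  \<comment> \<open>The formula for the mixture is a non-negative integral, so \<open>F\<close> is
    shifted by a constant that makes both \<open>F\<close> on subsets of \<open>N\<close> and the
    bound \<Gamma> non-negative; the shift cancels at the end.\<close>
  define K where "K = \<bar>\<Gamma>\<bar> + (\<Sum>V\<in>Pow N. \<bar>F V\<bar>)"
  have K: "0 \<le> F V + K" if "V \<subseteq> N" for V
    using member_le_sum[of V "Pow N" "\<lambda>V. \<bar>F V\<bar>"] that N unfolding K_def by auto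
  have K2: "0 \<le> \<Gamma> + K" proof -
    have "0 \<le> (\<Sum>V\<in>Pow N. \<bar>F V\<bar>)" by (intro sum_nonneg) auto
    then show ?thesis unfolding K_def by linarith
  qed
  define G where "G V = (if V \<subseteq> N then F V + K else 0)" for V
  have G: "0 \<le> G V" for V using K by (auto simp: G_def)
  have int: "integrable (measure_pmf D) f" for f :: "'a set \<Rightarrow> real"
    using D N by (intro integrable_measure_pmf_finite) (auto intro: finite_subset)
  have BG: "subset_mean q N G = subset_mean q N F + K" for q
  proof -
    have "subset_mean q N G = subset_mean q N (\<lambda>V. F V + K)" by (intro subset_mean_cong) (auto simp: G_def)
    then show ?thesis using N by (simp add: subset_mean_add subset_mean_const)
  qed
  have cont: "continuous_on {a..a + 14} (\<lambda>X. subset_mean (1 / X) N F)" if "4 \<le> a" for a :: real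
  proof (rule continuous_on_compose2[OF continuous_on_subset_mean[of UNIV]])
    show "continuous_on {a..a + 14} (\<lambda>X::real. 1 / X)" using that by (intro continuous_intros) auto
  qed auto
  have inner: "ennreal (\<Gamma> + K) \<le> (\<integral>\<^sup>+X. (\<integral>\<^sup>+V. G V \<partial>measure_pmf (random_subset (1 / X) N)) * indicator {4 + D..4 + D + 14} X \<partial>lborel) / 14"
    if "D \<in> {0..2}" for D
  proof -
    define a where "a = 4 + D"
    have a: "4 \<le> a" "a \<le> 6" using that by (auto simp: a_def)
    let ?h = "\<lambda>X. subset_mean (1 / X) N F + K"
    have h0: "0 \<le> ?h X" if "X \<in> {a..a + 14}" for X
    proof -
      have "subset_mean (1 / X) N (\<lambda>_. 0) \<le> subset_mean (1 / X) N (\<lambda>V. F V + K)"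
        using that a K by (intro subset_mean_mono) auto
      then show ?thesis using N by (simp add: subset_mean_add subset_mean_const)
    qed
    have int: "?h integrable_on {a..a + 14}"
      using cont[OF a(1)] by (intro integrable_continuous_real continuous_intros)
    have "(\<lambda>X. if X \<in> {a..a + 14} then ?h X else 0) \<in> borel_measurable borel"
    proof -
      have "(\<lambda>X. indicator {a..a + 14} X *\<^sub>R ?h X) \<in> borel_measurable borel"
        using cont[OF a(1)] by (intro borel_measurable_continuous_on_indicator continuous_intros) auto
      then show ?thesis by (rule measurable_cong[THEN iffD1, rotated]) auto
    qed
    moreover have "((\<lambda>X. if X \<in> {a..a + 14} then ?h X else 0) has_integral integral {a..a + 14} ?h) UNIV"
      unfolding has_integral_restrict_UNIV using int by (rule integrable_integral)
    ultimately have "(\<integral>\<^sup>+X. ennreal (if X \<in> {a..a + 14} then ?h X else 0) \<partial>lborel) = ennreal (integral {a..a + 14} ?h)"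
      using h0 by (intro nn_integral_has_integral_lborel) auto
    also have "(\<integral>\<^sup>+X. ennreal (if X \<in> {a..a + 14} then ?h X else 0) \<partial>lborel)
        = (\<integral>\<^sup>+X. (\<integral>\<^sup>+V. G V \<partial>measure_pmf (random_subset (1 / X) N)) * indicator {a..a + 14} X \<partial>lborel)"
    proof (intro nn_integral_cong)
      fix X :: real
      show "ennreal (if X \<in> {a..a + 14} then ?h X else 0)
        = (\<integral>\<^sup>+V. G V \<partial>measure_pmf (random_subset (1 / X) N)) * indicator {a..a + 14} X"
      proof (cases "X \<in> {a..a + 14}")
        case True
        have "(\<integral>\<^sup>+V. G V \<partial>measure_pmf (random_subset (1 / X) N)) = ennreal (measure_pmf.expectation (random_subset (1 / X) N) G)"
          using G N by (intro nn_integral_eq_integral integrable_measure_pmf_finite finite_set_random_subset) auto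
        also have "measure_pmf.expectation (random_subset (1 / X) N) G = ?h X"
          using True a N by (subst expectation_random_subset) (auto simp: BG)
        finally show ?thesis using True by simp
      qed auto
    qed
    finally have eq: "(\<integral>\<^sup>+X. (\<integral>\<^sup>+V. G V \<partial>measure_pmf (random_subset (1 / X) N)) * indicator {a..a + 14} X \<partial>lborel)
       = ennreal (integral {a..a + 14} ?h)" by simp
    have "integral {a..a + 14} ?h = integral {a..a + 14} (\<lambda>X. subset_mean (1 / X) N F) + 14 * K"
      using cont[OF a(1)] by (subst Henstock_Kurzweil_Integration.integral_add) (auto intro!: integrable_continuous_real)
    with \<Gamma>[OF a] have "14 * (\<Gamma> + K) \<le> integral {a..a + 14} ?h" by simp
    then have "ennreal (14 * (\<Gamma> + K)) / 14 \<le> ennreal (integral {a..a + 14} ?h) / 14"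
      by (intro divide_right_mono_ennreal ennreal_leI)
    also have "ennreal (14 * (\<Gamma> + K)) / 14 = ennreal (\<Gamma> + K)"
      using K2 by (subst ennreal_numeral[symmetric], subst divide_ennreal) auto
    finally show ?thesis unfolding a_def eq[unfolded a_def] .
  qed
  have "ennreal (\<Gamma> + K) = (\<integral>\<^sup>+D. ennreal (\<Gamma> + K) * indicator {0..2::real} D \<partial>lborel) / 2"
    using K2 by (subst nn_integral_cmult_indicator; simp add: ennreal_mult_divide_eq)
  also have "\<dots> \<le> (\<integral>\<^sup>+D. (\<integral>\<^sup>+X. (\<integral>\<^sup>+V. G V \<partial>measure_pmf (random_subset (1 / X) N)) * indicator {4 + D..4 + D + 14} X \<partial>lborel) / 14
       * indicator {0..2} D \<partial>lborel) / 2"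
    by (intro divide_right_mono_ennreal nn_integral_mono) (use inner in \<open>auto simp: indicator_def\<close>)
  also have "\<dots> = (\<integral>\<^sup>+V. G V \<partial>measure_pmf D)"
    unfolding D_def by (rule nn_integral_D0[OF N, symmetric])
  also have "\<dots> = ennreal (measure_pmf.expectation D G)"
    using G by (intro nn_integral_eq_integral int) auto
  finally have "\<Gamma> + K \<le> measure_pmf.expectation D G"
    using G by (subst (asm) ennreal_le_iff) (auto intro: integral_nonneg_AE)
  also have "\<dots> = measure_pmf.expectation D (\<lambda>V. F V + K)"
    using D by (intro integral_cong_AE) (auto simp: AE_measure_pmf_iff G_def)
  also have "\<dots> = measure_pmf.expectation D F + K"
    by (simp add: int)
  finally show ?thesis unfolding D_def by simp
qed

text \<open>Agreement at every single rate suffices; it follows from the lower bound 0 applied to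
  both differences, since X \<ge> 4 keeps the rate 1 / X inside (0, 1).\<close>

lemma D0_expectation_cong:
  fixes F G :: "'a set \<Rightarrow> real"
  assumes N: "finite N" "N \<noteq> {}" and eq: "\<And>q. 0 < q \<Longrightarrow> q < 1 \<Longrightarrow> subset_mean q N F = subset_mean q N G"
  shows "measure_pmf.expectation (D0 (real (card N) / 16) N) F = measure_pmf.expectation (D0 (real (card N) / 16) N) G"
proof -
  have int: "integrable (measure_pmf (D0 (real (card N) / 16) N)) f" for f :: "'a set \<Rightarrow> real"
    using set_pmf_D0[of "real (card N) / 16" N] N
    by (intro integrable_measure_pmf_finite) (auto simp: card_gt_0_iff intro: finite_subset)
  have *: "0 \<le> measure_pmf.expectation (D0 (real (card N) / 16) N) (\<lambda>V. F V - G V)"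
    if eq: "\<And>q. 0 < q \<Longrightarrow> q < 1 \<Longrightarrow> subset_mean q N F = subset_mean q N G" for F G :: "'a set \<Rightarrow> real"
  proof (rule D0_expectation_ge[OF N])
    fix a :: real assume a: "4 \<le> a" "a \<le> 6"
    have "integral {a..a + 14} (\<lambda>X. subset_mean (1 / X) N (\<lambda>V. F V - G V)) = integral {a..a + 14} (\<lambda>X. 0::real)"
      using a by (intro integral_cong) (auto simp: subset_mean_diff eq)
    then show "14 * 0 \<le> integral {a..a + 14} (\<lambda>X. subset_mean (1 / X) N (\<lambda>V. F V - G V))" by simp
  qed
  from *[of F G] *[of G F] show ?thesis using eq by (simp add: int)
qed

lemma D0_expectation_le:
  fixes F :: "'a set \<Rightarrow> real"
  assumes N: "finite N" "N \<noteq> {}" and le: "\<And>q. 1/20 \<le> q \<Longrightarrow> q \<le> 1/4 \<Longrightarrow> subset_mean q N F \<le> c"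
  shows "measure_pmf.expectation (D0 (real (card N) / 16) N) F \<le> c"
proof -
  have "- c \<le> measure_pmf.expectation (D0 (real (card N) / 16) N) (\<lambda>V. - 1 * F V)"
  proof (rule D0_expectation_ge[OF N])
    fix a :: real assume a: "4 \<le> a" "a \<le> 6"
    have "14 * - c = integral {a..a + 14} (\<lambda>X. - c)" by simp
    also have "\<dots> \<le> integral {a..a + 14} (\<lambda>X. subset_mean (1 / X) N (\<lambda>V. - 1 * F V))"
    proof (rule integral_le)
      show "(\<lambda>X. subset_mean (1 / X) N (\<lambda>V. - 1 * F V)) integrable_on {a..a + 14}"
        by (rule integrable_continuous_real, rule continuous_on_compose2[OF continuous_on_subset_mean[of UNIV]])
          (use a in \<open>auto intro!: continuous_intros\<close>)
      show "- c \<le> subset_mean (1 / X) N (\<lambda>V. - 1 * F V)" if "X \<in> {a..a + 14}" for X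
        using le[of "1 / X"] that a unfolding subset_mean_cmult by (auto simp: field_simps)
    qed auto
    finally show "14 * - c \<le> integral {a..a + 14} (\<lambda>X. subset_mean (1 / X) N (\<lambda>V. - 1 * F V))" .
  qed
  then show ?thesis by simp
qed


section \<open>Correct maps on the layers of fixed cardinality\<close>

lemma cond_pmf_eq_pmf_of_set:
  assumes T: "finite T" "T \<noteq> {}" "T \<subseteq> E" "set_pmf D \<inter> E \<subseteq> T"
    and w: "\<And>V. V \<in> T \<Longrightarrow> pmf D V = w" "0 < w"
  shows "cond_pmf D E = pmf_of_set T"
proof -
  have ne: "set_pmf D \<inter> E \<noteq> {}"
  proof -
    obtain V where "V \<in> T" using T by auto
    then have "V \<in> set_pmf D \<inter> E" using T(3) w(1)[of V] w(2) by (auto simp: set_pmf_iff)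
    then show ?thesis by blast
  qed
  have "measure (measure_pmf D) E = measure (measure_pmf D) T"
    by (rule measure_pmf.finite_measure_eq_AE) (use T in \<open>auto simp: AE_measure_pmf_iff\<close>)
  also have "\<dots> = (\<Sum>V\<in>T. pmf D V)" using T by (intro measure_measure_pmf_finite)
  also have "\<dots> = real (card T) * w" using w by simp
  finally have m: "measure (measure_pmf D) E = real (card T) * w" .
  show ?thesis
  proof (rule pmf_eqI)
    fix V
    have "pmf D V = 0" if "V \<in> E" "V \<notin> T" using that T by (auto simp: set_pmf_iff)
    then show "pmf (cond_pmf D E) V = pmf (pmf_of_set T) V"
      using T w by (auto simp: pmf_cond[OF ne] m indicator_def)
  qed
qed

lemma pmf_query_dist:
  "pmf (query_dist A N M) V = measure_pmf.expectation (D0 A N) (\<lambda>U. of_bool (M \<union> U = V))"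
proof -
  have "pmf (query_dist A N M) V = measure (measure_pmf (D0 A N)) ((\<lambda>U. M \<union> U) -` {V})"
    by (simp add: query_dist_def pmf_map)
  also have "\<dots> = measure_pmf.expectation (D0 A N) (indicator ((\<lambda>U. M \<union> U) -` {V}))"
    by simp
  also have "\<dots> = measure_pmf.expectation (D0 A N) (\<lambda>U. of_bool (M \<union> U = V))"
    by (intro integral_cong_AE) (auto simp: indicator_def)
  finally show ?thesis .
qed

lemma subset_mean_point:
  assumes "finite N" "M \<subseteq> N" "W \<subseteq> N - M"
  shows "subset_mean q N (\<lambda>U. of_bool (M \<union> U = M \<union> W)) = q ^ card W * (1 - q) ^ (card (N - M) - card W)"
proof -
  have "subset_mean q N (\<lambda>U. of_bool (M \<union> U = M \<union> W)) = subset_mean q N (\<lambda>U. (\<lambda>V. of_bool (V = W)) (U \<inter> (N - M)))"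
    using assms by (intro subset_mean_cong arg_cong[of _ _ of_bool]) auto
  also have "\<dots> = subset_mean q (N - M) (\<lambda>V. of_bool (V = W))"
    using assms by (intro subset_mean_marginal) auto
  also have "\<dots> = (\<Sum>V\<in>Pow (N - M). if V = W then q ^ card W * (1 - q) ^ (card (N - M) - card W) else 0)"
    unfolding subset_mean_def by (intro sum.cong) auto
  also have "\<dots> = q ^ card W * (1 - q) ^ (card (N - M) - card W)"
    using assms by (subst sum.delta) auto
  finally show ?thesis .
qed

text \<open>At every rate the probability of the query \<open>M \<union> W\<close> depends on
  \<open>W\<close> only through its size, so this survives mixing and the rate disappears after
  conditioning. The layer condition of a correct map thereby becomes a plain average.\<close>

lemma query_dist_uniform:
  fixes N :: "'a set"
  assumes N: "finite N" "N \<noteq> {}" and M: "M \<subseteq> N" and c: "c \<le> card (N - M)"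
  defines "T \<equiv> (\<union>) M ` {W. W \<subseteq> N - M \<and> card W = c}"
  defines "D \<equiv> query_dist (real (card N) / 16) N M"
  shows "set_pmf D \<inter> {V. card V = card M + c} \<noteq> {}"
    and "cond_pmf D {V. card V = card M + c} = pmf_of_set T"
proof -
  have n: "0 < real (card N)" using N by (simp add: card_gt_0_iff)
  obtain W0 where W0: "W0 \<subseteq> N - M" "card W0 = c"
    using obtain_subset_with_card_n[OF c] by blast
  define w where "w = pmf D (M \<union> W0)"
  have pmfD: "pmf D V = measure_pmf.expectation (D0 (real (card N) / 16) N) (\<lambda>U. of_bool (M \<union> U = V))" for V
    by (simp add: D_def pmf_query_dist)
  have cM: "card (M \<union> W) = card M + card W" if "W \<subseteq> N - M" for W
    using that M N by (subst card_Un_disjoint) (auto intro: finite_subset)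
  have eq: "pmf D V = w" if "V \<in> T" for V
    using that W0 N M unfolding w_def pmfD T_def
    by (intro D0_expectation_cong) (auto simp: subset_mean_point)
  have pos: "0 < w"
  proof -
    \<comment> \<open>For X between 4 and 20 both 1 / X and 1 - 1 / X are at least 1/20.\<close>
    have "(1/20) ^ card W0 * (1/20) ^ (card (N - M) - card W0) \<le> w"
      unfolding w_def pmfD
    proof (rule D0_expectation_ge[OF N])
      fix a :: real assume a: "4 \<le> a" "a \<le> 6"
      have "14 * ((1/20) ^ card W0 * (1/20) ^ (card (N - M) - card W0))
        = integral {a..a+14} (\<lambda>X::real. (1/20) ^ card W0 * (1/20) ^ (card (N - M) - card W0) :: real)"
        by simp
      also have "\<dots> \<le> integral {a..a + 14} (\<lambda>X. subset_mean (1 / X) N (\<lambda>U. of_bool (M \<union> U = M \<union> W0)))"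
      proof (rule integral_le)
        show "(\<lambda>X. subset_mean (1 / X) N (\<lambda>U. of_bool (M \<union> U = M \<union> W0))) integrable_on {a..a + 14}"
          by (rule integrable_continuous_real, rule continuous_on_compose2[OF continuous_on_subset_mean[of UNIV]])
            (use a in \<open>auto intro!: continuous_intros\<close>)
        fix X assume X: "X \<in> {a..a + 14}"
        show "(1/20) ^ card W0 * (1/20) ^ (card (N - M) - card W0) \<le> subset_mean (1 / X) N (\<lambda>U. of_bool (M \<union> U = M \<union> W0))"
          unfolding subset_mean_point[OF N(1) M W0(1)]
          by (intro mult_mono power_mono) (use X a in \<open>auto simp: field_simps\<close>)
      qed auto
      finally show "14 * ((1/20) ^ card W0 * (1/20) ^ (card (N - M) - card W0))
        \<le> integral {a..a + 14} (\<lambda>X. subset_mean (1 / X) N (\<lambda>U. of_bool (M \<union> U = M \<union> W0)))" .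
    qed
    then show ?thesis by (rule less_le_trans[rotated]) simp
  qed
  have TE: "T \<subseteq> {V. card V = card M + c}" unfolding T_def by (auto simp: cM)
  have sub: "set_pmf D \<inter> {V. card V = card M + c} \<subseteq> T"
  proof
    fix V assume V: "V \<in> set_pmf D \<inter> {V. card V = card M + c}"
    then obtain U where U: "U \<in> set_pmf (D0 (real (card N) / 16) N)" "V = M \<union> U"
      by (auto simp: D_def query_dist_def)
    then have "U \<subseteq> N" using set_pmf_D0[of "real (card N) / 16" N] N n by auto
    then have V': "V = M \<union> (U - M)" "U - M \<subseteq> N - M" using U by auto
    then have "card (U - M) = c" using V cM[of "U - M"] by auto
    then show "V \<in> T" unfolding T_def using V' by auto
  qed
  have "finite {W. W \<subseteq> N - M \<and> card W = c}" using N by auto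
  then have fT: "finite T" unfolding T_def by (rule finite_imageI)
  have W0T: "M \<union> W0 \<in> T" unfolding T_def using W0 by auto
  then have "M \<union> W0 \<in> set_pmf D" using pos by (auto simp: w_def set_pmf_iff)
  then show "set_pmf D \<inter> {V. card V = card M + c} \<noteq> {}" using W0T TE by auto
  show "cond_pmf D {V. card V = card M + c} = pmf_of_set T"
    by (rule cond_pmf_eq_pmf_of_set[OF fT _ TE sub eq pos]) (use W0T in auto)
qed

lemma correct_map_layer_sum:
  fixes N :: "'a set"
  assumes N: "finite N" "N \<noteq> {}" and M: "M \<subseteq> N" and c: "c \<le> card (N - M)"
    and \<pi>: "correct_map S (real (card N) / 16) \<delta> (query_dist (real (card N) / 16) N M) \<pi>"
  defines "L \<equiv> {W. W \<subseteq> N - M \<and> card W = c}"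
  shows "real (card M + c) < real (card N) / 16 \<Longrightarrow> (\<Sum>W\<in>L. \<pi> (S (M \<union> W))) \<le> \<delta> * real (card L)"
    and "real (card M + c) > real (card N) / 8 \<Longrightarrow> (\<Sum>W\<in>L. \<pi> (S (M \<union> W))) \<ge> (1 - \<delta>) * real (card L)"
proof -
  have fL: "finite L" using N by (auto simp: L_def)
  have neL: "L \<noteq> {}" using obtain_subset_with_card_n[OF c] unfolding L_def by blast
  have pos: "0 < real (card L)" using fL neL by (simp add: card_gt_0_iff)
  have inj: "inj_on ((\<union>) M) L" by (auto simp: inj_on_def L_def)
  have ex: "measure_pmf.expectation (cond_pmf (query_dist (real (card N) / 16) N M) {V. card V = card M + c}) (\<lambda>V. \<pi> (S V))
     = (\<Sum>W\<in>L. \<pi> (S (M \<union> W))) / real (card L)"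
    unfolding query_dist_uniform(2)[OF N M c] L_def[symmetric]
    using fL neL by (subst integral_pmf_of_set) (simp_all add: sum.reindex[OF inj] card_image[OF inj])
  note * = \<pi>[unfolded correct_map_def, THEN conjunct2, rule_format, OF query_dist_uniform(1)[OF N M c], unfolded ex]
  show "real (card M + c) < real (card N) / 16 \<Longrightarrow> (\<Sum>W\<in>L. \<pi> (S (M \<union> W))) \<le> \<delta> * real (card L)"
    using *[THEN conjunct1] pos by (simp add: field_simps)
  show "real (card M + c) > real (card N) / 8 \<Longrightarrow> (\<Sum>W\<in>L. \<pi> (S (M \<union> W))) \<ge> (1 - \<delta>) * real (card L)"
    using *[THEN conjunct2] pos by (simp add: field_simps)
qed

text \<open>The weight is constant on each layer of sets of equal size. This carries layerwise
  inequalities, which do not mention a rate, to an arbitrary rate q.\<close>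

lemma subset_mean_nonneg_if_layers:
  assumes "finite J" "0 \<le> q" "q \<le> 1"
    and layer: "\<And>c. c \<le> card J \<Longrightarrow> 0 \<le> (\<Sum>W | W \<subseteq> J \<and> card W = c. H W)"
  shows "0 \<le> subset_mean q J H"
proof -
  have "subset_mean q J H = (\<Sum>c\<le>card J. \<Sum>W\<in>{W\<in>Pow J. card W = c}. q ^ card W * (1 - q) ^ (card J - card W) * H W)"
    unfolding subset_mean_def using assms by (intro sum.group[symmetric]) (auto intro: card_mono)
  also have "\<dots> = (\<Sum>c\<le>card J. q ^ c * (1 - q) ^ (card J - c) * (\<Sum>W | W \<subseteq> J \<and> card W = c. H W))"
    unfolding sum_distrib_left by (intro sum.cong) auto
  also have "\<dots> \<ge> 0"
  proof (rule sum_nonneg)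
    fix c assume "c \<in> {..card J}"
    then show "0 \<le> q ^ c * (1 - q) ^ (card J - c) * (\<Sum>W | W \<subseteq> J \<and> card W = c. H W)"
      using assms(2,3) by (intro mult_nonneg_nonneg[OF _ layer]) auto
  qed
  finally show ?thesis .
qed

lemma subset_mean_card_prob:
  assumes "finite N" "0 \<le> q" "q \<le> 1"
  shows "subset_mean q N (\<lambda>U. of_bool (P (card U))) = measure_pmf.prob (binomial_pmf (card N) q) {x. P x}"
proof -
  have "binomial_pmf (card N) q = map_pmf card (random_subset q N)"
    using assms by (subst binomial_pmf_altdef'[of N "card N" q False])
      (auto simp: random_subset_def pmf.map_comp o_def)
  then have "measure_pmf.prob (binomial_pmf (card N) q) {x. P x}
     = measure_pmf.expectation (random_subset q N) (indicator (card -` {x. P x}))" by simp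
  also have "\<dots> = measure_pmf.expectation (random_subset q N) (\<lambda>U. of_bool (P (card U)))"
    by (intro integral_cong_AE) (auto simp: indicator_def)
  finally show ?thesis using assms by (simp add: expectation_random_subset)
qed

lemma exp_minus_le_thousandth: "(x::real) \<ge> 11 \<Longrightarrow> exp (- x) \<le> 1 / 1000"
proof -
  assume "x \<ge> 11"
  have "(1000::real) \<le> 2 ^ 11" by simp
  also have "\<dots> \<le> exp 1 ^ 11" using exp_ge_add_one_self[of 1] by (intro power_mono) auto
  also have "\<dots> = exp 11" by (simp flip: exp_of_nat_mult)
  also have "\<dots> \<le> exp x" using \<open>x \<ge> 11\<close> by simp
  finally show ?thesis by (simp add: exp_minus field_simps)
qed

section \<open>From layers to the mean response at the two ends of the rate interval\<close>

text \<open>Hoeffding's inequality at the extreme rates. The level 23/400 is 1/16 - 1/200, leaving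
  room for a mask of |N| / 200 keys, and it exceeds 1/18 by more than 1/600. The resulting exponent
  |N| / 180000 must reach 11, whence the bound 2 * 10^6 on |N|.\<close>

lemma subset_mean_card_tails:
  assumes "finite N" "real (card N) \<ge> 2 * 10 ^ 6"
  shows "1/6 \<le> q \<Longrightarrow> q \<le> 1 \<Longrightarrow> subset_mean q N (\<lambda>U. of_bool (real (card U) \<le> real (card N) / 8)) \<le> 1 / 1000"
    and "0 \<le> q \<Longrightarrow> q \<le> 1/18 \<Longrightarrow> subset_mean q N (\<lambda>U. of_bool (real (card U) \<ge> real (card N) * 23 / 400)) \<le> 1 / 1000"
proof -
  define n where "n = card N"
  have n: "real n \<ge> 2 * 10 ^ 6" "0 < n" using assms by (auto simp: n_def intro: Nat.gr0I)
  {
    assume q: "1/6 \<le> q" "q \<le> 1"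
    interpret binomial_distribution n q using q by unfold_locales auto
    have "subset_mean q N (\<lambda>U. of_bool (real (card U) \<le> real n / 8)) = measure_pmf.prob (binomial_pmf n q) {x. real x \<le> real n / 8}"
      using q assms subset_mean_card_prob[of N q "\<lambda>x. real x \<le> real n / 8"] by (simp add: n_def)
    also have "\<dots> \<le> measure_pmf.prob (binomial_pmf n q) {x. real x \<le> real n * q - real n / 24}"
    proof (intro measure_pmf.finite_measure_mono subsetI)
      fix x assume "x \<in> {x. real x \<le> real n / 8}"
      moreover have "real n * (1/6) \<le> real n * q" using q by (intro mult_left_mono) auto
      ultimately show "x \<in> {x. real x \<le> real n * q - real n / 24}" by auto
    qed auto
    also have "\<dots> \<le> exp (- 2 * (real n / 24)\<^sup>2 / real n)" using prob_le[OF n(2), of "real n / 24"] by simp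
    also have "- 2 * (real n / 24)\<^sup>2 / real n = - (real n / 288)" using n by (simp add: field_simps power2_eq_square)
    also have "exp \<dots> \<le> 1 / 1000" using n by (intro exp_minus_le_thousandth) auto
    finally show "subset_mean q N (\<lambda>U. of_bool (real (card U) \<le> real (card N) / 8)) \<le> 1 / 1000" by (simp add: n_def)
  next
    assume q: "0 \<le> q" "q \<le> 1/18"
    interpret binomial_distribution n q using q by unfold_locales auto
    have "subset_mean q N (\<lambda>U. of_bool (real (card U) \<ge> real n * 23 / 400)) = measure_pmf.prob (binomial_pmf n q) {x. real x \<ge> real n * 23 / 400}"
      using q assms subset_mean_card_prob[of N q "\<lambda>x. real x \<ge> real n * 23 / 400"] by (simp add: n_def)
    also have "\<dots> \<le> measure_pmf.prob (binomial_pmf n q) {x. real x \<ge> real n * q + real n / 600}"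
    proof (intro measure_pmf.finite_measure_mono subsetI)
      fix x assume "x \<in> {x. real x \<ge> real n * 23 / 400}"
      moreover have "real n * q \<le> real n * (1/18)" using q by (intro mult_left_mono) auto
      ultimately show "x \<in> {x. real x \<ge> real n * q + real n / 600}" by auto
    qed auto
    also have "\<dots> \<le> exp (- 2 * (real n / 600)\<^sup>2 / real n)" using prob_ge[OF n(2), of "real n / 600"] by simp
    also have "- 2 * (real n / 600)\<^sup>2 / real n = - (real n / 180000)" using n by (simp add: field_simps power2_eq_square)
    also have "exp \<dots> \<le> 1 / 1000" using n by (intro exp_minus_le_thousandth) auto
    finally show "subset_mean q N (\<lambda>U. of_bool (real (card U) \<ge> real (card N) * 23 / 400)) \<le> 1 / 1000" by (simp add: n_def)
  }
qed

text \<open>A rate of at least 1/6 produces queries above 2A = |N| / 8, and a rate of at most 1/18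
  queries below A = |N| / 16 even with the mask added. The error is \<delta> \<le> 1/100 plus a size
  tail of 1/1000.\<close>

lemma correct_map_mean:
  fixes N :: "'a set"
  assumes N: "finite N" "real (card N) \<ge> 2 * 10 ^ 6" and M: "M \<subseteq> N" "real (card M) \<le> real (card N) / 200"
    and \<pi>: "correct_map S (real (card N) / 16) \<delta> (query_dist (real (card N) / 16) N M) \<pi>"
    and \<delta>: "0 \<le> \<delta>" "\<delta> \<le> 1/100"
  shows "1/6 \<le> q \<Longrightarrow> q \<le> 1 \<Longrightarrow> subset_mean q N (\<lambda>U. \<pi> (S (M \<union> U))) \<ge> 989/1000"
    and "0 \<le> q \<Longrightarrow> q \<le> 1/18 \<Longrightarrow> subset_mean q N (\<lambda>U. \<pi> (S (M \<union> U))) \<le> 11/1000"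
proof -
  have ne: "N \<noteq> {}" using N by auto
  have p01: "0 \<le> \<pi> s" "\<pi> s \<le> 1" for s using \<pi> by (auto simp: correct_map_def)
  have cM: "card (M \<union> W) = card M + card W" if "W \<subseteq> N - M" for W
    using that M N by (subst card_Un_disjoint) (auto intro: finite_subset)
  have marg: "subset_mean q N (\<lambda>U. F (M \<union> U)) = subset_mean q (N - M) (\<lambda>W. F (M \<union> W))" for q and F :: "'a set \<Rightarrow> real"
  proof -
    have "subset_mean q N (\<lambda>U. F (M \<union> U)) = subset_mean q N (\<lambda>U. (\<lambda>W. F (M \<union> W)) (U \<inter> (N - M)))"
      by (intro subset_mean_cong arg_cong[of _ _ F]) auto
    then show ?thesis using subset_mean_marginal[of N "N - M" q "\<lambda>W. F (M \<union> W)"] N by simp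
  qed
  {
    assume q: "1/6 \<le> q" "q \<le> 1"
    \<comment> \<open>The indicator silences the layers on which correctness says nothing, so every
      layer sum is non-negative; dropping it again costs only the size tail.\<close>
    define H where "H V = (\<pi> (S V) - (1 - \<delta>)) * of_bool (real (card V) > real (card N) / 8)" for V
    have "0 \<le> subset_mean q (N - M) (\<lambda>W. H (M \<union> W))"
    proof (rule subset_mean_nonneg_if_layers)
      fix c assume c: "c \<le> card (N - M)"
      show "0 \<le> (\<Sum>W | W \<subseteq> N - M \<and> card W = c. H (M \<union> W))"
      proof (cases "real (card M + c) > real (card N) / 8")
        case True
        have "(\<Sum>W | W \<subseteq> N - M \<and> card W = c. H (M \<union> W)) = (\<Sum>W | W \<subseteq> N - M \<and> card W = c. \<pi> (S (M \<union> W)) - (1 - \<delta>))"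
          using True by (intro sum.cong) (auto simp: H_def cM)
        then show ?thesis using correct_map_layer_sum(2)[OF N(1) ne M(1) c \<pi> True] by (simp add: sum_subtractf mult.commute)
      next
        case False
        then have "(\<Sum>W | W \<subseteq> N - M \<and> card W = c. H (M \<union> W)) = 0"
          by (intro sum.neutral) (auto simp: H_def cM)
        then show ?thesis by simp
      qed
    qed (use N q in auto)
    then have "0 \<le> subset_mean q N (\<lambda>U. H (M \<union> U))" unfolding marg .
    also have "\<dots> \<le> subset_mean q N (\<lambda>U. \<pi> (S (M \<union> U)) - (1 - \<delta>) + of_bool (real (card U) \<le> real (card N) / 8))"
    proof (rule subset_mean_mono)
      fix U assume U: "U \<subseteq> N"
      show "H (M \<union> U) \<le> \<pi> (S (M \<union> U)) - (1 - \<delta>) + of_bool (real (card U) \<le> real (card N) / 8)"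
      proof (cases "real (card U) \<le> real (card N) / 8")
        case True
        then show ?thesis using p01[of "S (M \<union> U)"] \<delta> by (auto simp: H_def)
      next
        case False
        have "card U \<le> card (M \<union> U)" using U M N by (intro card_mono) (auto intro: finite_subset)
        then show ?thesis using False by (auto simp: H_def)
      qed
    qed (use q in auto)
    also have "\<dots> = subset_mean q N (\<lambda>U. \<pi> (S (M \<union> U))) - (1 - \<delta>) + subset_mean q N (\<lambda>U. of_bool (real (card U) \<le> real (card N) / 8))"
      using N by (simp add: subset_mean_add subset_mean_diff subset_mean_const)
    finally show "subset_mean q N (\<lambda>U. \<pi> (S (M \<union> U))) \<ge> 989/1000"
      using subset_mean_card_tails(1)[OF N q] \<delta> by simp
  next
    assume q: "0 \<le> q" "q \<le> 1/18"
    define H where "H V = (\<delta> - \<pi> (S V)) * of_bool (real (card V) < real (card N) / 16)" for V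
    have "0 \<le> subset_mean q (N - M) (\<lambda>W. H (M \<union> W))"
    proof (rule subset_mean_nonneg_if_layers)
      fix c assume c: "c \<le> card (N - M)"
      show "0 \<le> (\<Sum>W | W \<subseteq> N - M \<and> card W = c. H (M \<union> W))"
      proof (cases "real (card M + c) < real (card N) / 16")
        case True
        have "(\<Sum>W | W \<subseteq> N - M \<and> card W = c. H (M \<union> W)) = (\<Sum>W | W \<subseteq> N - M \<and> card W = c. \<delta> - \<pi> (S (M \<union> W)))"
          using True by (intro sum.cong) (auto simp: H_def cM)
        then show ?thesis using correct_map_layer_sum(1)[OF N(1) ne M(1) c \<pi> True] by (simp add: sum_subtractf mult.commute)
      next
        case False
        then have "(\<Sum>W | W \<subseteq> N - M \<and> card W = c. H (M \<union> W)) = 0"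
          by (intro sum.neutral) (auto simp: H_def cM)
        then show ?thesis by simp
      qed
    qed (use N q in auto)
    then have "0 \<le> subset_mean q N (\<lambda>U. H (M \<union> U))" unfolding marg .
    also have "\<dots> \<le> subset_mean q N (\<lambda>U. \<delta> - \<pi> (S (M \<union> U)) + of_bool (real (card U) \<ge> real (card N) * 23 / 400))"
    proof (rule subset_mean_mono)
      fix U assume U: "U \<subseteq> N"
      show "H (M \<union> U) \<le> \<delta> - \<pi> (S (M \<union> U)) + of_bool (real (card U) \<ge> real (card N) * 23 / 400)"
      proof (cases "real (card U) \<ge> real (card N) * 23 / 400")
        case True
        then show ?thesis using p01[of "S (M \<union> U)"] \<delta> by (auto simp: H_def)
      next
        case False
        have "card (M \<union> U) \<le> card M + card U" by (rule card_Un_le)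
        then have "real (card (M \<union> U)) \<le> real (card M) + real (card U)" by (metis of_nat_add of_nat_le_iff)
        then show ?thesis using False M by (auto simp: H_def)
      qed
    qed (use q in auto)
    also have "\<dots> = \<delta> - subset_mean q N (\<lambda>U. \<pi> (S (M \<union> U))) + subset_mean q N (\<lambda>U. of_bool (real (card U) \<ge> real (card N) * 23 / 400))"
      using N by (simp add: subset_mean_add subset_mean_diff subset_mean_const)
    finally show "subset_mean q N (\<lambda>U. \<pi> (S (M \<union> U))) \<le> 11/1000"
      using subset_mean_card_tails(2)[OF N q] \<delta> by simp
  }
qed


section \<open>The advantage of important keys in one round\<close>

text \<open>
  \<open>hit U\<close> says that \<open>U\<close> contains enough low-hash keys for the sketch of any \<open>V \<supseteq> U\<close> to be a function
  of \<open>V \<inter> I\<close>; the keys outside \<open>I\<close> are then invisible to the responder.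
\<close>

locale important_keys =
  fixes S :: "'a set \<Rightarrow> sketch" and N I :: "'a set" and hit :: "'a set \<Rightarrow> bool" and \<epsilon> :: real
  assumes finN: "finite N" and card_N: "real (card N) \<ge> 2 * 10 ^ 6"
    and I_N: "I \<subseteq> N" and card_I: "real (card I) \<le> real (card N) / 400"
    and hit: "U \<subseteq> V \<Longrightarrow> V \<subseteq> N \<Longrightarrow> hit U \<Longrightarrow> S V = S (V \<inter> I)"
    and miss: "1/20 \<le> q \<Longrightarrow> q \<le> 1/4 \<Longrightarrow> subset_mean q N (\<lambda>U. of_bool (\<not> hit U)) \<le> \<epsilon>"
    and \<epsilon>: "0 \<le> \<epsilon>" "\<epsilon> \<le> 1/1000" "real (card I) * \<epsilon> \<le> 1/20"
begin

abbreviation "A \<equiv> real (card N) / 16"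

lemma N_ne: "N \<noteq> {}" using card_N by auto

lemma integrable_D0: "integrable (measure_pmf (D0 A N)) (f :: 'a set \<Rightarrow> real)"
  using set_pmf_D0[of A N] finN card_N N_ne
  by (intro integrable_measure_pmf_finite) (auto simp: card_gt_0_iff intro: finite_subset)

text \<open>When \<open>h\<close> is the response probability, this is the expected increment of the
  score of \<open>x\<close> in one round.\<close>

definition gain :: "('a set \<Rightarrow> real) \<Rightarrow> 'a \<Rightarrow> real" where
  "gain h x = measure_pmf.expectation (D0 A N) (\<lambda>U. of_bool (x \<in> U) * h U)"

text \<open>Up to the event of missing the important keys, the response is a function
  \<open>f\<close> of \<open>U \<inter> J\<close>. Every key outside \<open>I\<close> then has the
  same expected increment, and this common value is the baseline. The total excess of
  \<open>J\<close> is the mixture of q (1 - q) g'(q), where g is the mean of \<open>f\<close> at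
  rate q.\<close>

lemma round_advantage:
  assumes M: "M \<subseteq> N" "real (card M) \<le> real (card N) / 200"
    and \<pi>: "correct_map S A \<delta> (query_dist A N M) \<pi>" and \<delta>: "0 \<le> \<delta>" "\<delta> \<le> 1/100"
  obtains p where "0 \<le> p" "p \<le> 1"
    "\<And>x. x \<in> N - I \<Longrightarrow> \<bar>gain (\<lambda>U. \<pi> (S (M \<union> U))) x - p\<bar> \<le> \<epsilon>"
    "(\<Sum>x\<in>I - M. gain (\<lambda>U. \<pi> (S (M \<union> U))) x - p) \<ge> 1/10"
proof -
  define J where "J = I - M"
  define f where "f W = \<pi> (S ((M \<inter> I) \<union> W))" for W
  define G where "G U = \<pi> (S (M \<union> U))" for U
  have p01: "0 \<le> \<pi> s" "\<pi> s \<le> 1" for s using \<pi> by (auto simp: correct_map_def)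
  have J: "J \<subseteq> N" "finite J" "card J \<le> card I" using I_N finN
    by (auto simp: J_def intro: finite_subset card_mono)
  have "card I < card N" using card_I card_N by simp
  then obtain x0 where x0: "x0 \<in> N - I"
    by (metis I_N Diff_eq_empty_iff all_not_in_conv card_mono finN finite_subset leD subset_antisym)
  \<comment> \<open>The choice of \<open>x0\<close> is immaterial: all keys outside \<open>I\<close>
    are independent of \<open>U \<inter> J\<close> given the rate.\<close>
  define p where "p = gain (\<lambda>U. f (U \<inter> J)) x0"
  have close: "\<bar>G U - f (U \<inter> J)\<bar> \<le> of_bool (\<not> hit U)" if U: "U \<subseteq> N" for U
  proof (cases "hit U")
    case True
    have "S (M \<union> U) = S ((M \<union> U) \<inter> I)" using True U M by (intro hit[of U]) auto
    also have "(M \<union> U) \<inter> I = (M \<inter> I) \<union> (U \<inter> J)" by (auto simp: J_def)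
    finally show ?thesis by (simp add: f_def G_def)
  next
    case False
    show ?thesis using False p01[of "S (M \<union> U)"] p01[of "S ((M \<inter> I) \<union> (U \<inter> J))"] by (auto simp: f_def G_def)
  qed
  have missD: "measure_pmf.expectation (D0 A N) (\<lambda>U. of_bool (\<not> hit U)) \<le> \<epsilon>"
    using miss by (intro D0_expectation_le[OF finN N_ne])
  have D0N: "AE U in measure_pmf (D0 A N). U \<subseteq> N"
    using set_pmf_D0[of A N] finN N_ne card_N by (auto simp: AE_measure_pmf_iff)
  have gain_close: "\<bar>gain G x - gain (\<lambda>U. f (U \<inter> J)) x\<bar> \<le> \<epsilon>" for x
  proof -
    have "\<bar>gain G x - gain (\<lambda>U. f (U \<inter> J)) x\<bar> = \<bar>measure_pmf.expectation (D0 A N) (\<lambda>U. of_bool (x \<in> U) * G U - of_bool (x \<in> U) * f (U \<inter> J))\<bar>"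
      unfolding gain_def by (simp add: integrable_D0)
    also have "\<dots> \<le> measure_pmf.expectation (D0 A N) (\<lambda>U. \<bar>of_bool (x \<in> U) * G U - of_bool (x \<in> U) * f (U \<inter> J)\<bar>)"
      by (rule integral_abs_bound)
    also have "\<dots> \<le> measure_pmf.expectation (D0 A N) (\<lambda>U. of_bool (\<not> hit U))"
    proof (rule integral_mono_AE[OF integrable_D0 integrable_D0])
      show "AE U in measure_pmf (D0 A N). \<bar>of_bool (x \<in> U) * G U - of_bool (x \<in> U) * f (U \<inter> J)\<bar> \<le> of_bool (\<not> hit U)"
        using D0N
      proof eventually_elim
        case (elim U)
        then show ?case using close[of U] by (cases "x \<in> U") auto
      qed
    qed
    finally show ?thesis using missD by linarith
  qed
  have transparent: "gain (\<lambda>U. f (U \<inter> J)) x = p" if "x \<in> N - I" for x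
    unfolding p_def gain_def using that x0 finN J
    by (intro D0_expectation_cong[OF finN N_ne]) (subst (1 2) subset_mean_independent; auto simp: J_def)
  \<comment> \<open>The derivative formula contains the rate, which is not a function of the drawn
    set. The indicator of the unimportant key \<open>x0\<close> stands in for it: given the rate it
    is independent of \<open>f (U \<inter> J)\<close> and has mean q.\<close>
  have "(\<Sum>x\<in>J. gain (\<lambda>U. f (U \<inter> J)) x - p) = measure_pmf.expectation (D0 A N)
      (\<lambda>U. \<Sum>x\<in>J. of_bool (x \<in> U) * f (U \<inter> J) - of_bool (x0 \<in> U) * f (U \<inter> J))"
    unfolding p_def gain_def by (simp add: integrable_D0)
  also have "\<dots> = measure_pmf.expectation (D0 A N)
      (\<lambda>U. f (U \<inter> J) * real (card (U \<inter> J)) - real (card J) * (of_bool (x0 \<in> U) * f (U \<inter> J)))"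
  proof (intro Bochner_Integration.integral_cong refl)
    fix U
    have "(\<Sum>x\<in>J. of_bool (x \<in> U) * f (U \<inter> J)) = f (U \<inter> J) * real (card (U \<inter> J))"
      using J by (simp add: sum_distrib_right[symmetric] of_bool_def sum.If_cases Int_commute Collect_mem_eq)
    then show "(\<Sum>x\<in>J. of_bool (x \<in> U) * f (U \<inter> J) - of_bool (x0 \<in> U) * f (U \<inter> J))
      = f (U \<inter> J) * real (card (U \<inter> J)) - real (card J) * (of_bool (x0 \<in> U) * f (U \<inter> J))"
      by (simp add: sum_subtractf)
  qed
  also have "3/20 \<le> \<dots>"
  proof (rule D0_expectation_ge[OF finN N_ne])
    fix a :: real assume a: "4 \<le> a" "a \<le> 6"
    define H where "H q = subset_mean q J (\<lambda>W. f W * (real (card W) - q * real (card J)))" for q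
    define g where "g q = subset_mean q J f" for q
    have H_eq: "subset_mean q N (\<lambda>U. f (U \<inter> J) * real (card (U \<inter> J)) - real (card J) * (of_bool (x0 \<in> U) * f (U \<inter> J))) = H q" for q
    proof -
      have "subset_mean q N (\<lambda>U. f (U \<inter> J) * real (card (U \<inter> J)) - real (card J) * (of_bool (x0 \<in> U) * f (U \<inter> J)))
        = subset_mean q J (\<lambda>W. f W * real (card W)) - real (card J) * (q * subset_mean q J f)"
        unfolding subset_mean_diff subset_mean_cmult
        using subset_mean_marginal[OF finN J(1), of q "\<lambda>W. f W * real (card W)"] x0
        by (subst subset_mean_independent[OF finN J(1)]) (auto simp: J_def)
      also have "\<dots> = subset_mean q J (\<lambda>W. f W * real (card W) - (real (card J) * q) * f W)"
        unfolding subset_mean_diff subset_mean_cmult by simp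
      also have "\<dots> = H q" unfolding H_def by (intro subset_mean_cong) (simp add: algebra_simps)
      finally show ?thesis .
    qed
    \<comment> \<open>With q = 1 / X one has q (1 - q) = (X - 1) / X^2, so the substitution turns q
      (1 - q) g'(q) into a total derivative plus g. This is the benefit of drawing the reciprocal of
      the rate uniformly.\<close>
    have der: "((\<lambda>X. - (X - 1) * g (1 / X)) has_vector_derivative (H (1 / X) - g (1 / X))) (at X within {a..a + 14})"
      if "X \<in> {a..a + 14}" for X
    proof -
      have X: "X > 1" using that a by auto
      have "(g has_real_derivative H (1 / X) / (1 / X * (1 - 1 / X))) (at (1 / X))"
        unfolding g_def H_def using X J by (intro subset_mean_has_derivative) auto
      moreover have "((\<lambda>X::real. 1 / X) has_real_derivative - (1 / X\<^sup>2)) (at X)"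
        using X by (auto intro!: derivative_eq_intros simp: power2_eq_square)
      ultimately have "((\<lambda>X. g (1 / X)) has_real_derivative H (1 / X) / (1 / X * (1 - 1 / X)) * (- (1 / X\<^sup>2))) (at X)"
        by (rule DERIV_chain2)
      then have "((\<lambda>X. - (X - 1) * g (1 / X)) has_real_derivative
          (- 1 * g (1 / X) + H (1 / X) / (1 / X * (1 - 1 / X)) * (- (1 / X\<^sup>2)) * (- (X - 1)))) (at X)"
        by (auto intro!: derivative_eq_intros)
      also have "- 1 * g (1 / X) + H (1 / X) / (1 / X * (1 - 1 / X)) * (- (1 / X\<^sup>2)) * (- (X - 1)) = H (1 / X) - g (1 / X)"
      proof -
        define e where "e = 1 / X * (1 - 1 / X)"
        have e: "e = (X - 1) * (1 / X\<^sup>2)" "e \<noteq> 0" using X by (auto simp: e_def field_simps power2_eq_square)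
        have "H (1 / X) / e * (- (1 / X\<^sup>2)) * (- (X - 1)) = H (1 / X) / e * ((X - 1) * (1 / X\<^sup>2))"
          by (simp only: mult_minus_right mult_minus_left minus_minus mult.assoc mult.commute[of "X - 1"])
        also have "\<dots> = H (1 / X)" unfolding e(1)[symmetric] using e(2) by simp
        finally show ?thesis unfolding e_def by simp
      qed
      finally have "((\<lambda>X. - (X - 1) * g (1 / X)) has_vector_derivative (H (1 / X) - g (1 / X))) (at X)"
        unfolding has_real_derivative_iff_has_vector_derivative .
      then show ?thesis by (rule has_vector_derivative_at_within)
    qed
    have int1: "((\<lambda>X. H (1 / X) - g (1 / X)) has_integral
        (- (a + 14 - 1) * g (1 / (a + 14)) - (- (a - 1) * g (1 / a)))) {a..a + 14}"
      by (rule fundamental_theorem_of_calculus) (use der in auto)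
    have g_nonneg: "0 \<le> g (1 / X)" if "X \<in> {a..a + 14}" for X
    proof -
      have "subset_mean (1 / X) J (\<lambda>_. 0) \<le> subset_mean (1 / X) J f"
        using that a p01 by (intro subset_mean_mono) (auto simp: f_def)
      then show ?thesis using J by (simp add: subset_mean_const g_def)
    qed
    have int2: "(\<lambda>X. H (1 / X)) integrable_on {a..a + 14}"
      unfolding H_eq[symmetric]
      by (rule integrable_continuous_real, rule continuous_on_compose2[OF continuous_on_subset_mean[of UNIV]])
        (use a in \<open>auto intro!: continuous_intros\<close>)
    have "(a - 1) * g (1 / a) - (a + 13) * g (1 / (a + 14)) = integral {a..a + 14} (\<lambda>X. H (1 / X) - g (1 / X))"
      unfolding integral_unique[OF int1] by (simp add: algebra_simps)
    also have "\<dots> \<le> integral {a..a + 14} (\<lambda>X. H (1 / X))"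
      using has_integral_integrable[OF int1] int2 g_nonneg by (intro integral_le) auto
    finally have low: "(a - 1) * g (1 / a) - (a + 13) * g (1 / (a + 14)) \<le> integral {a..a + 14} (\<lambda>X. H (1 / X))" .
    have g_close: "\<bar>g q - subset_mean q N G\<bar> \<le> 1/1000" if q: "1/20 \<le> q" "q \<le> 1/4" for q
    proof -
      have g: "g q = subset_mean q N (\<lambda>U. f (U \<inter> J))" unfolding g_def by (rule subset_mean_marginal[OF finN J(1), symmetric])
      have "f (U \<inter> J) - G U \<le> of_bool (\<not> hit U)" "G U - f (U \<inter> J) \<le> of_bool (\<not> hit U)" if "U \<subseteq> N" for U
        using close[OF that] by linarith+
      then have "subset_mean q N (\<lambda>U. f (U \<inter> J) - G U) \<le> subset_mean q N (\<lambda>U. of_bool (\<not> hit U))"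
        "subset_mean q N (\<lambda>U. G U - f (U \<inter> J)) \<le> subset_mean q N (\<lambda>U. of_bool (\<not> hit U))"
        using q by (auto intro!: subset_mean_mono simp del: of_bool_not_iff)
      then show ?thesis using miss[OF q] \<epsilon> unfolding g subset_mean_diff by linarith
    qed
    have "1/20 \<le> 1 / a" "1 / a \<le> 1/4" "1/6 \<le> 1 / a" "1 / a \<le> 1" using a by (auto simp: field_simps)
    then have ga: "988/1000 \<le> g (1 / a)"
      using g_close[of "1 / a"] correct_map_mean(1)[OF finN card_N M \<pi> \<delta>, of "1 / a"] unfolding G_def by linarith
    have "1/20 \<le> 1 / (a + 14)" "1 / (a + 14) \<le> 1/4" "0 \<le> 1 / (a + 14)" "1 / (a + 14) \<le> 1 / 18" using a by (auto simp: field_simps)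
    then have gb: "g (1 / (a + 14)) \<le> 12/1000"
      using g_close[of "1 / (a + 14)"] correct_map_mean(2)[OF finN card_N M \<pi> \<delta>, of "1 / (a + 14)"] unfolding G_def by linarith
    \<comment> \<open>Boundary terms: a - 1 \<ge> 3 at the high rate and a + 13 \<le> 19 at the low
      one. Their difference is at least 2.736, more than 14 * 3/20 = 2.1; replacing \<open>f\<close>
      by the true response later costs another 1/20.\<close>
    have "3 * (988/1000) \<le> (a - 1) * g (1 / a)" using a ga by (intro mult_mono) auto
    moreover have "(a + 13) * g (1 / (a + 14)) \<le> 19 * (12/1000)" using a gb g_nonneg[of "a + 14"] by (intro mult_mono) auto
    ultimately show "14 * (3 / 20) \<le> integral {a..a + 14} (\<lambda>X. subset_mean (1 / X) N
        (\<lambda>U. f (U \<inter> J) * real (card (U \<inter> J)) - real (card J) * (of_bool (x0 \<in> U) * f (U \<inter> J))))"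
      unfolding H_eq using low by linarith
  qed
  finally have "3/20 \<le> (\<Sum>x\<in>J. gain (\<lambda>U. f (U \<inter> J)) x - p)" .
  also have "\<dots> \<le> (\<Sum>x\<in>J. (gain G x - p) + \<epsilon>)"
  proof (rule sum_mono)
    show "gain (\<lambda>U. f (U \<inter> J)) x - p \<le> gain G x - p + \<epsilon>" for x
      using gain_close[of x] by linarith
  qed
  also have "\<dots> = (\<Sum>x\<in>J. gain G x - p) + real (card J) * \<epsilon>" by (simp add: sum.distrib)
  also have "real (card J) * \<epsilon> \<le> real (card I) * \<epsilon>" using J \<epsilon> by (intro mult_right_mono) auto
  finally have adv: "(\<Sum>x\<in>J. gain G x - p) \<ge> 1/10" using \<epsilon> by linarith
  have "0 \<le> p" unfolding p_def gain_def using p01 by (intro integral_nonneg_AE) (auto simp: f_def)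
  moreover have "p \<le> measure_pmf.expectation (D0 A N) (\<lambda>_. 1)"
    unfolding p_def gain_def using p01 by (intro integral_mono integrable_D0) (auto simp: f_def of_bool_def)
  then have "p \<le> 1" by simp
  moreover have "\<bar>gain G x - p\<bar> \<le> \<epsilon>" if "x \<in> N - I" for x using gain_close[of x] transparent[OF that] by simp
  ultimately show thesis using that adv unfolding J_def G_def by blast
qed

end


section \<open>Stitched supermartingales and medians\<close>

text \<open>Hoeffding's bound on the moment generating function, recentred at an upper bound
  \<open>P\<close> of the mean: since l \<ge> 0, a larger centre only lowers both
  exponentials.\<close>

lemma bernoulli_mgf:
  fixes p P l :: real
  assumes "0 \<le> l" "0 \<le> p" "p \<le> P"
  shows "p * exp (l * (1 - P)) + (1 - p) * exp (l * (- P)) \<le> exp (l\<^sup>2 / 8)"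
proof -
  have pos: "0 < 1 + p * (exp l - 1)" using assms by (intro add_pos_nonneg mult_nonneg_nonneg) auto
  have "p * exp (l * (1 - P)) + (1 - p) * exp (l * (- P)) = exp (- l * P) * (1 + p * (exp l - 1))"
    by (simp add: algebra_simps exp_diff exp_minus divide_simps)
  also have "\<dots> \<le> exp (- l * p) * (1 + p * (exp l - 1))"
    using assms pos by (intro mult_right_mono) (auto intro: mult_left_mono)
  also have "\<dots> = exp (- l * p + ln (1 + p * (exp l - 1)))"
    by (simp only: exp_add exp_ln[OF pos])
  also have "\<dots> \<le> exp (l\<^sup>2 / 8)"
    using Hoeffdings_lemma_aux[OF assms(1,2)] by simp
  finally show ?thesis .
qed

text \<open>
  A sum of exponential supermartingales, one for each epoch \<open>4\<^sup>j \<le> i < 4\<^sup>j\<^sup>+\<^sup>1\<close>, with the parameter tuned to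
  the boundary \<open>\<theta> * sqrt (i * L / 2)\<close> in that epoch. The loss against the optimal parameter is the factor \<open>4/5\<close>.
\<close>

definition stitched :: "real \<Rightarrow> real \<Rightarrow> nat \<Rightarrow> nat \<Rightarrow> real \<Rightarrow> real" where
  "stitched \<theta> L J i d = (\<Sum>j\<le>J. exp (2 * \<theta> * sqrt L / 2 ^ j * d - real i * (2 * \<theta> * sqrt L / 2 ^ j)\<^sup>2 / 8 - 4/5 * \<theta>\<^sup>2 * L))"

lemma stitched_nonneg: "0 \<le> stitched \<theta> L J i d"
  unfolding stitched_def by (intro sum_nonneg) auto

lemma stitched_0: "stitched \<theta> L J 0 0 = real (Suc J) * exp (- (4/5 * \<theta>\<^sup>2 * L))"
  unfolding stitched_def by simp

text \<open>Each summand is a supermartingale by itself: the l^2 / 8 subtracted per round is exactly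
  what the moment generating function can gain.\<close>

lemma stitched_step:
  assumes "0 \<le> \<theta>" "0 \<le> L" "0 \<le> p" "p \<le> P"
  shows "p * stitched \<theta> L J (Suc i) (d + (1 - P)) + (1 - p) * stitched \<theta> L J (Suc i) (d + (- P)) \<le> stitched \<theta> L J i d"
  unfolding stitched_def sum_distrib_left sum.distrib[symmetric]
proof (rule sum_mono)
  fix j
  define l where "l = 2 * \<theta> * sqrt L / 2 ^ j"
  have l: "0 \<le> l" using assms by (simp add: l_def)
  define E where "E = exp (l * d - real i * l\<^sup>2 / 8 - 4/5 * \<theta>\<^sup>2 * L)"
  have e: "exp (l * (d + y) - real (Suc i) * l\<^sup>2 / 8 - 4/5 * \<theta>\<^sup>2 * L) = E * (exp (l * y) / exp (l\<^sup>2 / 8))" for y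
    by (simp add: E_def field_simps flip: exp_add exp_diff)
  have "p * (E * (exp (l * (1 - P)) / exp (l\<^sup>2 / 8))) + (1 - p) * (E * (exp (l * (- P)) / exp (l\<^sup>2 / 8)))
    = E * ((p * exp (l * (1 - P)) + (1 - p) * exp (l * (- P))) / exp (l\<^sup>2 / 8))"
    by (simp add: field_simps)
  also have "\<dots> \<le> E * (exp (l\<^sup>2 / 8) / exp (l\<^sup>2 / 8))"
    using bernoulli_mgf[OF l assms(3,4)] by (intro mult_left_mono divide_right_mono) (auto simp: E_def)
  finally show "p * exp (2 * \<theta> * sqrt L / 2 ^ j * (d + (1 - P)) - real (Suc i) * (2 * \<theta> * sqrt L / 2 ^ j)\<^sup>2 / 8 - 4/5 * \<theta>\<^sup>2 * L)
    + (1 - p) * exp (2 * \<theta> * sqrt L / 2 ^ j * (d + (- P)) - real (Suc i) * (2 * \<theta> * sqrt L / 2 ^ j)\<^sup>2 / 8 - 4/5 * \<theta>\<^sup>2 * L)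
    \<le> exp (2 * \<theta> * sqrt L / 2 ^ j * d - real i * (2 * \<theta> * sqrt L / 2 ^ j)\<^sup>2 / 8 - 4/5 * \<theta>\<^sup>2 * L)"
    unfolding l_def[symmetric] e E_def[symmetric] by simp
qed

text \<open>The summand of the epoch containing \<open>i'\<close> already reaches 1. Separating
  \<open>i'\<close> from \<open>i\<close> allows scores from before a round to be compared with the
  threshold of that round.\<close>

lemma stitched_ge_1:
  assumes \<theta>: "0 \<le> \<theta>" and L: "0 \<le> L" and i: "i \<le> i'" "1 \<le> i'" "i' < 4 ^ Suc J"
    and d: "\<theta> * sqrt (real i' * L / 2) \<le> d"
  shows "1 \<le> stitched \<theta> L J i d"
proof -
  obtain j where j: "4 ^ j \<le> i'" "i' < 4 ^ (j + 1)"
    using ex_power_ivl1[of 4 i'] i by auto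
  have "(4::nat) ^ j < 4 ^ Suc J" using j i by linarith
  then have jJ: "j \<le> J" by (simp only: power_strict_increasing_iff less_Suc_eq_le)
  define u where "u = sqrt (real i') / 2 ^ j"
  have sq4: "sqrt (4 ^ j) = 2 ^ j" for j :: nat by (simp add: real_sqrt_power)
  have "sqrt (4 ^ j) \<le> sqrt (real i')" "sqrt (real i') \<le> sqrt (4 ^ (j + 1))"
  proof -
    have "real (4 ^ j) \<le> real i'" "real i' \<le> real (4 ^ (j + 1))"
      using j by (simp_all only: of_nat_le_iff less_imp_le)
    then show "sqrt (4 ^ j) \<le> sqrt (real i')" "sqrt (real i') \<le> sqrt (4 ^ (j + 1))"
      unfolding of_nat_power of_nat_numeral by (simp_all only: real_sqrt_le_iff)
  qed
  then have u: "1 \<le> u" "u \<le> 2" unfolding sq4 by (auto simp: u_def field_simps)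
  define l where "l = 2 * \<theta> * sqrt L / 2 ^ j"
  have l: "0 \<le> l" using \<theta> L by (simp add: l_def)
  have s2: "1.4 \<le> sqrt 2" by (rule real_le_rsqrt) (simp add: power2_eq_square)
  \<comment> \<open>Here u, between 1 and 2, is the position inside the epoch. The chord bound for
    u^2 and sqrt 2 \<ge> 1.4 give an exponent of at least 1 - u / 10 \<ge> 4/5 in units of
    \<open>\<theta>\<^sup>2 * L\<close>; this is the constant in \<open>stitched\<close>.\<close>
  have "(u - 1) * (2 - u) \<ge> 0" using u by simp
  then have "u\<^sup>2 \<le> 3 * u - 2" by (simp add: algebra_simps power2_eq_square)
  moreover have "1.4 * u \<le> sqrt 2 * u" using s2 u by (intro mult_right_mono) auto
  ultimately have key: "4/5 \<le> sqrt 2 * u - u\<^sup>2 / 2" using u by linarith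
  have "l * (\<theta> * sqrt (real i' * L / 2)) = \<theta>\<^sup>2 * L * (sqrt 2 * u)"
  proof -
    have "sqrt (real i' * L / 2) = sqrt (real i') * sqrt L / sqrt 2" by (simp add: real_sqrt_mult real_sqrt_divide)
    moreover have "2 / sqrt 2 = sqrt 2" by (simp add: real_div_sqrt)
    ultimately have "l * (\<theta> * sqrt (real i' * L / 2)) = \<theta>\<^sup>2 * (sqrt L * sqrt L) * (2 / sqrt 2 * u)"
    proof -
      have "2 * \<theta> * a / c * (\<theta> * (b * a / d)) = \<theta>\<^sup>2 * (a * a) * (2 / d * (b / c))" for a b c d :: real
        by (simp add: power2_eq_square ac_simps)
      then show ?thesis unfolding l_def u_def \<open>sqrt (real i' * L / 2) = sqrt (real i') * sqrt L / sqrt 2\<close> .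
    qed
    then show ?thesis using L \<open>2 / sqrt 2 = sqrt 2\<close> by simp
  qed
  moreover have "real i' * l\<^sup>2 / 8 = \<theta>\<^sup>2 * L * (u\<^sup>2 / 2)"
    using L by (simp add: l_def u_def power_mult_distrib power_divide ac_simps)
  moreover have "real i * l\<^sup>2 / 8 \<le> real i' * l\<^sup>2 / 8" using i by (intro divide_right_mono mult_right_mono) auto
  moreover have "l * (\<theta> * sqrt (real i' * L / 2)) \<le> l * d" using d l by (intro mult_left_mono)
  moreover have "\<theta>\<^sup>2 * L * (4/5) \<le> \<theta>\<^sup>2 * L * (sqrt 2 * u - u\<^sup>2 / 2)" using key L by (intro mult_left_mono) auto
  then have "\<theta>\<^sup>2 * L * (4/5) \<le> \<theta>\<^sup>2 * L * (sqrt 2 * u) - \<theta>\<^sup>2 * L * (u\<^sup>2 / 2)" by (simp only: right_diff_distrib)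
  ultimately have "0 \<le> l * d - real i * l\<^sup>2 / 8 - \<theta>\<^sup>2 * L * (4/5)" by linarith
  then have "0 \<le> l * d - real i * l\<^sup>2 / 8 - 4/5 * \<theta>\<^sup>2 * L" by (simp only: mult.commute mult.left_commute)
  then have "1 \<le> exp (l * d - real i * l\<^sup>2 / 8 - 4/5 * \<theta>\<^sup>2 * L)" by simp
  also have "\<dots> \<le> stitched \<theta> L J i d"
    unfolding stitched_def l_def using jJ by (intro member_le_sum) auto
  finally show ?thesis .
qed

section \<open>Bounds on the median\<close>

text \<open>If fewer than half of the values lie below \<open>v\<close>, neither of the two middle
  entries of the sorted list does, so their average is at least \<open>v\<close> for either
  parity.\<close>

lemma median_ge:
  fixes v :: real
  assumes "finite Y" "2 * card {y\<in>Y. real (C y) < v} < card Y"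
  shows "v \<le> median C Y"
proof -
  define s where "s = sorted_list_of_multiset (image_mset C (mset_set Y))"
  have ms: "mset s = image_mset C (mset_set Y)" by (simp add: s_def)
  then have len: "length s = card Y" by (metis size_image_mset size_mset size_mset_set)
  have sorted: "sorted s" by (simp add: s_def)
  have cnt: "length (filter (\<lambda>c. real c < v) s) = card {y\<in>Y. real (C y) < v}"
  proof -
    have "length (filter (\<lambda>c. real c < v) s) = size (filter_mset (\<lambda>c. real c < v) (image_mset C (mset_set Y)))"
      by (metis ms mset_filter size_mset)
    also have "\<dots> = card {y\<in>Y. real (C y) < v}"
      using assms(1) by (simp add: filter_mset_image_mset)
    finally show ?thesis .
  qed
  have ge: "v \<le> real (s ! a)" if a: "a < length s" "2 * a + 1 \<ge> length s - 1" for a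
  proof (rule ccontr)
    assume n: "\<not> v \<le> real (s ! a)"
    have "{..a} \<subseteq> {i. i < length s \<and> real (s ! i) < v}"
    proof
      fix i assume "i \<in> {..a}"
      then have "s ! i \<le> s ! a" using sorted a by (intro sorted_nth_mono) auto
      then show "i \<in> {i. i < length s \<and> real (s ! i) < v}" using n a \<open>i \<in> {..a}\<close> by auto
    qed
    then have "Suc a \<le> card {i. i < length s \<and> real (s ! i) < v}" using card_mono[of "{i. i < length s \<and> real (s ! i) < v}" "{..a}"] by simp
    also have "\<dots> = length (filter (\<lambda>c. real c < v) s)" by (simp add: length_filter_conv_card)
    finally show False using cnt assms(2) a len by linarith
  qed
  have pos: "0 < length s" using assms len by linarith
  have "v \<le> real (s ! ((length s - 1) div 2))" "v \<le> real (s ! (length s div 2))"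
    using pos by (intro ge; linarith)+
  moreover have "v \<le> (x + y) / 2" if "v \<le> x" "v \<le> y" for x y :: real using that by (simp add: field_simps)
  ultimately show ?thesis unfolding median_def Let_def s_def[symmetric] by blast
qed

lemma median_le:
  fixes v :: real
  assumes "finite Y" "2 * card {y\<in>Y. v < real (C y)} < card Y"
  shows "median C Y \<le> v"
proof -
  define s where "s = sorted_list_of_multiset (image_mset C (mset_set Y))"
  have ms: "mset s = image_mset C (mset_set Y)" by (simp add: s_def)
  then have len: "length s = card Y" by (metis size_image_mset size_mset size_mset_set)
  have sorted: "sorted s" by (simp add: s_def)
  have cnt: "length (filter (\<lambda>c. v < real c) s) = card {y\<in>Y. v < real (C y)}"
  proof -
    have "length (filter (\<lambda>c. v < real c) s) = size (filter_mset (\<lambda>c. v < real c) (image_mset C (mset_set Y)))"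
      by (metis ms mset_filter size_mset)
    also have "\<dots> = card {y\<in>Y. v < real (C y)}"
      using assms(1) by (simp add: filter_mset_image_mset)
    finally show ?thesis .
  qed
  have le: "real (s ! a) \<le> v" if a: "a < length s" "2 * a \<le> length s" for a
  proof (rule ccontr)
    assume n: "\<not> real (s ! a) \<le> v"
    have "{a..<length s} \<subseteq> {i. i < length s \<and> v < real (s ! i)}"
    proof
      fix i assume "i \<in> {a..<length s}"
      then have "s ! a \<le> s ! i" using sorted a by (intro sorted_nth_mono) auto
      then show "i \<in> {i. i < length s \<and> v < real (s ! i)}" using n a \<open>i \<in> {a..<length s}\<close> by auto
    qed
    then have "length s - a \<le> card {i. i < length s \<and> v < real (s ! i)}" using card_mono[of "{i. i < length s \<and> v < real (s ! i)}" "{a..<length s}"] by simp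
    also have "\<dots> = length (filter (\<lambda>c. v < real c) s)" by (simp add: length_filter_conv_card)
    finally show False using cnt assms(2) a len by linarith
  qed
  have pos: "0 < length s" using assms len by linarith
  have "real (s ! ((length s - 1) div 2)) \<le> v" "real (s ! (length s div 2)) \<le> v"
    using pos by (intro le; linarith)+
  moreover have "(x + y) / 2 \<le> v" if "x \<le> v" "y \<le> v" for x y :: real using that by (simp add: field_simps)
  ultimately show ?thesis unfolding median_def Let_def s_def[symmetric] by blast
qed


section \<open>Potentials for the interaction\<close>

lemma prob_bind_le:
  assumes fin: "finite (set_pmf p)" and le: "\<And>x. x \<in> set_pmf p \<Longrightarrow> measure_pmf.prob (f x) B \<le> g x"
  shows "measure_pmf.prob (bind_pmf p f) B \<le> measure_pmf.expectation p g"
proof -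
  have g0: "0 \<le> g x" if "x \<in> set_pmf p" for x using le[OF that] measure_nonneg[of "measure_pmf (f x)" B] by linarith
  have "ennreal (measure_pmf.prob (bind_pmf p f) B) = (\<integral>\<^sup>+x. emeasure (measure_pmf (f x)) B \<partial>measure_pmf p)"
    by (simp add: emeasure_bind_pmf flip: measure_pmf.emeasure_eq_measure)
  also have "\<dots> \<le> (\<integral>\<^sup>+x. ennreal (g x) \<partial>measure_pmf p)"
    by (intro nn_integral_mono_AE) (auto simp: AE_measure_pmf_iff measure_pmf.emeasure_eq_measure intro!: ennreal_leI le)
  also have "\<dots> = ennreal (measure_pmf.expectation p g)"
    using fin g0 by (intro nn_integral_eq_integral integrable_measure_pmf_finite) (auto simp: AE_measure_pmf_iff)
  finally show ?thesis
    using g0 by (subst (asm) ennreal_le_iff) (auto intro!: integral_nonneg_AE simp: AE_measure_pmf_iff)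
qed

text \<open>The median is recomputed after every key, with scores and mask half updated. All
  intermediate scores lie between those before and after the round, and by induction only keys of
  \<open>H\<close> join the mask from outside \<open>I\<close>; median bounds uniform over such
  states therefore serve the whole round, in any processing order.\<close>

lemma fold_process_key:
  fixes C' :: "'a \<Rightarrow> nat" and vl vu :: real and i n r :: nat
  defines "t \<equiv> sqrt (real i * ln (200 * real n * real r) / 2)"
  assumes med: "\<And>M C\<^sub>1. M \<subseteq> N \<Longrightarrow> M - I \<subseteq> H \<Longrightarrow> (\<And>x. C x \<le> C\<^sub>1 x \<and> C\<^sub>1 x \<le> C' x) \<Longrightarrow>
      vl \<le> median C\<^sub>1 (N - M) \<and> median C\<^sub>1 (N - M) \<le> vu"
    and enter: "\<And>x. x \<in> N - I \<Longrightarrow> vl + t \<le> real (C' x) \<Longrightarrow> x \<in> H"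
  shows "distinct xs \<Longrightarrow> set xs \<subseteq> N \<Longrightarrow> M \<subseteq> N \<Longrightarrow> M - I \<subseteq> H \<Longrightarrow>
    (\<And>x. C x \<le> C\<^sub>1 x \<and> C\<^sub>1 x \<le> C' x) \<Longrightarrow> (\<And>x. x \<in> set xs \<Longrightarrow> C\<^sub>1 x + of_bool Z = C' x) \<Longrightarrow>
    fold (process_key n r N i Z) xs (M, C\<^sub>1) = (M', C\<^sub>2) \<Longrightarrow>
    M \<subseteq> M' \<and> M' \<subseteq> N \<and> M' - I \<subseteq> H \<and> (\<forall>x\<in>set xs - M'. real (C' x) < vu + t) \<and>
    C\<^sub>2 = (\<lambda>x. if x \<in> set xs then C' x else C\<^sub>1 x)"
proof (induction xs arbitrary: M C\<^sub>1)
  case Nil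
  then show ?case by auto
next
  case (Cons x xs)
  define Cn where "Cn = C\<^sub>1(x := C\<^sub>1 x + of_bool Z)"
  define Mn where "Mn = (if real (Cn x) \<ge> median Cn (N - M) + t then insert x M else M)"
  have Cx: "Cn x = C' x" using Cons.prems(6)[of x] by (simp add: Cn_def)
  have bounds: "C y \<le> Cn y \<and> Cn y \<le> C' y" for y
    using Cons.prems(5)[of y] Cons.prems(5)[of x] Cx by (cases "y = x") (auto simp: Cn_def)
  have m: "vl \<le> median Cn (N - M) \<and> median Cn (N - M) \<le> vu"
    by (rule med[OF Cons.prems(3,4) bounds])
  have "process_key n r N i Z x (M, C\<^sub>1) = (Mn, Cn)"
    by (simp add: process_key_def Let_def Mn_def Cn_def t_def)
  then have fold: "fold (process_key n r N i Z) xs (Mn, Cn) = (M', C\<^sub>2)"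
    using Cons.prems(7) by simp
  have Mn: "Mn \<subseteq> N" "M \<subseteq> Mn" using Cons.prems(2,3) by (auto simp: Mn_def)
  have MnH: "Mn - I \<subseteq> H"
  proof
    fix y assume y: "y \<in> Mn - I"
    show "y \<in> H"
    proof (cases "y \<in> M")
      case True then show ?thesis using y Cons.prems(4) by auto
    next
      case False
      then have "y = x" "real (Cn x) \<ge> median Cn (N - M) + t" using y by (auto simp: Mn_def split: if_splits)
      then show ?thesis using m Cx y Mn by (intro enter) auto
    qed
  qed
  have "Mn \<subseteq> M' \<and> M' \<subseteq> N \<and> M' - I \<subseteq> H \<and> (\<forall>x\<in>set xs - M'. real (C' x) < vu + t) \<and>
    C\<^sub>2 = (\<lambda>x. if x \<in> set xs then C' x else Cn x)"
  proof (rule Cons.IH[OF _ _ Mn(1) MnH bounds _ fold])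
    show "distinct xs" "set xs \<subseteq> N" using Cons.prems(1,2) by auto
    show "Cn y + of_bool Z = C' y" if "y \<in> set xs" for y
      using Cons.prems(1) Cons.prems(6)[of y] that by (auto simp: Cn_def)
  qed
  moreover have "real (C' x) < vu + t" if "x \<notin> M'"
  proof -
    have "\<not> real (Cn x) \<ge> median Cn (N - M) + t" using that calculation by (auto simp: Mn_def split: if_splits)
    then show ?thesis using m Cx by simp
  qed
  moreover have "(\<lambda>y. if y \<in> set xs then C' y else Cn y) = (\<lambda>y. if y \<in> set (x # xs) then C' y else C\<^sub>1 y)"
    using Cx by (auto simp: Cn_def fun_eq_iff)
  ultimately show ?case using Mn(2) by auto
qed

lemma card_le_card_add_if_subset:
  assumes "finite B" "finite C" "D \<subseteq> B \<union> C"
  shows "real (card D) \<le> real (card B) + real (card C)"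
  using card_mono[of "B \<union> C" D] card_Un_le[of B C] assms by simp

text \<open>One run against an arbitrary strategy. \<open>J\<close> is large enough for the epochs
  to cover all \<open>r\<close> rounds, and \<open>\<beta> * |N|\<close> is the number of
  unimportant keys tolerated in the mask. The accumulated error \<open>r * \<epsilon>\<close> stays
  below 1, and L \<ge> 7200 makes every threshold at least 60, so bounded errors can be
  absorbed.\<close>

locale attack_run = important_keys S N I hit \<epsilon>
  for S :: "'a set \<Rightarrow> sketch" and N I hit \<epsilon> +
  fixes enum :: "'a set \<Rightarrow> 'a list" and Q :: "'a round list \<Rightarrow> 'a set pmf \<Rightarrow> (sketch \<Rightarrow> real)"
    and \<delta> :: real and r J :: nat and \<alpha> \<beta> L :: real
  assumes enum: "set_enumeration enum"
    and Q: "\<And>tr D. (\<exists>\<pi>. correct_map S A \<delta> D \<pi>) \<Longrightarrow> correct_map S A \<delta> D (Q tr D)"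
    and \<delta>: "0 \<le> \<delta>" "\<delta> \<le> 1/100"
    and r: "1 \<le> r" "r < 4 ^ Suc J" "real r * \<epsilon> \<le> 1"
    and L_def: "L = ln (200 * real (card N) * real r)" and L: "7200 \<le> L"
    and \<beta>: "0 < \<beta>" "\<beta> \<le> 1/400" "real (card I) + \<beta> * real (card N) \<le> \<alpha> * real (card N)"
begin

definition thr :: "nat \<Rightarrow> real" where "thr i = sqrt (real i * L / 2)"

text \<open>
  The failure probability is bounded by a potential with three parts. Here \<open>b\<close> is the sum over the
  past rounds of the common expected increment of the scores of unimportant keys, and \<open>m = r - i\<close>
  rounds remain. \<open>low\<close> and \<open>up\<close> are at least 1 as soon as a quarter of the unimportant keys has fallen
  well below \<open>b\<close> (which would spoil the median) or \<open>\<beta> * |N|\<close> of them have come near the threshold.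
  \<open>adv\<close> is linear: an important key outside the mask scores below \<open>b + cap\<close>, while a correct map makes
  these scores gain 1/10 in total on \<open>b\<close> per round, so the rounds cannot all be played.
\<close>

definition low :: "nat \<Rightarrow> real \<Rightarrow> ('a \<Rightarrow> nat) \<Rightarrow> real" where
  "low i b C = 4 / real (card N) * (\<Sum>x\<in>N - I. stitched (1/20) L J i (b - real i * \<epsilon> - real (C x)))"

definition up :: "nat \<Rightarrow> real \<Rightarrow> 'a set \<Rightarrow> ('a \<Rightarrow> nat) \<Rightarrow> real" where
  "up i b M C = 1 / (\<beta> * real (card N)) *
     (real (card (M - I)) + (\<Sum>x\<in>N - I - M. stitched (9/10) L J i (real (C x) - b - real i * \<epsilon>)))"

definition cap :: real where "cap = 2 * thr r + 2"

definition adv :: "nat \<Rightarrow> real \<Rightarrow> 'a set \<Rightarrow> ('a \<Rightarrow> nat) \<Rightarrow> real" where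
  "adv m b M C = 10 / real r * (\<Sum>x\<in>I - M. cap - (real (C x) - b)) + (1 - real m / real r)"

definition failure :: "'a set set" where
  "failure = {M. \<not> (real (card M) < \<alpha> * real (card N) \<and> \<not> (\<exists>\<pi>. correct_map S A \<delta> (query_dist A N M) \<pi>))}"

lemma n_pos: "0 < real (card N)" using card_N by simp

lemma low_nonneg: "0 \<le> low i b C"
  unfolding low_def by (intro mult_nonneg_nonneg sum_nonneg stitched_nonneg) auto

lemma up_nonneg: "0 \<le> up i b M C"
  unfolding up_def using \<beta> by (intro mult_nonneg_nonneg add_nonneg_nonneg sum_nonneg stitched_nonneg) auto

lemma finI: "finite I" using I_N finN finite_subset by blast

text \<open>A Markov bound over keys: every key that has fallen below the barrier contributes at
  least 1 to the sum inside \<open>low\<close>.\<close>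

lemma low_count:
  assumes "low i b C < 1" "i \<le> i'" "1 \<le> i'" "i' \<le> r"
  shows "real (card {x\<in>N - I. real (C x) < b - real i * \<epsilon> - thr i' / 20}) \<le> real (card N) / 4"
proof -
  define B where "B = {x\<in>N - I. real (C x) < b - real i * \<epsilon> - thr i' / 20}"
  have "real (card B) = (\<Sum>x\<in>B. 1)" by simp
  also have "\<dots> \<le> (\<Sum>x\<in>B. stitched (1/20) L J i (b - real i * \<epsilon> - real (C x)))"
    using assms L r by (intro sum_mono stitched_ge_1[where i' = i']) (auto simp: B_def thr_def)
  also have "\<dots> \<le> (\<Sum>x\<in>N - I. stitched (1/20) L J i (b - real i * \<epsilon> - real (C x)))"
    using finN by (intro sum_mono2 stitched_nonneg) (auto simp: B_def)
  also have "\<dots> \<le> real (card N) / 4" using assms(1) n_pos unfolding low_def by (simp add: field_simps)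
  finally show ?thesis unfolding B_def .
qed

text \<open>The first part is again Markov's inequality. In the second, masking a key whose term is
  at least 1 replaces that term by exactly 1, so updating the mask cannot raise the
  potential.\<close>

lemma up_count:
  assumes "up i b M C < 1" "M \<subseteq> N"
  shows "real (card (M - I \<union> {x\<in>N - I - M. 1 \<le> stitched (9/10) L J i (real (C x) - b - real i * \<epsilon>)})) < \<beta> * real (card N)"
    and "M - I \<subseteq> M' - I \<Longrightarrow> M' - I \<subseteq> M - I \<union> {x\<in>N - I - M. 1 \<le> stitched (9/10) L J i (real (C x) - b - real i * \<epsilon>)}
        \<Longrightarrow> up i b M' C \<le> up i b M C"
proof -
  define g where "g x = stitched (9/10) L J i (real (C x) - b - real i * \<epsilon>)" for x
  define B where "B = {x\<in>N - I - M. 1 \<le> g x}"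
  have fin: "finite B" "finite (M - I)" "finite (N - I - M)" using assms(2) finN by (auto simp: B_def intro: finite_subset)
  have g0: "0 \<le> g x" for x by (simp add: g_def stitched_nonneg)
  have cB: "real (card T) \<le> (\<Sum>x\<in>T. g x)" if "T \<subseteq> B" for T
  proof -
    have "(\<Sum>x\<in>T. 1) \<le> (\<Sum>x\<in>T. g x)" using that by (intro sum_mono) (auto simp: B_def)
    then show ?thesis by simp
  qed
  have "real (card (M - I \<union> B)) \<le> real (card (M - I)) + real (card B)"
    using fin by (intro card_le_card_add_if_subset) auto
  also have "real (card B) \<le> (\<Sum>x\<in>B. g x)" by (rule cB) simp
  also have "\<dots> \<le> (\<Sum>x\<in>N - I - M. g x)" using fin g0 by (intro sum_mono2) (auto simp: B_def)
  also have "real (card (M - I)) + (\<Sum>x\<in>N - I - M. g x) < \<beta> * real (card N)"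
    using assms(1) n_pos \<beta> unfolding up_def g_def by (simp add: field_simps)
  finally show "real (card (M - I \<union> {x\<in>N - I - M. 1 \<le> stitched (9/10) L J i (real (C x) - b - real i * \<epsilon>)})) < \<beta> * real (card N)"
    by (simp add: B_def g_def)
  assume M': "M - I \<subseteq> M' - I" "M' - I \<subseteq> M - I \<union> {x\<in>N - I - M. 1 \<le> stitched (9/10) L J i (real (C x) - b - real i * \<epsilon>)}"
  define T where "T = (M' - I) - (M - I)"
  have T: "T \<subseteq> B" using M' by (auto simp: T_def B_def g_def)
  have "M' - I = (M - I) \<union> T" "(M - I) \<inter> T = {}" using M' by (auto simp: T_def)
  then have c: "card (M' - I) = card (M - I) + card T"
    using fin T by (simp add: card_Un_disjoint finite_subset)
  have "N - I - M = (N - I - M') \<union> T" "(N - I - M') \<inter> T = {}"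
    using M' T by (auto simp: T_def B_def)
  then have "(\<Sum>x\<in>N - I - M. g x) = (\<Sum>x\<in>N - I - M'. g x) + (\<Sum>x\<in>T. g x)"
    using fin T finN by (metis (no_types, lifting) finite_Un sum.union_disjoint)
  with cB[OF T] c have "real (card (M' - I)) + (\<Sum>x\<in>N - I - M'. g x) \<le> real (card (M - I)) + (\<Sum>x\<in>N - I - M. g x)"
    by simp
  then show "up i b M' C \<le> up i b M C"
    unfolding up_def g_def[symmetric] using \<beta> by (intro mult_left_mono) auto
qed

lemma card_mask:
  assumes "M \<subseteq> N" "real (card (M - I)) < \<beta> * real (card N)"
  shows "real (card M) < \<alpha> * real (card N)" "real (card M) \<le> real (card N) / 200"
proof -
  have *: "real (card M) \<le> real (card I) + real (card (M - I))"
    using assms finN finI by (intro card_le_card_add_if_subset) (auto intro: finite_subset)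
  then show "real (card M) < \<alpha> * real (card N)" using assms \<beta> by linarith
  have "\<beta> * real (card N) \<le> 1/400 * real (card N)" using \<beta> by (intro mult_right_mono) auto
  then show "real (card M) \<le> real (card N) / 200" using * assms card_I by linarith
qed

lemma thr_ge: "1 \<le> i \<Longrightarrow> 60 \<le> thr i"
proof -
  assume i: "1 \<le> i"
  have "1 * 7200 \<le> real i * L" using i L by (intro mult_mono) auto
  then show ?thesis unfolding thr_def by (intro real_le_rsqrt) (simp add: power2_eq_square)
qed

lemma thr_mono: "i \<le> i' \<Longrightarrow> thr i \<le> thr i'"
  unfolding thr_def using L by (intro real_sqrt_le_mono divide_right_mono mult_right_mono) auto

text \<open>The deterministic content of a round. \<open>low\<close> before the round bounds the
  median from below and \<open>up\<close> after the score update, still with the old mask, bounds it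
  from above; hence the mask admits only allowed unimportant keys, and every important key left out
  stays capped.\<close>

lemma round_update:
  fixes C C' :: "'a \<Rightarrow> nat" and Z :: bool
  assumes M: "M \<subseteq> N" and U: "U \<subseteq> N" and i: "Suc i \<le> r" and p: "0 \<le> p" "p \<le> 1"
    and low: "low i b C < 1" and cap: "\<And>x. x \<in> I - M \<Longrightarrow> real (C x) - b \<le> cap - 1"
  defines "C' \<equiv> (\<lambda>x. C x + of_bool (Z \<and> x \<in> U))"
  assumes up: "up (Suc i) (b + p) M C' < 1"
    and fold: "fold (process_key (card N) r N (Suc i) Z) (enum U) (M, C) = (M', C\<^sub>2)"
  shows "C\<^sub>2 = C'" "M \<subseteq> M'" "M' \<subseteq> N" "up (Suc i) (b + p) M' C' \<le> up (Suc i) (b + p) M C'"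
    "\<And>x. x \<in> I - M' \<Longrightarrow> real (C' x) - (b + p) \<le> cap - 1"
proof -
  define b' where "b' = b + p"
  define T where "T = thr (Suc i)"
  define H where "H = M - I \<union> {x\<in>N - I - M. 1 \<le> stitched (9/10) L J (Suc i) (real (C' x) - b' - real (Suc i) * \<epsilon>)}"
  have H: "real (card H) < \<beta> * real (card N)" unfolding H_def b'_def by (rule up_count(1)[OF up M])
  have H': "real (card H) \<le> real (card N) / 400"
  proof -
    have "\<beta> * real (card N) \<le> 1/400 * real (card N)" using \<beta> by (intro mult_right_mono) auto
    then show ?thesis using H by linarith
  qed
  have finH: "finite H" using M finN by (auto simp: H_def intro: finite_subset)
  define vl where "vl = b - real i * \<epsilon> - T / 20"
  define vu where "vu = b' + real (Suc i) * \<epsilon> + 9/10 * T"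
  have T: "60 \<le> T" unfolding T_def by (rule thr_ge) simp
  have i\<epsilon>: "real i * \<epsilon> \<le> 1" "real (Suc i) * \<epsilon> \<le> 1"
    using mult_right_mono[of "real i" "real r" \<epsilon>] mult_right_mono[of "real (Suc i)" "real r" \<epsilon>] i \<epsilon>(1) r(3) by auto
  have inH: "x \<in> H" if "x \<in> N - I" "9/10 * T \<le> real (C' x) - b' - real (Suc i) * \<epsilon>" for x
  proof (cases "x \<in> M")
    case False
    have "1 \<le> stitched (9/10) L J (Suc i) (real (C' x) - b' - real (Suc i) * \<epsilon>)"
      using that L i r by (intro stitched_ge_1[where i' = "Suc i"]) (auto simp: T_def thr_def)
    then show ?thesis using False that by (auto simp: H_def)
  qed (use that in \<open>auto simp: H_def\<close>)
  have med: "vl \<le> median C\<^sub>1 (N - M\<^sub>1) \<and> median C\<^sub>1 (N - M\<^sub>1) \<le> vu"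
    if M1: "M\<^sub>1 \<subseteq> N" "M\<^sub>1 - I \<subseteq> H" and C1: "\<And>x. C x \<le> C\<^sub>1 x \<and> C\<^sub>1 x \<le> C' x" for M\<^sub>1 and C\<^sub>1 :: "'a \<Rightarrow> nat"
  proof -
    have "real (card (M\<^sub>1 - I)) < \<beta> * real (card N)"
      using card_mono[OF finH M1(2)] H by linarith
    then have "real (card M\<^sub>1) \<le> real (card N) / 200" by (rule card_mask(2)[OF M1(1)])
    moreover have "real (card (N - M\<^sub>1)) = real (card N) - real (card M\<^sub>1)"
      using M1(1) finN by (subst card_Diff_subset) (auto intro: finite_subset of_nat_diff card_mono)
    ultimately have big: "real (card (N - M\<^sub>1)) \<ge> 199/200 * real (card N)" by linarith
    have 1: "2 * card {y\<in>N - M\<^sub>1. real (C\<^sub>1 y) < vl} < card (N - M\<^sub>1)"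
    proof -
      let ?B = "{x\<in>N - I. real (C x) < b - real i * \<epsilon> - thr (Suc i) / 20}"
      have "{y\<in>N - M\<^sub>1. real (C\<^sub>1 y) < vl} \<subseteq> I \<union> ?B"
      proof
        fix y assume y: "y \<in> {y\<in>N - M\<^sub>1. real (C\<^sub>1 y) < vl}"
        have "real (C y) \<le> real (C\<^sub>1 y)" using C1[of y] by simp
        then have "real (C y) < vl" using y by simp
        then show "y \<in> I \<union> ?B" using y by (auto simp: vl_def T_def)
      qed
      then have "real (card {y\<in>N - M\<^sub>1. real (C\<^sub>1 y) < vl}) \<le> real (card I) + real (card ?B)"
        using finI finN by (intro card_le_card_add_if_subset) auto
      also have "\<dots> \<le> real (card N) / 400 + real (card N) / 4"
        using card_I low_count[OF low, of "Suc i"] i by (intro add_mono) auto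
      finally have "2 * real (card {y\<in>N - M\<^sub>1. real (C\<^sub>1 y) < vl}) < real (card (N - M\<^sub>1))" using big n_pos by linarith
      then show ?thesis by linarith
    qed
    have 2: "2 * card {y\<in>N - M\<^sub>1. vu < real (C\<^sub>1 y)} < card (N - M\<^sub>1)"
    proof -
      have "{y\<in>N - M\<^sub>1. vu < real (C\<^sub>1 y)} \<subseteq> I \<union> H"
      proof
        fix y assume y: "y \<in> {y\<in>N - M\<^sub>1. vu < real (C\<^sub>1 y)}"
        have "real (C\<^sub>1 y) \<le> real (C' y)" using C1[of y] by simp
        then have "9/10 * T \<le> real (C' y) - b' - real (Suc i) * \<epsilon>" using y unfolding vu_def by simp
        then show "y \<in> I \<union> H" using inH[of y] y by auto
      qed
      then have "real (card {y\<in>N - M\<^sub>1. vu < real (C\<^sub>1 y)}) \<le> real (card I) + real (card H)"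
        using finI finH by (intro card_le_card_add_if_subset) auto
      then have "2 * real (card {y\<in>N - M\<^sub>1. vu < real (C\<^sub>1 y)}) < real (card (N - M\<^sub>1))" using big n_pos card_I H' by linarith
      then show ?thesis by linarith
    qed
    show ?thesis using median_ge[OF _ 1] median_le[OF _ 2] finN by auto
  qed
  have enter: "x \<in> H" if "x \<in> N - I" "vl + T \<le> real (C' x)" for x
  proof (rule inH[OF that(1)])
    \<comment> \<open>From the median bound, the excess over the corrected baseline is at least
      19/20 * T - 3, which is at least 9/10 * T exactly because T \<ge> 60.\<close>
    show "9/10 * T \<le> real (C' x) - b' - real (Suc i) * \<epsilon>"
      using that(2) T i\<epsilon> p unfolding vl_def b'_def by linarith
  qed
  have en: "set (enum U) = U" "distinct (enum U)"
    using enum U finN by (auto simp: set_enumeration_def intro: finite_subset)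
  have T_eq: "T = sqrt (real (Suc i) * ln (200 * real (card N) * real r) / 2)"
    unfolding T_def thr_def by (simp only: L_def)
  have res: "M \<subseteq> M' \<and> M' \<subseteq> N \<and> M' - I \<subseteq> H \<and> (\<forall>x\<in>set (enum U) - M'. real (C' x) < vu + T) \<and>
    C\<^sub>2 = (\<lambda>x. if x \<in> set (enum U) then C' x else C x)"
    unfolding T_eq
  proof (rule fold_process_key[where C = C and vl = vl])
    show "fold (process_key (card N) r N (Suc i) Z) (enum U) (M, C) = (M', C\<^sub>2)" by (rule fold)
    show "vl \<le> median C\<^sub>1 (N - M\<^sub>1) \<and> median C\<^sub>1 (N - M\<^sub>1) \<le> vu"
      if "M\<^sub>1 \<subseteq> N" "M\<^sub>1 - I \<subseteq> H" "\<And>x. C x \<le> C\<^sub>1 x \<and> C\<^sub>1 x \<le> C' x" for M\<^sub>1 C\<^sub>1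
      by (rule med[OF that])
    show "x \<in> H" if "x \<in> N - I" "vl + sqrt (real (Suc i) * ln (200 * real (card N) * real r) / 2) \<le> real (C' x)" for x
      using that enter[of x] unfolding T_eq by blast
  qed (use en U M in \<open>auto simp: C'_def H_def\<close>)
  show "C\<^sub>2 = C'" using res en by (auto simp: C'_def fun_eq_iff)
  show "M \<subseteq> M'" "M' \<subseteq> N" using res by auto
  show "up (Suc i) (b + p) M' C' \<le> up (Suc i) (b + p) M C'"
    using res by (intro up_count(2)[OF up M]) (auto simp: H_def b'_def)
  \<comment> \<open>A key of \<open>U\<close> has just failed the test, so its advantage is below 1
    + 19/10 * T; any other key keeps its score while the baseline grows. The unit between
    \<open>cap - 1\<close> and \<open>cap\<close> is reserved for an increment of the next round
    that has not yet been tested.\<close>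
  show "real (C' x) - (b + p) \<le> cap - 1" if x: "x \<in> I - M'" for x
  proof (cases "x \<in> U")
    case True
    then have "real (C' x) < vu + T" using res x en by auto
    moreover have "T \<le> thr r" unfolding T_def using i by (rule thr_mono)
    ultimately show ?thesis using i\<epsilon> T unfolding vu_def b'_def cap_def by linarith
  next
    case False
    then have "C' x = C x" by (simp add: C'_def)
    moreover have "real (C x) - b \<le> cap - 1" using x res by (intro cap) auto
    ultimately show ?thesis using p by simp
  qed
qed


lemma adv_nonneg:
  assumes "m \<le> r" "\<And>x. x \<in> I - M \<Longrightarrow> real (C x) - b \<le> cap"
  shows "0 \<le> adv m b M C"
proof -
  have "0 \<le> 1 - real m / real r" using assms(1) r by simp
  moreover have "0 \<le> 10 / real r * (\<Sum>x\<in>I - M. cap - (real (C x) - b))"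
    using assms(2) by (intro mult_nonneg_nonneg sum_nonneg) auto
  ultimately show ?thesis unfolding adv_def by linarith
qed

lemma adv_antimono:
  assumes "M \<subseteq> M'" "\<And>x. x \<in> I - M \<Longrightarrow> real (C x) - b \<le> cap"
  shows "adv m b M' C \<le> adv m b M C"
proof -
  have "(\<Sum>x\<in>I - M'. cap - (real (C x) - b)) \<le> (\<Sum>x\<in>I - M. cap - (real (C x) - b))"
    using assms finI by (intro sum_mono2) auto
  then show ?thesis unfolding adv_def by (intro add_right_mono mult_left_mono) auto
qed

section \<open>Expected change of the potentials in one round\<close>

text \<open>The response depends on the query through \<open>G U\<close>. Averaging it out
  explicitly leaves a single expectation over \<open>U\<close>, linear in \<open>h\<close>.\<close>

definition round_mean :: "('a set \<Rightarrow> real) \<Rightarrow> ('a set \<Rightarrow> bool \<Rightarrow> real) \<Rightarrow> real" where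
  "round_mean G h = measure_pmf.expectation (D0 A N) (\<lambda>U. h U True * G U + h U False * (1 - G U))"

lemma round_mean_add: "round_mean G (\<lambda>U Z. h U Z + h' U Z) = round_mean G h + round_mean G h'"
  unfolding round_mean_def Bochner_Integration.integral_add[OF integrable_D0 integrable_D0, symmetric]
  by (intro Bochner_Integration.integral_cong) (auto simp: algebra_simps)

lemma round_mean_cmult: "round_mean G (\<lambda>U Z. c * h U Z) = c * round_mean G h"
  unfolding round_mean_def integral_mult_right_zero[symmetric]
  by (intro Bochner_Integration.integral_cong) (auto simp: algebra_simps)

lemma round_mean_const: "round_mean G (\<lambda>U Z. c) = c"
  unfolding round_mean_def by (simp flip: distrib_left)

lemma round_mean_sum: "finite X \<Longrightarrow> round_mean G (\<lambda>U Z. \<Sum>x\<in>X. h x U Z) = (\<Sum>x\<in>X. round_mean G (h x))"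
  by (induction X rule: finite_induct) (simp_all add: round_mean_const round_mean_add)

lemma round_mean_key:
  "round_mean G (\<lambda>U Z. \<phi> (Z \<and> x \<in> U)) = gain G x * \<phi> True + (1 - gain G x) * \<phi> False"
proof -
  have "round_mean G (\<lambda>U Z. \<phi> (Z \<and> x \<in> U))
    = measure_pmf.expectation (D0 A N) (\<lambda>U. \<phi> False + (\<phi> True - \<phi> False) * (of_bool (x \<in> U) * G U))"
    unfolding round_mean_def by (intro Bochner_Integration.integral_cong) (auto simp: algebra_simps)
  also have "\<dots> = \<phi> False + (\<phi> True - \<phi> False) * gain G x"
    unfolding gain_def by (simp add: integrable_D0)
  finally show ?thesis by (simp add: algebra_simps)
qed

lemma gain_01:
  assumes "\<And>U. 0 \<le> G U \<and> G U \<le> 1"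
  shows "0 \<le> gain G x" "gain G x \<le> 1"
proof -
  show "0 \<le> gain G x" unfolding gain_def using assms by (intro integral_nonneg_AE) auto
  have "gain G x \<le> measure_pmf.expectation (D0 A N) (\<lambda>_. 1)"
    unfolding gain_def using assms by (intro integral_mono integrable_D0) (auto simp: of_bool_def)
  then show "gain G x \<le> 1" by simp
qed

text \<open>Seen from below, success is the absence of an increment, with probability at most 1 - p
  + \<epsilon>. Subtracting \<epsilon> in every round pays for the gains being only approximately
  equal to \<open>p\<close>.\<close>

lemma low_step:
  assumes G: "\<And>U. 0 \<le> G U \<and> G U \<le> 1" and p: "\<And>x. x \<in> N - I \<Longrightarrow> \<bar>gain G x - p\<bar> \<le> \<epsilon>"
  shows "round_mean G (\<lambda>U Z. low (Suc i) (b + p) (\<lambda>x. C x + of_bool (Z \<and> x \<in> U))) \<le> low i b C"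
proof -
  define d where "d x = b - real i * \<epsilon> - real (C x)" for x
  have "round_mean G (\<lambda>U Z. stitched (1/20) L J (Suc i) (b + p - real (Suc i) * \<epsilon> - real (C x + of_bool (Z \<and> x \<in> U))))
      \<le> stitched (1/20) L J i (d x)" if x: "x \<in> N - I" for x
  proof -
    have e: "b + p - real (Suc i) * \<epsilon> - real (C x + of_bool z) = d x + (if z then - (1 - p + \<epsilon>) else 1 - (1 - p + \<epsilon>))" for z
      by (simp add: d_def algebra_simps)
    have "round_mean G (\<lambda>U Z. stitched (1/20) L J (Suc i) (b + p - real (Suc i) * \<epsilon> - real (C x + of_bool (Z \<and> x \<in> U))))
      = (1 - gain G x) * stitched (1/20) L J (Suc i) (d x + (1 - (1 - p + \<epsilon>)))
       + (1 - (1 - gain G x)) * stitched (1/20) L J (Suc i) (d x + - (1 - p + \<epsilon>))"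
      unfolding e by (subst round_mean_key) simp
    also have "\<dots> \<le> stitched (1/20) L J i (d x)"
      using gain_01[where G = G and x = x, OF G] p[OF x] L by (intro stitched_step) auto
    finally show ?thesis .
  qed
  then have "(\<Sum>x\<in>N - I. round_mean G (\<lambda>U Z. stitched (1/20) L J (Suc i) (b + p - real (Suc i) * \<epsilon> - real (C x + of_bool (Z \<and> x \<in> U)))))
     \<le> (\<Sum>x\<in>N - I. stitched (1/20) L J i (d x))" by (rule sum_mono)
  then show ?thesis
    unfolding low_def round_mean_cmult round_mean_sum[OF finite_Diff[OF finN]] d_def
    by (rule mult_left_mono) simp
qed

text \<open>For scores running ahead, success is an increment, of probability at most p +
  \<epsilon>. The mask is held fixed here; its update is handled separately as a pointwise
  decrease.\<close>

lemma up_step: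
  assumes G: "\<And>U. 0 \<le> G U \<and> G U \<le> 1" and p: "\<And>x. x \<in> N - I \<Longrightarrow> \<bar>gain G x - p\<bar> \<le> \<epsilon>"
  shows "round_mean G (\<lambda>U Z. up (Suc i) (b + p) M (\<lambda>x. C x + of_bool (Z \<and> x \<in> U))) \<le> up i b M C"
proof -
  define d where "d x = real (C x) - b - real i * \<epsilon>" for x
  have "round_mean G (\<lambda>U Z. stitched (9/10) L J (Suc i) (real (C x + of_bool (Z \<and> x \<in> U)) - (b + p) - real (Suc i) * \<epsilon>))
      \<le> stitched (9/10) L J i (d x)" if x: "x \<in> N - I - M" for x
  proof -
    have e: "real (C x + of_bool z) - (b + p) - real (Suc i) * \<epsilon> = d x + (if z then 1 - (p + \<epsilon>) else - (p + \<epsilon>))" for z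
      by (simp add: d_def algebra_simps)
    have "round_mean G (\<lambda>U Z. stitched (9/10) L J (Suc i) (real (C x + of_bool (Z \<and> x \<in> U)) - (b + p) - real (Suc i) * \<epsilon>))
      = gain G x * stitched (9/10) L J (Suc i) (d x + (1 - (p + \<epsilon>)))
       + (1 - gain G x) * stitched (9/10) L J (Suc i) (d x + - (p + \<epsilon>))"
      unfolding e by (subst round_mean_key) simp
    also have "\<dots> \<le> stitched (9/10) L J i (d x)"
      using gain_01[where G = G and x = x, OF G] p[of x] x L by (intro stitched_step) auto
    finally show ?thesis .
  qed
  then have "(\<Sum>x\<in>N - I - M. round_mean G (\<lambda>U Z. stitched (9/10) L J (Suc i) (real (C x + of_bool (Z \<and> x \<in> U)) - (b + p) - real (Suc i) * \<epsilon>)))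
     \<le> (\<Sum>x\<in>N - I - M. stitched (9/10) L J i (d x))" by (rule sum_mono)
  then show ?thesis
    unfolding up_def round_mean_cmult round_mean_add round_mean_const round_mean_sum[OF finite_Diff[OF finite_Diff[OF finN]]] d_def
    using \<beta> by (intro mult_left_mono add_left_mono) auto
qed

text \<open>The total advantage of 1/10, scaled by 10 / r, lowers the first term by at least 1 / r
  in expectation. This offsets the rise of the clock \<open>1 - m / r\<close>.\<close>

lemma adv_step:
  assumes p: "(\<Sum>x\<in>I - M. gain G x - p) \<ge> 1/10"
  shows "round_mean G (\<lambda>U Z. adv m (b + p) M (\<lambda>x. C x + of_bool (Z \<and> x \<in> U))) \<le> adv (Suc m) b M C"
proof -
  have key: "round_mean G (\<lambda>U Z. cap - (real (C x + of_bool (Z \<and> x \<in> U)) - (b + p))) = cap - (real (C x) - b) - (gain G x - p)" for x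
    by (subst round_mean_key[where \<phi> = "\<lambda>z. cap - (real (C x + of_bool z) - (b + p))"]) (simp add: algebra_simps)
  have "round_mean G (\<lambda>U Z. adv m (b + p) M (\<lambda>x. C x + of_bool (Z \<and> x \<in> U)))
     = 10 / real r * (\<Sum>x\<in>I - M. cap - (real (C x) - b) - (gain G x - p)) + (1 - real m / real r)"
    unfolding adv_def round_mean_add round_mean_cmult round_mean_const round_mean_sum[OF finite_Diff[OF finI]] key ..
  also have "(\<Sum>x\<in>I - M. cap - (real (C x) - b) - (gain G x - p)) \<le> (\<Sum>x\<in>I - M. cap - (real (C x) - b)) - 1/10"
    using p by (subst sum_subtractf) linarith
  then have "10 / real r * (\<Sum>x\<in>I - M. cap - (real (C x) - b) - (gain G x - p)) \<le> 10 / real r * ((\<Sum>x\<in>I - M. cap - (real (C x) - b)) - 1/10)"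
    by (intro mult_left_mono) auto
  also have "10 / real r * ((\<Sum>x\<in>I - M. cap - (real (C x) - b)) - 1/10) + (1 - real m / real r) = adv (Suc m) b M C"
    unfolding adv_def using r by (simp add: field_simps)
  finally show ?thesis by simp
qed

section \<open>Induction over the remaining rounds\<close>

text \<open>The three potentials add up to a supermartingale until \<open>low\<close> or
  \<open>up\<close> reaches 1. The baseline \<open>b\<close> is no part of the attacker's state: it
  is generalised in the induction and grows by the \<open>p\<close> belonging to the map chosen at
  the current transcript.\<close>

lemma prob_failure_loop:
  assumes "M \<subseteq> N" "m \<le> r" "low (r - m) b C < 1" "up (r - m) b M C < 1"
    and "\<And>x. x \<in> I - M \<Longrightarrow> real (C x) - b \<le> cap - 1"
  shows "measure_pmf.prob (attack_loop m enum S Q A \<delta> (card N) r N M C tr) failure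
    \<le> adv m b M C + low (r - m) b C + up (r - m) b M C"
  using assms
proof (induction m arbitrary: M C b tr)
  case 0
  \<comment> \<open>If all rounds were played, the clock alone makes \<open>adv\<close> at least 1,
    so the claimed bound is trivial.\<close>
  have "0 \<le> (\<Sum>x\<in>I - M. cap - (real (C x) - b))"
    using 0(5) by (intro sum_nonneg) (smt (verit))
  then have "1 \<le> adv 0 b M C" unfolding adv_def by simp
  moreover have "measure_pmf.prob (attack_loop 0 enum S Q A \<delta> (card N) r N M C tr) failure \<le> 1" by simp
  ultimately show ?case using low_nonneg[of "r - 0" b C] up_nonneg[of "r - 0" b M C] by linarith
next
  case (Suc m)
  define i where "i = r - Suc m"
  have i: "r - m = Suc i" "Suc i \<le> r" using Suc.prems(2) by (auto simp: i_def)
  have low: "low i b C < 1" and up: "up i b M C < 1" using Suc.prems(3,4) by (auto simp: i_def)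
  have cap1: "real (C x) - b \<le> cap" if "x \<in> I - M" for x using Suc.prems(5)[OF that] by linarith
  have mask: "real (card (M - I)) < \<beta> * real (card N)"
    by (rule le_less_trans[OF of_nat_mono[OF card_mono[OF _ Un_upper1]] up_count(1)[OF up Suc.prems(1)]])
      (use finN Suc.prems(1) in \<open>auto intro: finite_subset\<close>)
  note cardM = card_mask[OF Suc.prems(1) mask]
  define D where "D = query_dist A N M"
  show ?case
  proof (cases "\<exists>\<pi>. correct_map S A \<delta> D \<pi>")
    case False
    then have "attack_loop (Suc m) enum S Q A \<delta> (card N) r N M C tr = return_pmf M"
      by (simp add: Let_def D_def)
    \<comment> \<open>Halting is success: no correct map exists, and the bound on \<open>up\<close>
      has kept the mask small.\<close>
    moreover have "M \<notin> failure" using False cardM by (simp add: failure_def D_def)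
    ultimately have "measure_pmf.prob (attack_loop (Suc m) enum S Q A \<delta> (card N) r N M C tr) failure = 0"
      by simp
    moreover have "0 \<le> adv (Suc m) b M C" by (rule adv_nonneg[OF Suc.prems(2) cap1])
    ultimately show ?thesis using low_nonneg[of "r - Suc m" b C] up_nonneg[of "r - Suc m" b M C] by linarith
  next
    case True
    define \<pi> where "\<pi> = Q tr D"
    have \<pi>: "correct_map S A \<delta> (query_dist A N M) \<pi>" using Q[OF True, of tr] by (simp add: \<pi>_def D_def)
    define G where "G U = \<pi> (S (M \<union> U))" for U
    have G: "0 \<le> G U \<and> G U \<le> 1" for U using \<pi> by (simp add: correct_map_def G_def)
    obtain p where p: "0 \<le> p" "p \<le> 1" "\<And>x. x \<in> N - I \<Longrightarrow> \<bar>gain G x - p\<bar> \<le> \<epsilon>"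
      "(\<Sum>x\<in>I - M. gain G x - p) \<ge> 1/10"
      using round_advantage[OF Suc.prems(1) cardM(2) \<pi> \<delta>] unfolding G_def by blast
    define C' where "C' U Z = (\<lambda>x. C x + of_bool (Z \<and> x \<in> U))" for U Z
    define mid where "mid U Z = adv m (b + p) M (C' U Z) + low (Suc i) (b + p) (C' U Z) + up (Suc i) (b + p) M (C' U Z)" for U Z
    define loop where "loop U Z = (let (M', C') = fold (process_key (card N) r N (Suc i) Z) (enum U) (M, C) in
       attack_loop m enum S Q A \<delta> (card N) r N M' C' (tr @ [(D, M \<union> U, Z, M', C', U)]))" for U Z
    have loop: "attack_loop (Suc m) enum S Q A \<delta> (card N) r N M C tr
        = bind_pmf (D0 A N) (\<lambda>U. bind_pmf (bernoulli_pmf (G U)) (loop U))"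
      using True by (auto simp add: Let_def D_def loop_def[abs_def] G_def \<pi>_def i(1))
    have step: "measure_pmf.prob (loop U Z) failure \<le> mid U Z" if U: "U \<subseteq> N" for U Z
    proof -
      have capC': "real (C' U Z x) - (b + p) \<le> cap" if "x \<in> I - M" for x
        using Suc.prems(5)[OF that] p(1) by (auto simp: C'_def)
      have adv0: "0 \<le> adv m (b + p) M (C' U Z)" using Suc.prems(2) capC' by (intro adv_nonneg) auto
      note nn = adv0 low_nonneg[of "Suc i" "b + p" "C' U Z"] up_nonneg[of "Suc i" "b + p" M "C' U Z"]
      have le1: "measure_pmf.prob (loop U Z) failure \<le> 1" by simp
      show ?thesis
      \<comment> \<open>Once \<open>low\<close> or \<open>up\<close> reaches 1 the claimed bound is
        at least 1; otherwise the mask update is under control and the induction hypothesis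
        applies.\<close>
      proof (cases "low (Suc i) (b + p) (C' U Z) < 1 \<and> up (Suc i) (b + p) M (C' U Z) < 1")
        case False
        then show ?thesis using nn le1 unfolding mid_def by linarith
      next
        case good: True
        obtain M' C\<^sub>2 where f: "fold (process_key (card N) r N (Suc i) Z) (enum U) (M, C) = (M', C\<^sub>2)"
          by (cases "fold (process_key (card N) r N (Suc i) Z) (enum U) (M, C)")
        have up': "up (Suc i) (b + p) M (\<lambda>x. C x + of_bool (Z \<and> x \<in> U)) < 1" using good by (simp add: C'_def)
        note upd = round_update[OF Suc.prems(1) U i(2) p(1,2) low Suc.prems(5) up' f, folded C'_def]
        have f': "fold (process_key (card N) r N (Suc i) Z) (enum U) (M, C) = (M', C' U Z)" using f upd(1) by simp
        have cap': "real (C' U Z x) - (b + p) \<le> cap - 1" if "x \<in> I - M'" for x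
          using upd(5)[of x] that by (simp add: C'_def)
        have "measure_pmf.prob (loop U Z) failure \<le> adv m (b + p) M' (C' U Z) + low (r - m) (b + p) (C' U Z) + up (r - m) (b + p) M' (C' U Z)"
          unfolding loop_def f' Let_def prod.case
          by (rule Suc.IH) (use upd(3,4) cap' good Suc.prems(2) in \<open>auto simp: i(1)\<close>)
        also have "adv m (b + p) M' (C' U Z) \<le> adv m (b + p) M (C' U Z)"
          by (rule adv_antimono[OF upd(2) capC'])
        finally show ?thesis using upd(4) unfolding mid_def i(1) by linarith
      qed
    qed
    have "measure_pmf.prob (attack_loop (Suc m) enum S Q A \<delta> (card N) r N M C tr) failure \<le> round_mean G mid"
      unfolding loop round_mean_def
    proof (rule prob_bind_le)
      show "finite (set_pmf (D0 A N))"
        using set_pmf_D0[of A N] finN N_ne n_pos by (auto intro: finite_subset)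
      fix U assume "U \<in> set_pmf (D0 A N)"
      then have U: "U \<subseteq> N" using set_pmf_D0[of A N] finN N_ne n_pos by auto
      have "measure_pmf.prob (bind_pmf (bernoulli_pmf (G U)) (loop U)) failure \<le> measure_pmf.expectation (bernoulli_pmf (G U)) (mid U)"
        using step[OF U] by (intro prob_bind_le) auto
      also have "\<dots> = mid U True * G U + mid U False * (1 - G U)"
        using G[of U] by (subst integral_bernoulli_pmf) (auto simp: mult.commute)
      finally show "measure_pmf.prob (bind_pmf (bernoulli_pmf (G U)) (loop U)) failure \<le> mid U True * G U + mid U False * (1 - G U)" .
    qed
    also have "\<dots> = round_mean G (\<lambda>U Z. adv m (b + p) M (C' U Z)) + round_mean G (\<lambda>U Z. low (Suc i) (b + p) (C' U Z))
       + round_mean G (\<lambda>U Z. up (Suc i) (b + p) M (C' U Z))"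
      unfolding mid_def round_mean_add ..
    also have "\<dots> \<le> adv (Suc m) b M C + low i b C + up i b M C"
      unfolding C'_def by (intro add_mono adv_step low_step up_step G p)
    finally show ?thesis by (simp add: i_def)
  qed
qed

text \<open>The exponents are 4/5 * \<theta>^2 for \<theta> = 1/20 and \<theta> = 9/10, that is
  1/500 and 81/125; the factor J + 1 counts the epochs.\<close>

lemma prob_failure:
  assumes "4 * real (Suc J) * exp (- (L / 500)) < 1" "real (Suc J) / \<beta> * exp (- (81 / 125 * L)) < 1"
  shows "measure_pmf.prob (attack_loop r enum S Q A \<delta> (card N) r N {} (\<lambda>_. 0) []) failure
    \<le> 10 / real r * (real (card I) * cap) + 4 * real (Suc J) * exp (- (L / 500)) + real (Suc J) / \<beta> * exp (- (81 / 125 * L))"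
proof -
  have c: "real (card (N - I)) \<le> real (card N)" using finN by (intro of_nat_mono card_mono) auto
  have cap: "1 \<le> cap" unfolding cap_def thr_def using L by simp
  have "low 0 0 (\<lambda>_. 0) = real (card (N - I)) / real (card N) * (4 * real (Suc J) * exp (- (L / 500)))"
    unfolding low_def by (simp add: stitched_0 power2_eq_square)
  also have "\<dots> \<le> 1 * (4 * real (Suc J) * exp (- (L / 500)))" using c n_pos by (intro mult_right_mono) auto
  finally have low: "low 0 0 (\<lambda>_. 0) \<le> 4 * real (Suc J) * exp (- (L / 500))" by simp
  have "up 0 0 {} (\<lambda>_. 0) = real (card (N - I)) / real (card N) * (real (Suc J) / \<beta> * exp (- (81 / 125 * L)))"
    unfolding up_def by (simp add: stitched_0 power2_eq_square)
  also have "\<dots> \<le> 1 * (real (Suc J) / \<beta> * exp (- (81 / 125 * L)))" using c n_pos \<beta> by (intro mult_right_mono) auto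
  finally have up: "up 0 0 {} (\<lambda>_. 0) \<le> real (Suc J) / \<beta> * exp (- (81 / 125 * L))" by simp
  have adv: "adv r 0 {} (\<lambda>_. 0) = 10 / real r * (real (card I) * cap)"
    unfolding adv_def using r by simp
  have "measure_pmf.prob (attack_loop r enum S Q A \<delta> (card N) r N {} (\<lambda>_. 0) []) failure
    \<le> adv r 0 {} (\<lambda>_. 0) + low (r - r) 0 (\<lambda>_. 0) + up (r - r) 0 {} (\<lambda>_. 0)"
    by (rule prob_failure_loop) (use low up cap assms in auto)
  then show ?thesis using low up adv by simp
qed

end


section \<open>Important keys of MinHash sketches\<close>

text \<open>A deterministic property of the sketching map at one value of the hash functions.
  Stating it with a free \<open>l\<close> lets the size of \<open>I\<close> be traded against the
  miss probability later.\<close>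

definition has_important_keys :: "('a set \<Rightarrow> sketch) \<Rightarrow> 'a set \<Rightarrow> nat \<Rightarrow> nat \<Rightarrow> bool" where
  "has_important_keys S N k l \<longleftrightarrow> (\<exists>I hit. I \<subseteq> N \<and> card I \<le> k * l \<and>
     (\<forall>U V. U \<subseteq> V \<longrightarrow> V \<subseteq> N \<longrightarrow> hit U \<longrightarrow> S V = S (V \<inter> I)) \<and>
     (\<forall>q. 1/20 \<le> q \<longrightarrow> q \<le> 1/4 \<longrightarrow> subset_mean q N (\<lambda>U. of_bool (\<not> hit U)) \<le> real k * (19/20) ^ l))"

text \<open>Union bound over the blocks; at a rate of at least 1/20 a block of l keys is missed with
  probability at most (19/20)^l.\<close>

lemma subset_mean_miss_some_block:
  assumes "finite N" "1/20 \<le> q" "q \<le> 1/4" "K \<subseteq> {..<k}"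
    and B: "\<And>j. j \<in> K \<Longrightarrow> B j \<subseteq> N" "\<And>j. j \<in> K \<Longrightarrow> card (B j) = l"
  shows "subset_mean q N (\<lambda>U. of_bool (\<not> (\<forall>j\<in>K. U \<inter> B j \<noteq> {}))) \<le> real k * (19/20) ^ l"
proof -
  have K: "finite K" "card K \<le> k"
    using assms(4) finite_subset card_mono[of "{..<k}" K] by auto
  have "subset_mean q N (\<lambda>U. of_bool (\<not> (\<forall>j\<in>K. U \<inter> B j \<noteq> {}))) \<le> subset_mean q N (\<lambda>U. \<Sum>j\<in>K. of_bool (U \<inter> B j = {}))"
  proof (rule subset_mean_mono)
    fix U
    show "(of_bool (\<not> (\<forall>j\<in>K. U \<inter> B j \<noteq> {})) :: real) \<le> (\<Sum>j\<in>K. of_bool (U \<inter> B j = {}))"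
    proof (cases "\<forall>j\<in>K. U \<inter> B j \<noteq> {}")
      case False
      then obtain j where j: "j \<in> K" "U \<inter> B j = {}" by auto
      have "of_bool (U \<inter> B j = {}) \<le> (\<Sum>j\<in>K. of_bool (U \<inter> B j = {}) :: real)"
        using j K by (intro member_le_sum) auto
      then show ?thesis using j by simp
    qed (simp add: sum_nonneg)
  qed (use assms in auto)
  also have "\<dots> = (\<Sum>j\<in>K. (1 - q) ^ l)"
    unfolding subset_mean_sum using assms by (intro sum.cong refl) (simp add: subset_mean_miss)
  also have "\<dots> = real (card K) * (1 - q) ^ l" by simp
  also have "\<dots> \<le> real k * (19/20) ^ l"
    using K assms by (intro mult_mono power_mono) auto
  finally show ?thesis .
qed

lemma lowest_keys:
  fixes h :: "'a \<Rightarrow> real"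
  assumes "finite Y"
  obtains B where "B \<subseteq> Y" "B = Y \<or> card B = l" "card B \<le> l" "\<And>x y. x \<in> B \<Longrightarrow> y \<in> Y - B \<Longrightarrow> h x \<le> h y"
proof -
  have "\<exists>B\<subseteq>Y. (B = Y \<or> card B = l) \<and> card B \<le> l \<and> (\<forall>x\<in>B. \<forall>y\<in>Y - B. h x \<le> h y)"
  proof (induction l)
    case 0
    show ?case by (intro exI[of _ "{}"]) auto
  next
    case (Suc l)
    then obtain B where B: "B \<subseteq> Y" "B = Y \<or> card B = l" "card B \<le> l" "\<forall>x\<in>B. \<forall>y\<in>Y - B. h x \<le> h y" by blast
    show ?case
    proof (cases "B = Y")
      case True
      then show ?thesis using B by (intro exI[of _ B]) auto
    next
      case False
      define z where "z = arg_min_on h (Y - B)"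
      have "finite (Y - B)" "Y - B \<noteq> {}" using assms B False by auto
      then have z: "z \<in> Y - B" "\<forall>y\<in>Y - B. h z \<le> h y"
        unfolding z_def using arg_min_if_finite(1)[of "Y - B" h] arg_min_least[of "Y - B" _ h] by auto
      have "finite B" using B assms finite_subset by blast
      then show ?thesis using B False z by (intro exI[of _ "insert z B"]) (auto simp: card_insert_if)
    qed
  qed
  then show thesis using that by blast
qed

text \<open>For each coordinate take the l lowest keys of its class. If \<open>U\<close> meets them,
  every larger set attains that minimum there, so the other keys of the class are
  irrelevant.\<close>

lemma has_important_keys_min_sketch:
  assumes N: "finite N" and S: "S = (\<lambda>V. map (\<lambda>j. INF x\<in>V \<inter> Y j. ereal (h j x)) [0..<k])"
  shows "has_important_keys S N k l"
proof -
  have "\<exists>B. B \<subseteq> N \<inter> Y j \<and> (B = N \<inter> Y j \<or> card B = l) \<and> card B \<le> l \<and>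
      (\<forall>x\<in>B. \<forall>y\<in>N \<inter> Y j - B. h j x \<le> h j y)" for j
    using lowest_keys[of "N \<inter> Y j" l "h j"] N by (metis finite_Int)
  then obtain B where B: "\<And>j. B j \<subseteq> N \<inter> Y j" "\<And>j. B j = N \<inter> Y j \<or> card (B j) = l" "\<And>j. card (B j) \<le> l"
      "\<And>j x y. x \<in> B j \<Longrightarrow> y \<in> N \<inter> Y j - B j \<Longrightarrow> h j x \<le> h j y"
    by metis
  \<comment> \<open>Coordinates whose whole class is already in \<open>B j\<close> need no hit; this
    also covers empty classes.\<close>
  define K where "K = {j\<in>{..<k}. B j \<noteq> N \<inter> Y j}"
  define I where "I = (\<Union>j<k. B j)"
  have "card I \<le> (\<Sum>j<k. card (B j))" unfolding I_def by (intro card_UN_le) auto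
  also have "\<dots> \<le> (\<Sum>j<k. l)" using B by (intro sum_mono) auto
  finally have cI: "card I \<le> k * l" by simp
  have "S V = S (V \<inter> I)" if UV: "U \<subseteq> V" "V \<subseteq> N" and hit: "\<forall>j\<in>K. U \<inter> B j \<noteq> {}" for U V
  proof -
    have "(INF x\<in>V \<inter> Y j. ereal (h j x)) = (INF x\<in>V \<inter> I \<inter> Y j. ereal (h j x))" if j: "j < k" for j
    proof (rule antisym)
      show "(INF x\<in>V \<inter> Y j. ereal (h j x)) \<le> (INF x\<in>V \<inter> I \<inter> Y j. ereal (h j x))"
        by (intro INF_superset_mono) auto
      show "(INF x\<in>V \<inter> I \<inter> Y j. ereal (h j x)) \<le> (INF x\<in>V \<inter> Y j. ereal (h j x))"
      proof (rule INF_mono)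
        fix x assume x: "x \<in> V \<inter> Y j"
        show "\<exists>y\<in>V \<inter> I \<inter> Y j. ereal (h j y) \<le> ereal (h j x)"
        proof (cases "x \<in> B j")
          case True
          then show ?thesis using x j by (intro bexI[of _ x]) (auto simp: I_def)
        next
          case False
          then have "B j \<noteq> N \<inter> Y j" using x UV by auto
          then obtain y where y: "y \<in> U" "y \<in> B j" using hit j by (auto simp: K_def)
          then have "h j y \<le> h j x" using B(4)[of y j x] False x UV by auto
          then show ?thesis using y B(1)[of j] UV j by (intro bexI[of _ y]) (auto simp: I_def)
        qed
      qed
    qed
    then show ?thesis unfolding S by simp
  qed
  moreover have "card (B j) = l" if "j \<in> K" for j using B(2)[of j] that by (auto simp: K_def)
  then have "subset_mean q N (\<lambda>U. of_bool (\<not> (\<forall>j\<in>K. U \<inter> B j \<noteq> {}))) \<le> real k * (19/20) ^ l"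
    if "1/20 \<le> q" "q \<le> 1/4" for q
    using B(1) N that by (intro subset_mean_miss_some_block) (auto simp: K_def)
  moreover have "I \<subseteq> N" using B(1) by (auto simp: I_def)
  ultimately show ?thesis unfolding has_important_keys_def using cI
    by (intro exI[of _ I] exI[of _ "\<lambda>U. \<forall>j\<in>K. U \<inter> B j \<noteq> {}"]) blast
qed

lemma has_important_keys_kmins: "finite N \<Longrightarrow> has_important_keys (kmins_sketch k h) N k l"
  by (rule has_important_keys_min_sketch[where Y = "\<lambda>_. UNIV" and h = h]) (auto simp: kmins_sketch_def)

lemma has_important_keys_kpartition: "finite N \<Longrightarrow> has_important_keys (kpartition_sketch k P h) N k l"
  by (rule has_important_keys_min_sketch[where Y = "\<lambda>j. {x. P x = j}" and h = "\<lambda>_. h"])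
    (auto simp: kpartition_sketch_def Int_def)

section \<open>Bottom-k sketches\<close>

lemma sorted_list_of_set_union:
  assumes "finite X" "finite Y" "\<And>x y. x \<in> X \<Longrightarrow> y \<in> Y \<Longrightarrow> x < (y::real)"
  shows "sorted_list_of_set (X \<union> Y) = sorted_list_of_set X @ sorted_list_of_set Y"
proof (rule sorted_distinct_set_unique)
  show "sorted (sorted_list_of_set X @ sorted_list_of_set Y)"
    using assms by (auto simp: sorted_append less_imp_le)
  show "distinct (sorted_list_of_set X @ sorted_list_of_set Y)"
    using assms by (auto dest: less_imp_neq)
qed (use assms in auto)

text \<open>The lowest k * l keys are cut into k blocks of l. A set meeting every block contains k
  of them, and these precede all other keys. Blocks replace a lower-tail estimate for a binomial
  count by the same union bound as above. Injectivity makes k keys yield k distinct values.\<close>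

lemma has_important_keys_bottomk:
  assumes N: "finite N" and inj: "inj_on h N"
  shows "has_important_keys (bottomk_sketch k h) N k l"
proof -
  obtain I where I: "I \<subseteq> N" "I = N \<or> card I = k * l" "card I \<le> k * l" "\<And>x y. x \<in> I \<Longrightarrow> y \<in> N - I \<Longrightarrow> h x \<le> h y"
    using lowest_keys[OF N, of "k * l" h] by metis
  show ?thesis
  proof (cases "I = N")
    case True
    have "V \<inter> I = V" if "V \<subseteq> N" for V using that True by auto
    then show ?thesis unfolding has_important_keys_def using I True N
      by (intro exI[of _ I] exI[of _ "\<lambda>_. True"]) (auto simp: subset_mean_const)
  next
    case False
    then have cI: "card I = k * l" using I by auto
    have finI: "finite I" using I N finite_subset by blast
    obtain g where g: "bij_betw g I {0..<k * l}" using ex_bij_betw_finite_nat[OF finI] cI by auto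
    \<comment> \<open>Any numbering of \<open>I\<close> will do: only the sizes and disjointness of
      the blocks matter, not their order by hash value.\<close>
    define B where "B j = {x\<in>I. g x div l = j}" for j
    have cB: "card (B j) = l" if j: "j < k" for j
    proof (cases "l = 0")
      case True then show ?thesis using cI finI by (simp add: B_def)
    next
      case False
      have "bij_betw g (B j) {m\<in>{0..<k * l}. m div l = j}"
        using g unfolding B_def bij_betw_def inj_on_def by auto
      moreover have "{m\<in>{0..<k * l}. m div l = j} = {j * l..<j * l + l}"
      proof -
        have "m < k * l" if "m < j * l + l" for m
        proof -
          have "j * l + l = Suc j * l" by simp
          also have "\<dots> \<le> k * l" using j by (intro mult_le_mono1) auto
          finally show ?thesis using that by simp
        qed
        then show ?thesis using False
          by (auto simp: div_nat_eqI div_less_iff_less_mult algebra_simps dividend_less_times_div intro!: div_nat_eqI)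
      qed
      ultimately show ?thesis using bij_betw_same_card by fastforce
    qed
    have "bottomk_sketch k h V = bottomk_sketch k h (V \<inter> I)"
      if UV: "U \<subseteq> V" "V \<subseteq> N" and hit: "\<forall>j\<in>{..<k}. U \<inter> B j \<noteq> {}" for U V
    proof -
      have fV: "finite V" using UV N finite_subset by blast
      have "k = (\<Sum>j<k. 1)" by simp
      also have "\<dots> \<le> (\<Sum>j<k. card (V \<inter> B j))"
      proof (rule sum_mono)
        fix j assume "j \<in> {..<k}"
        then have "V \<inter> B j \<noteq> {}" using hit UV by blast
        then show "1 \<le> card (V \<inter> B j)" using fV by (simp add: Suc_le_eq card_gt_0_iff)
      qed
      also have "\<dots> = card (\<Union>j<k. V \<inter> B j)"
        using fV by (intro card_UN_disjoint[symmetric]) (auto simp: B_def)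
      also have "\<dots> \<le> card (V \<inter> I)" using fV by (intro card_mono) (auto simp: B_def)
      also have "\<dots> = card (h ` (V \<inter> I))"
        using inj UV by (intro card_image[symmetric]) (auto intro: inj_on_subset)
      finally have k: "k \<le> card (h ` (V \<inter> I))" .
      have less: "h x < h y" if "x \<in> V \<inter> I" "y \<in> V - I" for x y
      proof -
        have "h x \<noteq> h y" using inj_onD[OF inj, of x y] that UV by auto
        moreover have "h x \<le> h y" using I(4)[of x y] that UV by auto
        ultimately show ?thesis by simp
      qed
      have "h ` V = h ` (V \<inter> I) \<union> h ` (V - I)" by auto
      then have "sorted_list_of_set (h ` V) = sorted_list_of_set (h ` (V \<inter> I)) @ sorted_list_of_set (h ` (V - I))"
        using fV less by (simp only:) (intro sorted_list_of_set_union; auto)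
      then show ?thesis unfolding bottomk_sketch_def using k by simp
    qed
    moreover have "subset_mean q N (\<lambda>U. of_bool (\<not> (\<forall>j\<in>{..<k}. U \<inter> B j \<noteq> {}))) \<le> real k * (19/20) ^ l"
      if "1/20 \<le> q" "q \<le> 1/4" for q
      using cB N that I by (intro subset_mean_miss_some_block) (auto simp: B_def)
    ultimately show ?thesis unfolding has_important_keys_def using I
      by (intro exI[of _ I] exI[of _ "\<lambda>U. \<forall>j\<in>{..<k}. U \<inter> B j \<noteq> {}"]) blast
  qed
qed

section \<open>Almost sure absence of ties\<close>

text \<open>By Fubini the diagonal is null for the product of an atomless law with itself; finitely
  many pairs of keys remain to be excluded.\<close>

lemma AE_iid_inj_on:
  assumes "prob_space R" and \<nu>: "continuous_law \<nu>" and iid: "iid_on R \<nu> h X" and X: "finite X"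
  shows "AE \<rho> in R. inj_on (\<lambda>x. h x \<rho>) X"
proof -
  interpret prob_space R by fact
  interpret \<nu>: prob_space \<nu> using \<nu> by (simp add: continuous_law_def)
  interpret P: pair_prob_space \<nu> \<nu> ..
  have sets: "sets \<nu> = sets borel" using \<nu> by (simp add: continuous_law_def)
  have sp: "space \<nu> = UNIV" using sets_eq_imp_space_eq[OF sets] by simp
  have sets2: "sets (\<nu> \<Otimes>\<^sub>M \<nu>) = sets (borel \<Otimes>\<^sub>M borel)" using sets by (intro sets_pair_measure_cong)
  have ind: "indep_vars (\<lambda>_. \<nu>) h X" and law: "\<And>x. x \<in> X \<Longrightarrow> distr R \<nu> (h x) = \<nu>"
    using iid by (auto simp: iid_on_def)
  have "AE \<rho> in R. h x \<rho> \<noteq> h y \<rho>" if xy: "x \<in> X" "y \<in> X" "x \<noteq> y" for x y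
  proof -
    have iv: "indep_var \<nu> (h x) \<nu> (h y)"
    proof -
      have "indep_var \<nu> ((\<lambda>f. f x) \<circ> (\<lambda>\<omega>. restrict (\<lambda>i. h i \<omega>) {x})) \<nu> ((\<lambda>f. f y) \<circ> (\<lambda>\<omega>. restrict (\<lambda>i. h i \<omega>) {y}))"
        by (rule indep_var_compose[OF indep_var_restrict[OF ind]]) (use xy in auto)
      then show ?thesis by (simp add: comp_def)
    qed
    then have D: "distr R (\<nu> \<Otimes>\<^sub>M \<nu>) (\<lambda>\<rho>. (h x \<rho>, h y \<rho>)) = \<nu> \<Otimes>\<^sub>M \<nu>"
      unfolding indep_var_distribution_eq using law xy by auto
    have rv: "h x \<in> measurable R \<nu>" "h y \<in> measurable R \<nu>"
      using iv by (auto simp: indep_var_distribution_eq)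
    have diag: "{p \<in> space (\<nu> \<Otimes>\<^sub>M \<nu>). \<not> fst p \<noteq> snd p} \<in> sets (\<nu> \<Otimes>\<^sub>M \<nu>)"
    proof -
      have "{p \<in> space (borel \<Otimes>\<^sub>M borel :: (real \<times> real) measure). \<not> fst p \<noteq> snd p} \<in> sets (borel \<Otimes>\<^sub>M borel)" by measurable
      then show ?thesis using sets2 sets_eq_imp_space_eq[OF sets2] by simp
    qed
    have "AE p in \<nu> \<Otimes>\<^sub>M \<nu>. fst p \<noteq> snd p"
    proof (rule AE_I)
      have "emeasure (\<nu> \<Otimes>\<^sub>M \<nu>) {p \<in> space (\<nu> \<Otimes>\<^sub>M \<nu>). \<not> fst p \<noteq> snd p}
        = (\<integral>\<^sup>+a. emeasure \<nu> (Pair a -` {p \<in> space (\<nu> \<Otimes>\<^sub>M \<nu>). \<not> fst p \<noteq> snd p}) \<partial>\<nu>)"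
        by (rule \<nu>.emeasure_pair_measure_alt[OF diag])
      also have "\<dots> = (\<integral>\<^sup>+a. 0 \<partial>\<nu>)"
      proof (rule nn_integral_cong)
        fix a
        have "Pair a -` {p \<in> space (\<nu> \<Otimes>\<^sub>M \<nu>). \<not> fst p \<noteq> snd p} = {a}"
          by (auto simp: space_pair_measure sp)
        then show "emeasure \<nu> (Pair a -` {p \<in> space (\<nu> \<Otimes>\<^sub>M \<nu>). \<not> fst p \<noteq> snd p}) = 0"
          using \<nu> by (simp add: continuous_law_def \<nu>.emeasure_eq_measure)
      qed
      finally show "emeasure (\<nu> \<Otimes>\<^sub>M \<nu>) {p \<in> space (\<nu> \<Otimes>\<^sub>M \<nu>). \<not> fst p \<noteq> snd p} = 0" by simp
    qed (use diag in auto)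
    then have "AE p in distr R (\<nu> \<Otimes>\<^sub>M \<nu>) (\<lambda>\<rho>. (h x \<rho>, h y \<rho>)). fst p \<noteq> snd p" unfolding D .
    then show ?thesis
      by (subst (asm) AE_distr_iff) (use rv diag in \<open>auto simp: Collect_neg_eq\<close>)
  qed
  then have "AE \<rho> in R. \<forall>x\<in>X. \<forall>y\<in>X. x \<noteq> y \<longrightarrow> h x \<rho> \<noteq> h y \<rho>"
    using X by (simp add: AE_finite_all)
  then show ?thesis by eventually_elim (auto simp: inj_on_def)
qed

text \<open>The quantifiers over \<open>N\<close> and \<open>l\<close> stand inside: a single null
  set, at worst that of ties in the whole universe, serves every ground set the attacker may
  draw.\<close>

lemma AE_minhash_has_important_keys:
  assumes "prob_space R" "finite X" "is_minhash R X k S"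
  shows "AE \<rho> in R. \<forall>N\<subseteq>X. \<forall>l. has_important_keys (S \<rho>) N k l"
  using assms(3) unfolding is_minhash_def
proof (elim disjE)
  assume "is_kmins R X k S"
  then show ?thesis
    using assms(2) by (auto simp: is_kmins_def intro!: AE_I2 has_important_keys_kmins intro: finite_subset)
next
  assume "is_kpartition R X k S"
  then show ?thesis
    using assms(2) by (auto simp: is_kpartition_def intro!: AE_I2 has_important_keys_kpartition intro: finite_subset)
next
  assume "is_bottomk R X k S"
  then obtain \<nu> h where h: "continuous_law \<nu>" "iid_on R \<nu> h X" "S = (\<lambda>\<rho>. bottomk_sketch k (\<lambda>x. h x \<rho>))"
    by (auto simp: is_bottomk_def)
  have "AE \<rho> in R. inj_on (\<lambda>x. h x \<rho>) X" by (rule AE_iid_inj_on[OF assms(1) h(1,2) assms(2)])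
  then show ?thesis
    by eventually_elim (use assms(2) in \<open>auto simp: h(3) intro!: has_important_keys_bottomk intro: finite_subset inj_on_subset\<close>)
qed


section \<open>Constants\<close>

text \<open>The free parameters are fixed here. The three potentials then start at no more than
  1/500, 1/1000 and 1/1000, well below 1/100 together.\<close>

lemma prob_loop_failure:
  fixes N :: "'a set" and k r :: nat and \<alpha> :: real
  defines "n \<equiv> card N" and "L \<equiv> ln (200 * real (card N) * real r)"
  assumes N: "finite N" and imp: "\<And>l. has_important_keys S N k l" and enum: "set_enumeration enum"
    and Q: "\<And>tr D. (\<exists>\<pi>. correct_map S (real n / 16) \<delta> D \<pi>) \<Longrightarrow> correct_map S (real n / 16) \<delta> D (Q tr D)"
    and \<delta>: "0 \<le> \<delta>" "\<delta> \<le> 1/100" and k: "1 \<le> k" and \<alpha>: "0 < \<alpha>" and r: "1000 \<le> r" "1 / \<alpha> \<le> sqrt (real r)"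
    and n: "122 * real k * ln (real k * real r) \<le> \<alpha> * real n" "2000000 * (real k * ln (real k * real r)) \<le> real n"
    and L: "7200 \<le> L" "4 * (1 + L) * exp (- (L / 500)) \<le> 1/1000"
      "402 * (1 + L) * exp (L / 2) * exp (- (81 / 125 * L)) \<le> 1/1000"
    and rL: "15 * 10 ^ 11 * (real k)\<^sup>2 * L ^ 3 \<le> real r"
  shows "measure_pmf.prob (attack_loop r enum S Q (real n / 16) \<delta> n r N {} (\<lambda>_. 0) [])
      {M. \<not> (real (card M) < \<alpha> * real n \<and> \<not> (\<exists>\<pi>. correct_map S (real n / 16) \<delta> (query_dist (real n / 16) N M) \<pi>))} \<le> 1/100"
proof -
  define x where "x = real k * real r"
  define \<Lambda> where "\<Lambda> = ln x"
  \<comment> \<open>Since 60 / 20 = 3, the miss probability of a block is at most (k r)^(-3). This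
    makes both \<open>r * \<epsilon>\<close> and \<open>|I| * \<epsilon>\<close> small, while |I|
    \<le> 61 k ln (k r).\<close>
  define l where "l = nat \<lceil>60 * \<Lambda>\<rceil>"
  have "1 * 1000 \<le> x" unfolding x_def using k r by (intro mult_mono) auto
  then have x: "1000 \<le> x" "0 < x" by auto
  have \<Lambda>: "1 \<le> \<Lambda>" unfolding \<Lambda>_def using x exp_le by (subst ln_ge_iff) auto
  have l: "60 * \<Lambda> \<le> real l" "real l \<le> 61 * \<Lambda>" using \<Lambda> unfolding l_def by linarith+
  have "(19/20 :: real) ^ l \<le> exp (- (1/20)) ^ l"
    using exp_ge_add_one_self[of "- (1/20)"] by (intro power_mono) auto
  also have "\<dots> = exp (- (real l / 20))" by (simp flip: exp_of_nat_mult)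
  also have "\<dots> \<le> exp (- (real 3 * \<Lambda>))" using l by simp
  also have "\<dots> = 1 / x ^ 3"
    unfolding exp_minus exp_of_nat_mult using x by (simp add: \<Lambda>_def inverse_eq_divide)
  finally have pl: "(19/20 :: real) ^ l \<le> 1 / x ^ 3" .
  define \<epsilon> where "\<epsilon> = real k * (19/20) ^ l"
  have \<epsilon>0: "0 \<le> \<epsilon>" by (simp add: \<epsilon>_def)
  have \<epsilon>k: "\<epsilon> \<le> real k / x ^ 3"
    using mult_left_mono[OF pl, of "real k"] by (simp add: \<epsilon>_def)
  have "real r * \<epsilon> \<le> real r * (real k / x ^ 3)" using \<epsilon>k by (intro mult_left_mono) auto
  also have "\<dots> = 1 / x ^ 2"
  proof -
    have "real r * (real k / x ^ 3) = x / x ^ 3" by (simp add: x_def)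
    then show ?thesis using x by (simp add: power3_eq_cube power2_eq_square)
  qed
  also have "\<dots> \<le> 1 / 1000"
  proof -
    have "x * 1 \<le> x * x" using x by (intro mult_left_mono) auto
    then have "1000 \<le> x ^ 2" unfolding power2_eq_square using x by linarith
    then show ?thesis using x by (simp add: field_simps)
  qed
  finally have r\<epsilon>: "real r * \<epsilon> \<le> 1 / 1000" .
  have "1 * \<epsilon> \<le> real r * \<epsilon>" using r \<epsilon>0 by (intro mult_right_mono) auto
  then have \<epsilon>1: "\<epsilon> \<le> 1 / 1000" using r\<epsilon> by simp
  obtain I hit where I: "I \<subseteq> N" "card I \<le> k * l"
      "\<And>U V. U \<subseteq> V \<Longrightarrow> V \<subseteq> N \<Longrightarrow> hit U \<Longrightarrow> S V = S (V \<inter> I)"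
      "\<And>q. 1/20 \<le> q \<Longrightarrow> q \<le> 1/4 \<Longrightarrow> subset_mean q N (\<lambda>U. of_bool (\<not> hit U)) \<le> \<epsilon>"
    using imp[of l] unfolding has_important_keys_def \<epsilon>_def by blast
  have "real (card I) \<le> real (k * l)" using I(2) by (rule of_nat_mono)
  also have "\<dots> \<le> real k * (61 * \<Lambda>)" using l by (simp add: mult_left_mono)
  finally have cI: "real (card I) \<le> 61 * (real k * \<Lambda>)" by simp
  have k\<Lambda>: "real k * 1 \<le> real k * \<Lambda>" using \<Lambda> by (intro mult_left_mono) auto
  then have k\<Lambda>1: "1 \<le> real k * \<Lambda>" using k by linarith
  have n2: "2000000 * (real k * \<Lambda>) \<le> real n" using n(2) by (simp add: \<Lambda>_def x_def)
  have n1: "122 * (real k * \<Lambda>) \<le> \<alpha> * real n" using n(1) by (simp add: \<Lambda>_def x_def mult.assoc)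
  have nbig: "2000000 \<le> real n" using n2 k\<Lambda>1 by linarith
  have "real (card I) * \<epsilon> \<le> 61 * (real k * \<Lambda>) * (real k / x ^ 3)"
    using cI \<epsilon>k \<epsilon>0 \<Lambda> by (intro mult_mono) auto
  also have "\<dots> \<le> 61 * (real k * x) * (real k / x ^ 3)"
    using x unfolding \<Lambda>_def by (intro mult_right_mono mult_left_mono) (auto intro: order_trans[OF ln_le_minus_one])
  also have "\<dots> = 61 / (real r)\<^sup>2"
    using k r by (simp add: x_def power3_eq_cube power2_eq_square field_simps)
  also have "\<dots> \<le> 1 / 20"
  proof -
    have "real r * 1000 \<le> real r * real r" using r by (intro mult_left_mono) auto
    then have "1220 \<le> (real r)\<^sup>2" unfolding power2_eq_square using r by linarith
    then show ?thesis using r by (simp add: field_simps)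
  qed
  finally have I\<epsilon>: "real (card I) * \<epsilon> \<le> 1 / 20" .
  obtain J where J: "4 ^ J \<le> r" "r < 4 ^ (J + 1)" using ex_power_ivl1[of 4 r] r by auto
  \<comment> \<open>Half of the mask budget goes to unimportant keys. The constant 122 = 2 * 61 in
    the hypothesis on \<open>n\<close> lets \<open>I\<close> fit into the other half.\<close>
  define \<beta> where "\<beta> = min (\<alpha> / 2) (1/400)"
  have \<beta>: "0 < \<beta>" "\<beta> \<le> 1/400" "\<beta> \<le> \<alpha> / 2" using \<alpha> by (auto simp: \<beta>_def)
  have "\<beta> * real n \<le> \<alpha> / 2 * real n" using \<beta> by (intro mult_right_mono) auto
  then have mask: "real (card I) + \<beta> * real n \<le> \<alpha> * real n" using cI n1 by linarith
  interpret run: attack_run S N I hit \<epsilon> enum Q \<delta> r J \<alpha> \<beta> L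
  proof unfold_locales
    show "finite N" "I \<subseteq> N" by fact+
    show "2 * 10 ^ 6 \<le> real (card N)" using nbig by (simp add: n_def)
    show "real (card I) \<le> real (card N) / 400" using cI n2 \<open>1 \<le> real k * \<Lambda>\<close> by (simp add: n_def)
    show "S V = S (V \<inter> I)" if "U \<subseteq> V" "V \<subseteq> N" "hit U" for U V using I(3)[OF that] .
    show "subset_mean q N (\<lambda>U. of_bool (\<not> hit U)) \<le> \<epsilon>" if "1/20 \<le> q" "q \<le> 1/4" for q using I(4)[OF that] .
    show "correct_map S (real (card N) / 16) \<delta> D (Q tr D)" if "\<exists>\<pi>. correct_map S (real (card N) / 16) \<delta> D \<pi>" for tr D
      using Q[unfolded n_def, OF that] .
    show "1 \<le> r" "r < 4 ^ Suc J" using r J by auto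
    show "real r * \<epsilon> \<le> 1" using r\<epsilon> by simp
    show "L = ln (200 * real (card N) * real r)" by (simp add: L_def)
    show "real (card I) + \<beta> * real (card N) \<le> \<alpha> * real (card N)" using mask by (simp add: n_def)
  qed (fact enum \<delta> L(1) \<beta>(1,2) \<epsilon>0 \<epsilon>1 I\<epsilon>)+
  have n1': "1 \<le> real n" using nbig by simp
  have expL: "exp L = 200 * real n * real r" using n1' r unfolding L_def n_def by (intro exp_ln) auto
  have rL1: "real r \<le> exp L"
  proof -
    have "1 * real r \<le> (200 * real n) * real r" using n1' by (intro mult_right_mono) auto
    then show ?thesis by (simp add: expL)
  qed
  have \<Lambda>L: "\<Lambda> \<le> L"
  proof -
    have "real k \<le> 200 * real n" using k\<Lambda> n2 k\<Lambda>1 by linarith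
    then have "x \<le> exp L" unfolding x_def expL by (intro mult_right_mono) auto
    then show ?thesis unfolding \<Lambda>_def using x by (metis ln_exp ln_mono)
  qed
  have SJ: "real (Suc J) \<le> 1 + L"
  proof -
    have "1 \<le> ln (4::real)" using exp_le by (subst ln_ge_iff) auto
    then have "real J * 1 \<le> real J * ln 4" by (intro mult_left_mono) auto
    also have "\<dots> = ln (4 ^ J)" by (simp add: ln_realpow)
    also have "\<dots> \<le> ln (exp L)"
    proof (rule ln_mono)
      have "real (4 ^ J) \<le> real r" using J(1) by (simp only: of_nat_le_iff)
      then show "4 ^ J \<le> exp L" using rL1 unfolding of_nat_power of_nat_numeral by linarith
    qed auto
    finally show ?thesis by simp
  qed
  have sqrt_r: "sqrt (real r) \<le> exp (L / 2)"
    using rL1 by (intro real_le_lsqrt) (auto simp: power2_eq_square simp flip: exp_add)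
  \<comment> \<open>The hypothesis on 1 / \<alpha> and r \<le> exp L bound 1 / \<alpha> by exp (L /
    2); 402 adds up the two cases 2 / \<alpha> and 400.\<close>
  have inv\<beta>: "1 / \<beta> \<le> 402 * exp (L / 2)"
  proof -
    have "1 \<le> sqrt (real r)" using r by simp
    then have "1 / \<alpha> \<le> exp (L / 2)" "1 \<le> exp (L / 2)" using sqrt_r r(2) by linarith+
    moreover have "1 / \<beta> = 2 * (1 / \<alpha>) \<or> 1 / \<beta> = 400" by (simp add: \<beta>_def min_def)
    ultimately show ?thesis by linarith
  qed
  have low: "4 * real (Suc J) * exp (- (L / 500)) \<le> 1 / 1000"
    using SJ by (intro order_trans[OF _ L(2)] mult_right_mono) auto
  have "real (Suc J) / \<beta> * exp (- (81 / 125 * L)) = real (Suc J) * (1 / \<beta>) * exp (- (81 / 125 * L))" by simp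
  also have "\<dots> \<le> (1 + L) * (402 * exp (L / 2)) * exp (- (81 / 125 * L))"
    using SJ inv\<beta> \<beta> L(1) by (intro mult_mono) auto
  also have "\<dots> \<le> 1 / 1000" using L(3) by (simp only: mult.assoc mult.left_commute)
  finally have up: "real (Suc J) / \<beta> * exp (- (81 / 125 * L)) \<le> 1 / 1000" .
  have s: "1 \<le> sqrt (real r * L)"
  proof -
    have "1 * 1 \<le> real r * L" using r L(1) by (intro mult_mono) auto
    then show ?thesis by simp
  qed
  have "run.cap \<le> 4 * sqrt (real r * L)"
  proof -
    have "run.thr r \<le> sqrt (real r * L)" unfolding run.thr_def using L(1) r by (intro real_sqrt_le_mono) auto
    then show ?thesis using s unfolding run.cap_def by linarith
  qed
  moreover have cap0: "0 \<le> run.cap" unfolding run.cap_def run.thr_def using L(1) by simp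
  moreover have "real (card I) \<le> 61 * (real k * L)"
    using cI mult_left_mono[OF \<Lambda>L, of "real k"] by simp
  ultimately have "real (card I) * run.cap \<le> 61 * (real k * L) * (4 * sqrt (real r * L))"
    using L(1) by (intro mult_mono) auto
  \<comment> \<open>1220000 = 5000 * 61 * 4 collects the factor 10 of \<open>adv\<close>, the target
    1/500 and the bounds on \<open>|I|\<close> and \<open>cap\<close>. Its square is below 15 *
    10^11, and squaring is what asks for r of order k^2 L^3.\<close>
  moreover have "1220000 * (real k * L * sqrt (real r * L)) \<le> real r"
  proof (rule power2_le_imp_le)
    have "(1220000 * (real k * L * sqrt (real r * L)))\<^sup>2 = 1220000\<^sup>2 * ((real k)\<^sup>2 * L\<^sup>2 * (real r * L))"
      using L(1) by (simp add: power_mult_distrib)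
    also have "\<dots> = 1220000\<^sup>2 * ((real k)\<^sup>2 * L ^ 3) * real r" by (simp add: power2_eq_square power3_eq_cube)
    also have "\<dots> \<le> 15 * 10 ^ 11 * ((real k)\<^sup>2 * L ^ 3) * real r"
      using L(1) by (intro mult_right_mono) auto
    also have "\<dots> \<le> real r * real r" using rL by (intro mult_right_mono) (auto simp: mult_ac)
    finally show "(1220000 * (real k * L * sqrt (real r * L)))\<^sup>2 \<le> (real r)\<^sup>2" by (simp add: power2_eq_square)
  qed auto
  ultimately have "500 * (10 * (real (card I) * run.cap)) \<le> real r" by linarith
  then have adv: "10 / real r * (real (card I) * run.cap) \<le> 1 / 500"
    using r by (simp add: field_simps)
  have "measure_pmf.prob (attack_loop r enum S Q run.A \<delta> (card N) r N {} (\<lambda>_. 0) []) run.failure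
    \<le> 10 / real r * (real (card I) * run.cap) + 4 * real (Suc J) * exp (- (L / 500)) + real (Suc J) / \<beta> * exp (- (81 / 125 * L))"
    by (rule run.prob_failure) (use low up in linarith)+
  also have "\<dots> \<le> 1 / 100" using adv low up by linarith
  finally show ?thesis unfolding run.failure_def n_def .
qed

lemma prob_attack_ge:
  assumes X: "finite X" "n \<le> card X"
    and loop: "\<And>N. N \<subseteq> X \<Longrightarrow> card N = n \<Longrightarrow>
      measure_pmf.prob (attack_loop r enum S Q A \<delta> n r N {} (\<lambda>_. 0) []) {M. \<not> P N M} \<le> 1/100"
  shows "0.99 \<le> measure_pmf.prob (attack enum S Q A \<delta> n r X) {(N, M). P N M}"
proof -
  let ?Ns = "{N. N \<subseteq> X \<and> card N = n}"
  have fin: "finite ?Ns" using X by auto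
  have ne: "?Ns \<noteq> {}" using obtain_subset_with_card_n[OF X(2)] by blast
  have "measure_pmf.prob (attack enum S Q A \<delta> n r X) {(N, M). \<not> P N M} \<le> measure_pmf.expectation (pmf_of_set ?Ns) (\<lambda>_. 1/100)"
    unfolding attack_def
  proof (rule prob_bind_le)
    fix N assume "N \<in> set_pmf (pmf_of_set ?Ns)"
    then have N: "N \<subseteq> X" "card N = n" using fin ne by auto
    have "measure_pmf.prob (attack_loop r enum S Q A \<delta> n r N {} (\<lambda>_. 0) [] \<bind> (\<lambda>M. return_pmf (N, M))) {(N, M). \<not> P N M}
      = measure_pmf.prob (attack_loop r enum S Q A \<delta> n r N {} (\<lambda>_. 0) []) {M. \<not> P N M}"
      by (simp add: vimage_def flip: map_pmf_def)
    also have "\<dots> \<le> 1/100" by (rule loop[OF N])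
    finally show "measure_pmf.prob (attack_loop r enum S Q A \<delta> n r N {} (\<lambda>_. 0) [] \<bind> (\<lambda>M. return_pmf (N, M))) {(N, M). \<not> P N M} \<le> 1/100" .
  qed (use fin ne in auto)
  then have "measure_pmf.prob (attack enum S Q A \<delta> n r X) {(N, M). \<not> P N M} \<le> 1/100" by simp
  moreover have "{(N, M). P N M} = UNIV - {(N, M). \<not> P N M}" by auto
  ultimately show ?thesis
    using measure_pmf.prob_compl[of "{(N, M). \<not> P N M}" "attack enum S Q A \<delta> n r X"] by simp
qed

text \<open>The last term decays because 81/125 exceeds the 1/2 spent on 1 / \<beta>; this is what
  the losses 4/5 and 9/10 still leave room for.\<close>

lemma eventually_tail_constants:
  "\<forall>\<^sub>F L::real in at_top. 7200 \<le> L \<and> 4 * (1 + L) * exp (- (L / 500)) \<le> 1/1000 \<and>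
      402 * (1 + L) * exp (L / 2) * exp (- (81 / 125 * L)) \<le> 1/1000"
  by (intro eventually_conj) real_asymp+

lemma eventually_cubed_log_le:
  "\<forall>\<^sub>F y::real in at_top. 15 * 10 ^ 11 * (16 + ln y) ^ 3 \<le> y"
  by real_asymp

text \<open>The hypothesis only provides powers of \<open>ln n\<close>; writing \<open>r = k\<^sup>2 (1 + ln n)\<^sup>6 y\<close> shows that they also control \<open>ln r\<close>.\<close>

lemma cubed_log_le:
  fixes k n r y :: real
  assumes "1 \<le> k" "k \<le> n" "1 \<le> y" "15 * 10 ^ 11 * (16 + ln y) ^ 3 \<le> y" and r: "r = k\<^sup>2 * (1 + ln n) ^ 6 * y"
  shows "15 * 10 ^ 11 * k\<^sup>2 * (ln (200 * n * r)) ^ 3 \<le> r"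
proof -
  define m where "m = 1 + ln n"
  have m: "1 \<le> m" using assms by (simp add: m_def)
  have "0 < k\<^sup>2" "0 < m ^ 6" using assms m by auto
  have r1: "r = k\<^sup>2 * m ^ 6 * y" by (simp add: r m_def)
  have "ln r = 2 * ln k + 6 * ln m + ln y"
    unfolding r1 using assms m by (simp add: ln_mult ln_realpow)
  moreover have "ln k \<le> m" using assms by (simp add: m_def add_increasing)
  moreover have "ln m \<le> m" using m ln_le_minus_one[of m] by linarith
  moreover have "ln (200::real) \<le> 8"
  proof -
    have "(200::real) \<le> 2 ^ 8" by simp
    also have "\<dots> \<le> exp 1 ^ 8" using exp_ge_add_one_self[of 1] by (intro power_mono) auto
    also have "\<dots> = exp 8" by (simp flip: exp_of_nat_mult)
    finally have "ln 200 \<le> ln (exp 8 :: real)" by (intro ln_mono) auto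
    then show ?thesis by simp
  qed
  moreover have "0 < r" unfolding r1 using assms m by simp
  then have "ln (200 * n * r) = ln 200 + ln n + ln r" using assms(1,2) by (simp add: ln_mult)
  moreover have "ln n = m - 1" by (simp add: m_def)
  ultimately have "ln (200 * n * r) \<le> 7 + 9 * m + ln y" by linarith
  also have "\<dots> \<le> 16 * m + m * ln y"
    using m assms mult_right_mono[of 1 m "ln y"] by simp
  finally have le: "ln (200 * n * r) \<le> m * (16 + ln y)" by (simp add: algebra_simps)
  have "(1::real) \<le> 200 * n * r"
  proof -
    have "1 * 1 \<le> (k\<^sup>2 * m ^ 6) * y" using assms m one_le_power[of m 6] one_le_power[of k 2]
      by (intro mult_mono order_trans[of 1 "1 * 1 :: real" "k\<^sup>2 * m ^ 6"]) (auto intro!: mult_mono[of 1 _ 1, simplified])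
    then have "1 * 1 \<le> (200 * n) * r" using assms unfolding r1 by (intro mult_mono) auto
    then show ?thesis by simp
  qed
  then have "0 \<le> ln (200 * n * r)" by simp
  then have "(ln (200 * n * r)) ^ 3 \<le> (m * (16 + ln y)) ^ 3" using le by (intro power_mono)
  then have "15 * 10 ^ 11 * k\<^sup>2 * (ln (200 * n * r)) ^ 3 \<le> 15 * 10 ^ 11 * k\<^sup>2 * (m * (16 + ln y)) ^ 3"
    by (intro mult_left_mono) auto
  also have "\<dots> = k\<^sup>2 * m ^ 3 * (15 * 10 ^ 11 * (16 + ln y) ^ 3)" by (simp add: power_mult_distrib)
  also have "\<dots> \<le> k\<^sup>2 * m ^ 6 * y"
    using assms m by (intro mult_mono mult_left_mono power_increasing) auto
  finally show ?thesis unfolding r1 .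
qed


theorem mainTheorem3:
  "\<exists>\<delta>\<^sub>0>0. \<forall>c>0. \<forall>\<alpha>\<^sub>0>0. \<exists>C\<^sub>1>0. \<exists>C\<^sub>2>0. \<exists>d::nat.
     \<forall>(R :: 'r measure) (\<U> :: 'a set) S QR enum (k::nat) (n::nat) (r::nat) (\<alpha>::real) (\<delta>::real).
       prob_space R \<longrightarrow> finite \<U> \<longrightarrow> n \<le> card \<U> \<longrightarrow> k \<ge> 1 \<longrightarrow>
       is_minhash R \<U> k S \<longrightarrow>
       0 \<le> \<delta> \<longrightarrow> \<delta> \<le> \<delta>\<^sub>0 \<longrightarrow> \<delta> \<le> c / sqrt (real k) \<longrightarrow>
       follows_protocol R S (real n / 16) \<delta> QR \<longrightarrow>
       set_enumeration enum \<longrightarrow>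
       0 < \<alpha> \<longrightarrow> \<alpha> \<le> \<alpha>\<^sub>0 \<longrightarrow>
       real n \<ge> C\<^sub>1 * (1 / \<alpha>) * real k * ln (real k * real r) \<longrightarrow>
       real r \<ge> C\<^sub>2 * (real k ^ 2 / \<alpha> ^ 2) * (1 + ln (real n)) ^ d \<longrightarrow>
       (\<integral>\<^sup>+\<rho>. measure_pmf.prob (attack enum (S \<rho>) (QR \<rho>) (real n / 16) \<delta> n r \<U>)
            {(N, M). real (card M) < \<alpha> * real n \<and>
               \<not> (\<exists>\<pi>. correct_map (S \<rho>) (real n / 16) \<delta> (query_dist (real n / 16) N M) \<pi>)} \<partial>R)
         \<ge> ennreal 0.99"
proof -
  obtain L\<^sub>0 :: real where L\<^sub>0: "\<And>L. L\<^sub>0 \<le> L \<Longrightarrow> 7200 \<le> L \<and> 4 * (1 + L) * exp (- (L / 500)) \<le> 1/1000 \<and>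
      402 * (1 + L) * exp (L / 2) * exp (- (81 / 125 * L)) \<le> 1/1000"
    using eventually_tail_constants unfolding eventually_at_top_linorder by blast
  obtain Y\<^sub>0 :: real where Y\<^sub>0: "\<And>y. Y\<^sub>0 \<le> y \<Longrightarrow> 15 * 10 ^ 11 * (16 + ln y) ^ 3 \<le> y"
    using eventually_cubed_log_le unfolding eventually_at_top_linorder by blast
  \<comment> \<open>The three summands secure a large \<open>L\<close>, a large \<open>y\<close> for
    the logarithmic comparison, and r \<ge> 1000.\<close>
  define r\<^sub>0 where "r\<^sub>0 = exp L\<^sub>0 + \<bar>Y\<^sub>0\<bar> + 1000"
  have r\<^sub>0: "1000 \<le> r\<^sub>0" "exp L\<^sub>0 \<le> r\<^sub>0" "Y\<^sub>0 \<le> r\<^sub>0"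
    using exp_ge_zero[of L\<^sub>0] abs_ge_zero[of Y\<^sub>0] abs_ge_self[of Y\<^sub>0] unfolding r\<^sub>0_def by linarith+
  have main: "(\<integral>\<^sup>+\<rho>. measure_pmf.prob (attack enum (S \<rho>) (QR \<rho>) (real n / 16) \<delta> n r \<U>)
            {(N, M). real (card M) < \<alpha> * real n \<and>
               \<not> (\<exists>\<pi>. correct_map (S \<rho>) (real n / 16) \<delta> (query_dist (real n / 16) N M) \<pi>)} \<partial>R)
         \<ge> ennreal 0.99"
    if R: "prob_space R" and X: "finite \<U>" "n \<le> card \<U>" and k: "1 \<le> k" and S: "is_minhash R \<U> k S"
      and \<delta>: "0 \<le> \<delta>" "\<delta> \<le> 1/100" and QR: "follows_protocol R S (real n / 16) \<delta> QR" and enum: "set_enumeration enum"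
      and \<alpha>: "0 < \<alpha>" "\<alpha> \<le> \<alpha>\<^sub>0"
      and n: "real n \<ge> (122 + 2000000 * \<alpha>\<^sub>0) * (1 / \<alpha>) * real k * ln (real k * real r)"
      and r: "real r \<ge> (\<alpha>\<^sub>0\<^sup>2 * r\<^sub>0 + 1) * (real k ^ 2 / \<alpha> ^ 2) * (1 + ln (real n)) ^ 6"
    for R :: "'r measure" and \<U> :: "'a set" and S QR enum and k n r :: nat and \<alpha> \<alpha>\<^sub>0 \<delta> :: real
  proof -
    interpret prob_space R by fact
    define m where "m = 1 + ln (real n)"
    \<comment> \<open>For n = 0 the convention ln 0 = 0 gives m = 1.\<close>
    have m: "1 \<le> m" unfolding m_def by (cases "n = 0") auto
    have m6: "1 \<le> m ^ 6" using m by (rule one_le_power)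
    have k2: "1 \<le> (real k)\<^sup>2" using k by (intro one_le_power) auto
    define y where "y = real r / ((real k)\<^sup>2 * m ^ 6)"
    have km: "0 < (real k)\<^sup>2 * m ^ 6" by (rule mult_pos_pos) (use k2 m6 in linarith)+
    have "(\<alpha>\<^sub>0\<^sup>2 * r\<^sub>0 + 1) / \<alpha>\<^sup>2 * ((real k)\<^sup>2 * m ^ 6) \<le> real r"
      using r by (simp add: m_def mult_ac)
    then have y: "(\<alpha>\<^sub>0\<^sup>2 * r\<^sub>0 + 1) / \<alpha>\<^sup>2 \<le> y" unfolding y_def using km by (simp add: pos_le_divide_eq)
    \<comment> \<open>The bound \<alpha> \<le> \<open>\<alpha>\<^sub>0\<close> makes the first part
      of the constant for \<open>r\<close> an absolute lower bound on \<open>y\<close>; the second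
      part, 1 / \<alpha>^2, gives 1 / \<alpha> \<le> sqrt r.\<close>
    have "r\<^sub>0 * 1 \<le> r\<^sub>0 * (\<alpha>\<^sub>0\<^sup>2 / \<alpha>\<^sup>2)"
      using \<alpha> r\<^sub>0 by (intro mult_left_mono) (auto simp: power_mono)
    moreover have "(\<alpha>\<^sub>0\<^sup>2 * r\<^sub>0 + 1) / \<alpha>\<^sup>2 = r\<^sub>0 * (\<alpha>\<^sub>0\<^sup>2 / \<alpha>\<^sup>2) + 1 / \<alpha>\<^sup>2" by (simp add: add_divide_distrib)
    ultimately have y0: "r\<^sub>0 + 1 / \<alpha>\<^sup>2 \<le> y" using y by linarith
    have \<alpha>2: "0 < 1 / \<alpha>\<^sup>2" using \<alpha> by simp
    have ynn: "0 \<le> y" using y0 \<alpha>2 r\<^sub>0 by linarith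
    have "1 * y \<le> ((real k)\<^sup>2 * m ^ 6) * y"
      using ynn mult_mono[OF k2 m6] by (intro mult_right_mono) auto
    also have ry: "((real k)\<^sup>2 * m ^ 6) * y = real r" unfolding y_def times_divide_eq_right
      by (rule nonzero_mult_div_cancel_left[OF less_imp_neq[OF km, THEN not_sym]])
    finally have yr: "y \<le> real r" by simp
    have r1000: "1000 \<le> r"
    proof -
      have "1000 \<le> real r" using yr y0 \<alpha>2 r\<^sub>0 by linarith
      then show ?thesis by simp
    qed
    have \<alpha>r: "1 / \<alpha> \<le> sqrt (real r)"
      using yr y0 r\<^sub>0 \<alpha> by (intro real_le_rsqrt) (simp add: power_divide)
    define w where "w = real k * ln (real k * real r)"
    have lnkr: "1 \<le> ln (real k * real r)"
    proof -
      have "1 * 1000 \<le> real k * real r" using k r1000 by (intro mult_mono) auto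
      then show ?thesis using exp_le by (subst ln_ge_iff) auto
    qed
    have w: "real k \<le> w" unfolding w_def using mult_left_mono[OF lnkr, of "real k"] by simp
    then have w0: "1 \<le> w" using k by simp
    have n': "(122 + 2000000 * \<alpha>\<^sub>0) * w \<le> \<alpha> * real n"
      using mult_left_mono[OF n, of \<alpha>] \<alpha> by (simp add: w_def mult_ac)
    have "0 \<le> \<alpha>\<^sub>0 * w" using \<alpha> w0 by (intro mult_nonneg_nonneg) auto
    then have n1: "122 * w \<le> \<alpha> * real n" using n' by (simp add: distrib_right)
    \<comment> \<open>The summand proportional to \<open>\<alpha>\<^sub>0\<close> in the constant
      for \<open>n\<close> yields, after cancelling \<alpha>, a lower bound on \<open>n\<close> free
      of \<alpha>.\<close>
    have "\<alpha> * (2000000 * w) \<le> \<alpha>\<^sub>0 * (2000000 * w)" using \<alpha> w0 by (intro mult_right_mono) auto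
    also have "\<dots> = (122 + 2000000 * \<alpha>\<^sub>0) * w - 122 * w" by (simp add: algebra_simps)
    also have "\<dots> \<le> \<alpha> * real n" using n' w0 by linarith
    finally have n2: "2000000 * w \<le> real n" using \<alpha> by simp
    have kn: "real k \<le> real n" using w w0 n2 by linarith
    define L where "L = ln (200 * real n * real r)"
    have "L\<^sub>0 \<le> L"
    proof -
      have "1 \<le> real n" using w0 n2 by linarith
      then have "1 * real r \<le> (200 * real n) * real r" by (intro mult_right_mono) auto
      then have "exp L\<^sub>0 \<le> 200 * real n * real r" using yr y0 r\<^sub>0 \<alpha>2 by linarith
      then have "ln (exp L\<^sub>0) \<le> L" unfolding L_def by (intro ln_mono) auto
      then show ?thesis by simp
    qed
    note L = L\<^sub>0[OF this]
    have rL: "15 * 10 ^ 11 * (real k)\<^sup>2 * L ^ 3 \<le> real r"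
      unfolding L_def
    proof (rule cubed_log_le[OF _ kn])
      show "1 \<le> real k" using k by simp
      have "Y\<^sub>0 \<le> y" using y0 \<alpha>2 r\<^sub>0 by linarith
      then show "15 * 10 ^ 11 * (16 + ln y) ^ 3 \<le> y" by (rule Y\<^sub>0)
      show "1 \<le> y" using y0 \<alpha>2 r\<^sub>0 by linarith
      show "real r = (real k)\<^sup>2 * (1 + ln (real n)) ^ 6 * y" using ry by (simp add: m_def)
    qed
    \<comment> \<open>The bound 0.99 holds at almost every value of the sketch randomness, so
      integration over \<open>R\<close> is immediate.\<close>
    have "AE \<rho> in R. 0.99 \<le> measure_pmf.prob (attack enum (S \<rho>) (QR \<rho>) (real n / 16) \<delta> n r \<U>)
            {(N, M). real (card M) < \<alpha> * real n \<and>
               \<not> (\<exists>\<pi>. correct_map (S \<rho>) (real n / 16) \<delta> (query_dist (real n / 16) N M) \<pi>)}"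
      using AE_minhash_has_important_keys[OF R X(1) S] AE_space
    proof eventually_elim
      case (elim \<rho>)
      show ?case
      proof (rule prob_attack_ge[OF X])
        fix N assume N: "N \<subseteq> \<U>" "card N = n"
        have fN: "finite N" using N X finite_subset by blast
        show "measure_pmf.prob (attack_loop r enum (S \<rho>) (QR \<rho>) (real n / 16) \<delta> n r N {} (\<lambda>_. 0) [])
            {M. \<not> (real (card M) < \<alpha> * real n \<and>
              \<not> (\<exists>\<pi>. correct_map (S \<rho>) (real n / 16) \<delta> (query_dist (real n / 16) N M) \<pi>))} \<le> 1/100"
          unfolding N(2)[symmetric]
        proof (rule prob_loop_failure[OF fN _ enum _ \<delta> k \<alpha>(1) r1000 \<alpha>r])
          show "has_important_keys (S \<rho>) N k l" for l using elim(1) N(1) by blast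
          show "correct_map (S \<rho>) (real (card N) / 16) \<delta> D (QR \<rho> tr D)"
            if "\<exists>\<pi>. correct_map (S \<rho>) (real (card N) / 16) \<delta> D \<pi>" for tr D
            using QR elim(2) that unfolding follows_protocol_def N(2) by blast
        qed (use n1 n2 L rL in \<open>simp_all add: N(2) L_def w_def mult.assoc\<close>)
      qed
    qed
    then have "AE \<rho> in R. ennreal 0.99 \<le> ennreal (measure_pmf.prob (attack enum (S \<rho>) (QR \<rho>) (real n / 16) \<delta> n r \<U>)
            {(N, M). real (card M) < \<alpha> * real n \<and>
               \<not> (\<exists>\<pi>. correct_map (S \<rho>) (real n / 16) \<delta> (query_dist (real n / 16) N M) \<pi>)})"
      by eventually_elim (rule ennreal_leI)
    then have "(\<integral>\<^sup>+\<rho>. ennreal 0.99 \<partial>R) \<le> (\<integral>\<^sup>+\<rho>. measure_pmf.prob (attack enum (S \<rho>) (QR \<rho>) (real n / 16) \<delta> n r \<U>)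
            {(N, M). real (card M) < \<alpha> * real n \<and>
               \<not> (\<exists>\<pi>. correct_map (S \<rho>) (real n / 16) \<delta> (query_dist (real n / 16) N M) \<pi>)} \<partial>R)"
      by (rule nn_integral_mono_AE)
    then show ?thesis by (simp add: emeasure_space_1)
  qed
  show ?thesis
  proof (rule exI[of _ "1/100::real"], intro conjI allI impI)
    fix c \<alpha>\<^sub>0 :: real assume "0 < c" and \<alpha>\<^sub>0: "0 < \<alpha>\<^sub>0"
    have pos: "0 < 122 + 2000000 * \<alpha>\<^sub>0" "0 < \<alpha>\<^sub>0\<^sup>2 * r\<^sub>0 + 1"
      using \<alpha>\<^sub>0 r\<^sub>0 by (auto intro!: add_nonneg_pos mult_nonneg_nonneg)
    show "\<exists>C\<^sub>1>0. \<exists>C\<^sub>2>0. \<exists>d::nat.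
     \<forall>(R :: 'r measure) (\<U> :: 'a set) S QR enum (k::nat) (n::nat) (r::nat) (\<alpha>::real) (\<delta>::real).
       prob_space R \<longrightarrow> finite \<U> \<longrightarrow> n \<le> card \<U> \<longrightarrow> k \<ge> 1 \<longrightarrow>
       is_minhash R \<U> k S \<longrightarrow>
       0 \<le> \<delta> \<longrightarrow> \<delta> \<le> 1/100 \<longrightarrow> \<delta> \<le> c / sqrt (real k) \<longrightarrow>
       follows_protocol R S (real n / 16) \<delta> QR \<longrightarrow>
       set_enumeration enum \<longrightarrow>
       0 < \<alpha> \<longrightarrow> \<alpha> \<le> \<alpha>\<^sub>0 \<longrightarrow>
       real n \<ge> C\<^sub>1 * (1 / \<alpha>) * real k * ln (real k * real r) \<longrightarrow>
       real r \<ge> C\<^sub>2 * (real k ^ 2 / \<alpha> ^ 2) * (1 + ln (real n)) ^ d \<longrightarrow>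
       (\<integral>\<^sup>+\<rho>. measure_pmf.prob (attack enum (S \<rho>) (QR \<rho>) (real n / 16) \<delta> n r \<U>)
            {(N, M). real (card M) < \<alpha> * real n \<and>
               \<not> (\<exists>\<pi>. correct_map (S \<rho>) (real n / 16) \<delta> (query_dist (real n / 16) N M) \<pi>)} \<partial>R)
         \<ge> ennreal 0.99"
      by (rule exI, rule conjI[OF pos(1)], rule exI, rule conjI[OF pos(2)], rule exI[of _ 6],
          intro allI impI, rule main; assumption)
  qed simp
qed

end
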